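(* Let $(R,\mathfrak m)$ be a Noetherian local ring of dimension $d\geq 1$ with infinite residue field, let $s\ge 1$, and let $I_1,\ldots,I_s$ be $\mathfrak m$-primary ideals of $R$ with $\operatorname{grade}(I_1\cdots I_s)\geq 1$; write $\mathbf I=(I_1,\ldots,I_s)$. Let $\mathcal F=\{\mathcal F(\mathbf n)\}_{\mathbf n\in\mathbb Z^s}$ be an $\mathbf I$-admissible filtration of ideals in $R$. Let $\mathcal A_{\mathcal F}=\{a_{ij}\in I_i : j=1,\ldots,d;\ i=1,\ldots,s\}$ be a complete reduction of $\mathcal F$ and $y_j=a_{1j}\cdots a_{sj}$ for all $j=1,\ldots,d$. Let $\mathfrak a$ denote the ideal $(y_1^*,\ldots,y_d^* )$ of $G(\mathbf I)$, where $y_j^*=y_j+\mathbf I^{2\mathbf e}\in G(\mathbf I)_{\mathbf e}$ for all $j=1,\ldots,d$. Then there exist $f_1,\ldots,f_d\in\mathfrak a_{\mathbf e}$ (the degree-$\mathbf e$ component of $\mathfrak a$) such that $f_1,\ldots,f_d$ is a $G(\mathcal F)$-filter-regular sequence and $(y_1^*,\ldots,y_d^* )=(f_1,\ldots,f_d)G(\mathbf I)$.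
   Context: Notation: $\mathbb N$ includes $0$; $\mathbf e=(1,\ldots,1)\in\mathbb Z^s$. For $\mathbf m,\mathbf n\in\mathbb Z^s$, $\mathbf m\ge\mathbf n$ means $m_i\ge n_i$ for all $i$. "For all large $\mathbf n$" means for all $\mathbf n\in\mathbb N^s$ with $n_i\gg0$ for all $i$. For $\mathbf n\in\mathbb Z^s$, $\mathbf n^+=(\max\{0,n_1\},\ldots,\max\{0,n_s\})$ and $\mathbf I^{\mathbf n}=I_1^{n_1}\cdots I_s^{n_s}$, where $I_i^{n_i}=R$ if $n_i\le 0$. A $\mathbb Z^s$-graded $\mathbf I$-filtration is a family of ideals $\mathcal F=\{\mathcal F(\mathbf n)\}_{\mathbf n\in\mathbb Z^s}$ of $R$ with $\mathbf I^{\mathbf n}\subseteq\mathcal F(\mathbf n)$, $\mathcal F(\mathbf n)\mathcal F(\mathbf m)\subseteq\mathcal F(\mathbf n+\mathbf m)$, and $\mathcal F(\mathbf m)\subseteq\mathcal F(\mathbf n)$ whenever $\mathbf m\ge\mathbf n$. With indeterminates $t_1,\dots,t_s$ and $\mathbf t^{\mathbf n}=t_1^{n_1}\cdots t_s^{n_s}$, put $\mathcal R'(\mathcal F)=\bigoplus_{\mathbf n\in\mathbb Z^s}\mathcal F(\mathbf n)\mathbf t^{\mathbf n}$ and $\mathcal R'(\mathbf I)=\bigoplus_{\mathbf n\in\mathbb Z^s}\mathbf I^{\mathbf n}\mathbf t^{\mathbf n}$. $\mathcal F$ is $\mathbf I$-admissible if $\mathcal F(\mathbf n)=\mathcal F(\mathbf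 n^+)$ for all $\mathbf n\in\mathbb Z^s$ and $\mathcal R'(\mathcal F)$ is a finite $\mathcal R'(\mathbf I)$-module. Associated multigraded rings: $G(\mathcal F)=\bigoplus_{\mathbf n\in\mathbb N^s}\mathcal F(\mathbf n)/\mathcal F(\mathbf n+\mathbf e)$ and $G(\mathbf I)=\bigoplus_{\mathbf n\in\mathbb N^s}\mathbf I^{\mathbf n}/\mathbf I^{\mathbf n+\mathbf e}$; $G(\mathcal F)$ is regarded as a (finitely generated) graded $G(\mathbf I)$-module. Complete reductions: a set $\{a_{ij}\in I_i\mid j=1,\ldots,d;\ i=1,\ldots,s\}$ is a complete reduction of $\mathcal F$ if, with $y_j=a_{1j}\cdots a_{sj}$, there is $\mathbf m\in\mathbb N^s$ such that $(y_1,\ldots,y_d)\mathcal F(\mathbf n)=\mathcal F(\mathbf n+\mathbf e)$ for all $\mathbf n\ge\mathbf m$. Filter-regular sequences: for an $\mathbb N^s$-graded ring $S$ and a finitely generated $\mathbb Z^s$-graded $S$-module $M$, a homogeneous element $a\in S$ is $M$-filter-regular if $(0:_M a)_{\mathbf n}=0$ for all large $\mathbf n$. Homogeneous elements $a_1,\ldots,a_r\in S$ form an $M$-filter-regular sequence if $a_i$ is $M/(a_1,\ldots,a_{i-1})M$-filter-regular for all $i=1,\ldots,r$. Here $S=G(\mathbf I)$ and $M=G(\mathcal F)$. *)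

theory Defs
  imports
    "HOL-Library.Function_Algebras"
    "HOL-Library.Extended_Nat"
    "HOL-Algebra.Ring_Divisibility"
    "HOL-Algebra.Ideal_Product"
begin

section \<open>Local rings, dimension, primary ideals, grade\<close>

definition local_ring :: "('a, 'b) ring_scheme \<Rightarrow> 'a set \<Rightarrow> bool"
  where "local_ring R \<mm> \<longleftrightarrow> cring R \<and> maximalideal \<mm> R \<and> (\<forall>M. maximalideal M R \<longrightarrow> M = \<mm>)"

definition krull_dim :: "('a, 'b) ring_scheme \<Rightarrow> enat"
  where "krull_dim R =
    Sup {enat n | n. \<exists>P. (\<forall>i\<le>n. primeideal (P i) R) \<and> (\<forall>i<n. P i \<subset> P (Suc i))}"

definition ideal_radical :: "('a, 'b) ring_scheme \<Rightarrow> 'a set \<Rightarrow> 'a set"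
  where "ideal_radical R Q = {x \<in> carrier R. \<exists>n::nat. x [^]\<^bsub>R\<^esub> n \<in> Q}"

definition primary_ideal :: "('a, 'b) ring_scheme \<Rightarrow> 'a set \<Rightarrow> bool"
  where "primary_ideal R Q \<longleftrightarrow> ideal Q R \<and> Q \<noteq> carrier R \<and>
    (\<forall>a\<in>carrier R. \<forall>b\<in>carrier R. a \<otimes>\<^bsub>R\<^esub> b \<in> Q \<longrightarrow> a \<in> Q \<or> b \<in> ideal_radical R Q)"

definition primary_to :: "('a, 'b) ring_scheme \<Rightarrow> 'a set \<Rightarrow> 'a set \<Rightarrow> bool"
  where "primary_to R \<pp> Q \<longleftrightarrow> primary_ideal R Q \<and> ideal_radical R Q = \<pp>"

definition nonzerodivisor_mod :: "('a, 'b) ring_scheme \<Rightarrow> 'a set \<Rightarrow> 'a \<Rightarrow> bool"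
  where "nonzerodivisor_mod R J x \<longleftrightarrow>
    (\<forall>Y\<in>carrier (R Quot J). (J +>\<^bsub>R\<^esub> x) \<otimes>\<^bsub>R Quot J\<^esub> Y = \<zero>\<^bsub>R Quot J\<^esub> \<longrightarrow> Y = \<zero>\<^bsub>R Quot J\<^esub>)"

definition regular_sequence :: "('a, 'b) ring_scheme \<Rightarrow> 'a list \<Rightarrow> bool"
  where "regular_sequence R xs \<longleftrightarrow> set xs \<subseteq> carrier R \<and> Idl\<^bsub>R\<^esub> (set xs) \<noteq> carrier R \<and>
    (\<forall>k<length xs. nonzerodivisor_mod R (Idl\<^bsub>R\<^esub> (set (take k xs))) (xs ! k))"

definition ideal_grade :: "('a, 'b) ring_scheme \<Rightarrow> 'a set \<Rightarrow> enat"
  where "ideal_grade R J = Sup {enat (length xs) | xs. set xs \<subseteq> J \<and> regular_sequence R xs}"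


section \<open>Modules\<close>

definition gen_submodule :: "('r, 'b) ring_scheme \<Rightarrow> ('r, 'm, 'c) module_scheme \<Rightarrow> 'm set \<Rightarrow> 'm set"
  where "gen_submodule S M Y = \<Inter>{N. submodule N S M \<and> Y \<subseteq> N}"

definition finite_module :: "('r, 'b) ring_scheme \<Rightarrow> ('r, 'm, 'c) module_scheme \<Rightarrow> bool"
  where "finite_module S M \<longleftrightarrow>
    (\<exists>Y. finite Y \<and> Y \<subseteq> carrier M \<and> gen_submodule S M Y = carrier M)"

definition ideal_smult :: "('r, 'b) ring_scheme \<Rightarrow> 'r set \<Rightarrow> ('r, 'm, 'c) module_scheme \<Rightarrow> 'm set"
  where "ideal_smult S J M = gen_submodule S M {b \<odot>\<^bsub>M\<^esub> x | b x. b \<in> J \<and> x \<in> carrier M}"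

text \<open>The library's module record extends the ring record; a quotient module carries no ring
  multiplication, so these two fields are left unspecified.\<close>

definition quot_module :: "('r, 'm, 'c) module_scheme \<Rightarrow> 'm set \<Rightarrow> ('r, 'm set) module"
  where "quot_module M N =
    \<lparr>carrier = a_rcosets\<^bsub>M\<^esub> N, mult = undefined, one = undefined, zero = N, add = set_add M,
     smult = (\<lambda>b Y. \<Union>x\<in>Y. N +>\<^bsub>M\<^esub> (b \<odot>\<^bsub>M\<^esub> x))\<rparr>"


section \<open>Filtrations\<close>

text \<open>Multidegrees in \<open>\<int>\<^sup>s\<close> are functions \<open>'s \<Rightarrow> int\<close> on a finite index type with the pointwise
  order and operations; in particular \<open>1\<close> is the vector \<open>(1,\<dots>,1)\<close>, and \<open>n \<ge> 0\<close> says that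
  \<open>n\<close> lies in \<open>\<nat>\<^sup>s\<close>.\<close>

type_synonym 's mdeg = "'s \<Rightarrow> int"

definition pos_part :: "'s mdeg \<Rightarrow> 's mdeg"
  where "pos_part n = (\<lambda>i. max 0 (n i))"

text \<open>Powers and products are taken in the multiplicative monoid of ideals, whose unit is the
  whole ring; \<open>nat\<close> sends nonpositive exponents to \<open>0\<close>.\<close>

definition ideal_mpow :: "('a, 'b) ring_scheme \<Rightarrow> ('s::finite \<Rightarrow> 'a set) \<Rightarrow> 's mdeg \<Rightarrow> 'a set"
  where "ideal_mpow R I n =
    (\<Otimes>\<^bsub>ideals_set R\<^esub>i\<in>UNIV. I i [^]\<^bsub>ideals_set R\<^esub> nat (n i))"

definition ideal_filtration ::
    "('a, 'b) ring_scheme \<Rightarrow> ('s::finite \<Rightarrow> 'a set) \<Rightarrow> ('s mdeg \<Rightarrow> 'a set) \<Rightarrow> bool"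
  where "ideal_filtration R I F \<longleftrightarrow>
    (\<forall>n. ideal (F n) R) \<and>
    (\<forall>n. ideal_mpow R I n \<subseteq> F n) \<and>
    (\<forall>n m. F n \<cdot>\<^bsub>R\<^esub> F m \<subseteq> F (n + m)) \<and>
    (\<forall>n m. n \<le> m \<longrightarrow> F m \<subseteq> F n)"

text \<open>The extended Rees ring \<open>\<Oplus>\<^sub>n F(n) t\<^sup>n\<close>: a Laurent polynomial is encoded by its finitely
  supported coefficient function. The same multiplication serves as ring multiplication and as
  scalar multiplication, so the Rees ring of \<open>F\<close> can be used as a ring and as a module over
  the Rees ring of a smaller filtration.\<close>

definition rees_mult ::
    "('a, 'b) ring_scheme \<Rightarrow> ('s mdeg \<Rightarrow> 'a) \<Rightarrow> ('s mdeg \<Rightarrow> 'a) \<Rightarrow> ('s mdeg \<Rightarrow> 'a)"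
  where "rees_mult R f g =
    (\<lambda>n. \<Oplus>\<^bsub>R\<^esub>p\<in>{p. f p \<noteq> \<zero>\<^bsub>R\<^esub>}. f p \<otimes>\<^bsub>R\<^esub> g (n - p))"

definition ext_rees ::
    "('a, 'b) ring_scheme \<Rightarrow> ('s mdeg \<Rightarrow> 'a set) \<Rightarrow> ('s mdeg \<Rightarrow> 'a, 's mdeg \<Rightarrow> 'a) module"
  where "ext_rees R F =
    \<lparr>carrier = {f. (\<forall>n. f n \<in> F n) \<and> finite {n. f n \<noteq> \<zero>\<^bsub>R\<^esub>}},
     mult = rees_mult R,
     one = (\<lambda>n. if n = 0 then \<one>\<^bsub>R\<^esub> else \<zero>\<^bsub>R\<^esub>),
     zero = (\<lambda>n. \<zero>\<^bsub>R\<^esub>),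
     add = (\<lambda>f g n. f n \<oplus>\<^bsub>R\<^esub> g n),
     smult = rees_mult R\<rparr>"

definition admissible_filtration ::
    "('a, 'b) ring_scheme \<Rightarrow> ('s::finite \<Rightarrow> 'a set) \<Rightarrow> ('s mdeg \<Rightarrow> 'a set) \<Rightarrow> bool"
  where "admissible_filtration R I F \<longleftrightarrow>
    ideal_filtration R I F \<and>
    (\<forall>n. F n = F (pos_part n)) \<and>
    finite_module (ext_rees R (ideal_mpow R I)) (ext_rees R F)"

definition column_prod :: "('a, 'b) ring_scheme \<Rightarrow> ('s::finite \<Rightarrow> nat \<Rightarrow> 'a) \<Rightarrow> nat \<Rightarrow> 'a"
  where "column_prod R a j = (\<Otimes>\<^bsub>R\<^esub>i\<in>UNIV. a i j)"

definition complete_reduction ::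
    "('a, 'b) ring_scheme \<Rightarrow> ('s::finite \<Rightarrow> 'a set) \<Rightarrow> ('s mdeg \<Rightarrow> 'a set) \<Rightarrow> nat
      \<Rightarrow> ('s \<Rightarrow> nat \<Rightarrow> 'a) \<Rightarrow> bool"
  where "complete_reduction R I F d a \<longleftrightarrow>
    (\<forall>i. \<forall>j\<in>{1..d}. a i j \<in> I i) \<and>
    (\<exists>m\<ge>0. \<forall>n\<ge>m. (Idl\<^bsub>R\<^esub> (column_prod R a ` {1..d})) \<cdot>\<^bsub>R\<^esub> F n = F (n + 1))"


section \<open>Associated multigraded rings\<close>

text \<open>An element of \<open>\<Oplus>\<^bsub>n\<ge>0\<^esub> F(n) / F(n + 1)\<close> is encoded as a family of cosets, almost all of them
  zero, indexed by all of \<open>\<int>\<^sup>s\<close>; outside \<open>\<nat>\<^sup>s\<close> it takes the value \<open>F(n + 1)\<close>, which is the zero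
  coset in every degree.\<close>

definition gr_mult ::
    "('a, 'b) ring_scheme \<Rightarrow> ('s mdeg \<Rightarrow> 'a set) \<Rightarrow> ('s mdeg \<Rightarrow> 'a set) \<Rightarrow> ('s mdeg \<Rightarrow> 'a set)
      \<Rightarrow> ('s mdeg \<Rightarrow> 'a set)"
  where "gr_mult R F f g =
    (\<lambda>n. \<Oplus>\<^bsub>R Quot F (n + 1)\<^esub>p\<in>{0..n}. [mod F (n + 1):] f p \<Otimes>\<^bsub>R\<^esub> g (n - p))"

definition gr_elem ::
    "('a, 'b) ring_scheme \<Rightarrow> ('s mdeg \<Rightarrow> 'a set) \<Rightarrow> 's mdeg \<Rightarrow> 'a \<Rightarrow> ('s mdeg \<Rightarrow> 'a set)"
  where "gr_elem R F n x = (\<lambda>p. if p = n then F (p + 1) +>\<^bsub>R\<^esub> x else F (p + 1))"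

text \<open>As for the Rees ring, \<open>assoc_gr R F\<close> serves both as a ring and as a module over
  \<open>assoc_gr R E\<close> for a filtration \<open>E\<close> with \<open>E(n) \<subseteq> F(n)\<close>: in \<open>f \<odot> g\<close> the components of
  \<open>f\<close> are cosets of the \<open>E(p + 1)\<close> and those of the result are cosets of the \<open>F(n + 1)\<close>.\<close>

definition assoc_gr ::
    "('a, 'b) ring_scheme \<Rightarrow> ('s mdeg \<Rightarrow> 'a set) \<Rightarrow> ('s mdeg \<Rightarrow> 'a set, 's mdeg \<Rightarrow> 'a set) module"
  where "assoc_gr R F =
    \<lparr>carrier = {f. (\<forall>n\<ge>0. f n \<in> (\<lambda>x. F (n + 1) +>\<^bsub>R\<^esub> x) ` F n) \<and>
                   (\<forall>n. \<not> 0 \<le> n \<longrightarrow> f n = F (n + 1)) \<and>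
                   finite {n. f n \<noteq> F (n + 1)}},
     mult = gr_mult R F,
     one = gr_elem R F 0 \<one>\<^bsub>R\<^esub>,
     zero = (\<lambda>n. F (n + 1)),
     add = (\<lambda>f g n. f n <+>\<^bsub>R\<^esub> g n),
     smult = gr_mult R F\<rparr>"

definition assoc_gr_comp ::
    "('a, 'b) ring_scheme \<Rightarrow> ('s mdeg \<Rightarrow> 'a set) \<Rightarrow> 's mdeg \<Rightarrow> ('s mdeg \<Rightarrow> 'a set) set"
  where "assoc_gr_comp R F n = {f \<in> carrier (assoc_gr R F). \<forall>p. p \<noteq> n \<longrightarrow> f p = F (p + 1)}"


section \<open>Filter-regular sequences\<close>

text \<open>A grading on a ring or module is given by its family of homogeneous components.\<close>

definition filter_regular ::
    "('s mdeg \<Rightarrow> 'r set) \<Rightarrow> ('r, 'm, 'c) module_scheme \<Rightarrow> ('s mdeg \<Rightarrow> 'm set) \<Rightarrow> 'r \<Rightarrow> bool"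
  where "filter_regular Sgr M Mgr b \<longleftrightarrow>
    (\<exists>k\<ge>0. b \<in> Sgr k) \<and>
    (\<exists>m\<ge>0. \<forall>n\<ge>m. {x \<in> Mgr n. b \<odot>\<^bsub>M\<^esub> x = \<zero>\<^bsub>M\<^esub>} = {\<zero>\<^bsub>M\<^esub>})"

definition filter_regular_seq ::
    "('r, 'b) ring_scheme \<Rightarrow> ('s mdeg \<Rightarrow> 'r set) \<Rightarrow> ('r, 'm, 'c) module_scheme
      \<Rightarrow> ('s mdeg \<Rightarrow> 'm set) \<Rightarrow> nat \<Rightarrow> (nat \<Rightarrow> 'r) \<Rightarrow> bool"
  where "filter_regular_seq S Sgr M Mgr r f \<longleftrightarrow>
    (\<forall>i\<in>{1..r}. let N = ideal_smult S (Idl\<^bsub>S\<^esub> (f ` {1..<i})) M in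
       filter_regular Sgr (quot_module M N) (\<lambda>n. (\<lambda>x. N +>\<^bsub>M\<^esub> x) ` Mgr n) (f i))"

end

theory Submission
  imports Defs
begin

text \<open>A graded submodule of a quotient of \<open>G(F)\<close> is a family of ideals \<open>K(n)\<close> of \<open>R\<close>, stable under
  multiplication by the ideals \<open>I\<^sub>i\<close> and lying between two fixed families \<open>P(n) \<subseteq> F(n)\<close>; such families
  satisfy the ascending chain condition by an argument in the style of Hilbert's basis theorem.
  The generators are \<open>f\<^sub>t = \<Sum>\<^sub>j t\<^sup>j\<^sup>-\<^sup>1 y\<^sub>j\<^sup>*\<close> for parameters \<open>t\<close> that are pairwise distinct modulo
  the maximal ideal: by Vandermonde, any \<open>d\<close> of them generate \<open>(y\<^sub>1\<^sup>*, \<dots>, y\<^sub>d\<^sup>*)\<close>. For each quotient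
  \<open>M\<close> of \<open>G(F)\<close> only finitely many \<open>f\<^sub>t\<close> fail to be \<open>M\<close>-filter-regular. Indeed, call a finite set \<open>A\<close>
  of parameters irregular if the common annihilator \<open>W\<^sub>A\<close> of the \<open>f\<^sub>t\<close>, \<open>t \<in> A\<close>, does not vanish in
  all large degrees. Sets with \<open>d\<close> elements are never irregular, and if infinitely many maximal
  irregular sets existed, the sum of the corresponding modules \<open>W\<^sub>A\<close> would be direct in large degrees,
  against the chain condition. Hence \<open>d\<close> parameters can be chosen one after the other; no primary
  decomposition or prime avoidance is needed.\<close>

section \<open>Chains of stable families of ideals\<close>

text \<open>Taking the \<open>f\<^sub>t\<close> on a moment curve separates the two demands on the
  generators: any \<open>d\<close> distinct parameters give the right ideal, so the choice of a new
  parameter only has to secure filter-regularity. The exceptional set depends on the quotient of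
  \<open>G(F)\<close> reached so far, but each time it is finite while the parameters are infinitely
  many. That a set \<open>A\<close> of \<open>d\<close> parameters is regular rests on the complete
  reduction: all \<open>y\<^sub>j\<close> kill \<open>W\<^sub>A\<close>, and in high degrees every
  step by \<open>(1,\<dots>,1)\<close> is generated by the \<open>y\<^sub>j\<close>. By itself this
  controls one diagonal at a time. The obstacle is that large multidegrees can lie on infinitely
  many diagonals, each with a bound of its own; the chain condition is what makes the bound uniform.
  The contradiction for infinitely many maximal irregular sets: a stationary chain of partial sums
  puts one \<open>W\<^sub>A\<close> inside the sum of its predecessors, while directness makes it
  meet that sum trivially in large degrees.\<close>

lemma double_chain_stabilises:
  fixes L :: "nat \<Rightarrow> nat \<Rightarrow> 'b::order"
  assumes mono: "\<And>q q' j j'. q \<le> q' \<Longrightarrow> j \<le> j' \<Longrightarrow> L q j \<le> L q' j'"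
    and diag: "\<exists>N. \<forall>k\<ge>N. L k k = L N N"
    and rows: "\<And>q. \<exists>N. \<forall>j\<ge>N. L q j = L q N"
  shows "\<exists>N. \<forall>q. \<forall>j\<ge>N. L q j = L q N"
proof -
  obtain N where N: "\<And>k. k \<ge> N \<Longrightarrow> L k k = L N N" using diag by blast
  obtain M where M: "\<And>q j. j \<ge> M q \<Longrightarrow> L q j = L q (M q)" using rows by metis
  define N' where "N' = Max (insert N (M ` {..N}))"
  have N'M: "M q \<le> N'" if "q \<le> N" for q
    unfolding N'_def using that by (intro Max_ge) auto
  have N'N: "N \<le> N'" unfolding N'_def by (intro Max_ge) auto
  have "L q j = L q N'" if j: "j \<ge> N'" for q j
  proof (cases "q \<le> N")
    case True
    then show ?thesis using M[of q j] M[of q N'] N'M[OF True] j by simp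
  next
    case False
    \<comment> \<open>Rows beyond \<open>N\<close> are squeezed between the limit
      \<open>L N N\<close> and a diagonal term, so all of them are constant from column
      \<open>N\<close> on; only the finitely many rows up to \<open>N\<close> need bounds of their
      own.\<close>
    have "L q j' = L N N" if "j' \<ge> N" for j'
    proof (rule antisym)
      show "L q j' \<le> L N N"
        using mono[of q "max q j'" j' "max q j'"] N[of "max q j'"] that by simp
      show "L N N \<le> L q j'" using mono[of N q N j'] False that by simp
    qed
    then show ?thesis using j N'N by simp
  qed
  then show ?thesis by blast
qed

context ring
begin

lemma mem_set_add_iff: "x \<in> A <+>\<^bsub>R\<^esub> B \<longleftrightarrow> (\<exists>u\<in>A. \<exists>v\<in>B. x = u \<oplus> v)"
  by (auto simp: set_add_def')

lemma ideal_zero: "ideal J R \<Longrightarrow> \<zero> \<in> J"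
  by (simp add: additive_subgroup.zero_closed ideal.axioms(1))

lemma ideal_add: "ideal J R \<Longrightarrow> x \<in> J \<Longrightarrow> y \<in> J \<Longrightarrow> x \<oplus> y \<in> J"
  by (simp add: additive_subgroup.a_closed ideal.axioms(1))

lemma ideal_uminus: "ideal J R \<Longrightarrow> x \<in> J \<Longrightarrow> \<ominus> x \<in> J"
  by (simp add: additive_subgroup.a_inv_closed ideal.axioms(1))

lemma ideal_minus: "ideal J R \<Longrightarrow> x \<in> J \<Longrightarrow> y \<in> J \<Longrightarrow> x \<ominus> y \<in> J"
  by (simp add: a_minus_def ideal_add ideal_uminus)

lemma ideal_carr: "ideal J R \<Longrightarrow> x \<in> J \<Longrightarrow> x \<in> carrier R"
  by (rule ideal.Icarr)

lemma ideal_mult_l: "ideal J R \<Longrightarrow> x \<in> J \<Longrightarrow> r \<in> carrier R \<Longrightarrow> r \<otimes> x \<in> J"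
  by (rule ideal.I_l_closed)

lemma ideal_sub_set_add_l: "ideal J R \<Longrightarrow> A \<subseteq> carrier R \<Longrightarrow> A \<subseteq> A <+>\<^bsub>R\<^esub> J"
  using ideal_zero r_zero by (auto simp: mem_set_add_iff subset_iff) (metis r_zero)

lemma ideal_sub_set_add_r: "ideal J R \<Longrightarrow> A \<subseteq> carrier R \<Longrightarrow> A \<subseteq> J <+>\<^bsub>R\<^esub> A"
  using ideal_zero by (auto simp: mem_set_add_iff subset_iff) (metis l_zero)

lemma set_add_sub_ideal: "ideal J R \<Longrightarrow> A \<subseteq> J \<Longrightarrow> B \<subseteq> J \<Longrightarrow> A <+>\<^bsub>R\<^esub> B \<subseteq> J"
  unfolding mem_set_add_iff subset_iff by (metis ideal_add)

lemma ideal_diff_mem: 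
  assumes "ideal J R" "x \<oplus> y \<in> J" "y \<in> J" "x \<in> carrier R"
  shows "x \<in> J"
proof -
  have "x = (x \<oplus> y) \<ominus> y" using assms ideal_carr[OF assms(1,3)]
    by (simp add: a_minus_def a_assoc r_neg)
  then show ?thesis using ideal_minus[OF assms(1-3)] by simp
qed

end

context cring
begin

lemma ideal_intro:
  assumes "J \<subseteq> carrier R" "\<zero> \<in> J" "\<And>x y. x \<in> J \<Longrightarrow> y \<in> J \<Longrightarrow> x \<oplus> y \<in> J"
    "\<And>r x. r \<in> carrier R \<Longrightarrow> x \<in> J \<Longrightarrow> r \<otimes> x \<in> J"
  shows "ideal J R"
proof (rule idealI)
  show "ring R" by (rule ring_axioms)
  show "subgroup J (add_monoid R)"
  proof (rule subgroup.intro)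
    fix x assume x: "x \<in> J"
    have "\<ominus> x = (\<ominus> \<one>) \<otimes> x" using x assms(1) by (simp add: l_minus subset_iff)
    then show "inv\<^bsub>add_monoid R\<^esub> x \<in> J"
      using assms(4)[OF _ x, of "\<ominus> \<one>"] by (simp add: a_inv_def[symmetric])
  qed (use assms in auto)
  show "\<And>a x. a \<in> J \<Longrightarrow> x \<in> carrier R \<Longrightarrow> x \<otimes> a \<in> J" using assms(4) by blast
  show "\<And>a x. a \<in> J \<Longrightarrow> x \<in> carrier R \<Longrightarrow> a \<otimes> x \<in> J"
    using assms(1,4) m_comm by (metis subsetD)
qed

lemma ideal_image_mult:
  assumes "ideal J R" "c \<in> carrier R"
  shows "ideal ((\<otimes>) c ` J) R"
proof (rule ideal_intro)
  note J = ideal_carr[OF assms(1)]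
  show "(\<otimes>) c ` J \<subseteq> carrier R" using assms(2) J by auto
  show "\<zero> \<in> (\<otimes>) c ` J" using ideal_zero[OF assms(1)] assms(2) by (metis imageI r_null)
  fix x y assume "x \<in> (\<otimes>) c ` J" "y \<in> (\<otimes>) c ` J"
  then show "x \<oplus> y \<in> (\<otimes>) c ` J"
    using ideal_add[OF assms(1)] J assms(2) by (auto simp: r_distr[symmetric])
next
  fix r x assume r: "r \<in> carrier R" and "x \<in> (\<otimes>) c ` J"
  then obtain u where u: "u \<in> J" "x = c \<otimes> u" by blast
  have "r \<otimes> x = c \<otimes> (r \<otimes> u)" using u r assms ideal_carr[OF assms(1)] by (simp add: m_lcomm)
  then show "r \<otimes> x \<in> (\<otimes>) c ` J" using ideal_mult_l[OF assms(1) u(1) r] by blast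
qed

lemma ideal_preimage_mult:
  assumes "ideal J R" "ideal K R" "c \<in> carrier R"
  shows "ideal {x \<in> J. c \<otimes> x \<in> K} R"
proof (rule ideal_intro)
  note J = ideal_carr[OF assms(1)] 
  show "{x \<in> J. c \<otimes> x \<in> K} \<subseteq> carrier R" using J by auto
  show "\<zero> \<in> {x \<in> J. c \<otimes> x \<in> K}" using ideal_zero assms by simp
  show "x \<oplus> y \<in> {x \<in> J. c \<otimes> x \<in> K}" if "x \<in> {x \<in> J. c \<otimes> x \<in> K}" "y \<in> {x \<in> J. c \<otimes> x \<in> K}" for x y
    using that ideal_add assms J by (simp add: r_distr)
  show "r \<otimes> x \<in> {x \<in> J. c \<otimes> x \<in> K}" if "r \<in> carrier R" "x \<in> {x \<in> J. c \<otimes> x \<in> K}" for r x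
    using that assms J by (auto simp: ideal_mult_l m_lcomm[of c r])
qed

text \<open>An operator multiplies by \<open>b\<close> and raises the degree by
  \<open>\<delta>\<close>. Degrees form a ring, not merely a group, so that a \<open>q\<close>-fold
  shift can be written \<open>of_nat q * \<delta>\<close>; for integer vectors with pointwise
  operations this is the ordinary multiple.\<close>

definition stable_family :: "('a \<times> 'g::comm_ring_1) list \<Rightarrow> ('g \<Rightarrow> 'a set) \<Rightarrow> bool"
  where "stable_family ops K \<longleftrightarrow>
    (\<forall>n. ideal (K n) R) \<and> (\<forall>(b, \<delta>)\<in>set ops. \<forall>n. \<forall>x\<in>K n. b \<otimes> x \<in> K (n + \<delta>))"

text \<open>This is \<open>F n \<subseteq> P n + \<Sum> b F (n - \<delta>)\<close> outside
  \<open>D\<close>: modulo \<open>P\<close> the operators produce everything from other degrees.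
  Testing against all ideals \<open>J\<close> replaces the explicit sum of ideals.\<close>

definition generated_outside ::
    "('a \<times> 'g::comm_ring_1) list \<Rightarrow> 'g set \<Rightarrow> ('g \<Rightarrow> 'a set) \<Rightarrow> ('g \<Rightarrow> 'a set) \<Rightarrow> bool"
  where "generated_outside ops D P F \<longleftrightarrow>
    (\<forall>n. n \<notin> D \<longrightarrow> (\<forall>J. ideal J R \<longrightarrow> P n \<subseteq> J \<longrightarrow>
      (\<forall>(b, \<delta>)\<in>set ops. \<forall>x\<in>F (n - \<delta>). b \<otimes> x \<in> J) \<longrightarrow> F n \<subseteq> J))"

lemma stable_familyI:
  "(\<And>n. ideal (K n) R) \<Longrightarrow> (\<And>b \<delta> n x. (b, \<delta>) \<in> set ops \<Longrightarrow> x \<in> K n \<Longrightarrow> b \<otimes> x \<in> K (n + \<delta>)) \<Longrightarrow>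
    stable_family ops K"
  unfolding stable_family_def by blast

lemma stable_familyD:
  assumes "stable_family ops K"
  shows "ideal (K n) R" "(b, \<delta>) \<in> set ops \<Longrightarrow> x \<in> K n \<Longrightarrow> b \<otimes> x \<in> K (n + \<delta>)"
  using assms unfolding stable_family_def by blast+

lemma stable_family_pow:
  assumes "stable_family ops K" "(b, \<delta>) \<in> set ops" "b \<in> carrier R" "x \<in> K n"
  shows "(b [^] (q::nat)) \<otimes> x \<in> K (n + of_nat q * \<delta>)"
proof (induction q)
  case 0
  then show ?case using assms ideal_carr[OF stable_familyD(1)[OF assms(1)]] by simp
next
  case (Suc q)
  have "x \<in> carrier R" using assms ideal_carr[OF stable_familyD(1)[OF assms(1)]] by blast
  then have "b [^] Suc q \<otimes> x = b \<otimes> (b [^] q \<otimes> x)" using assms(3)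
    by (metis m_assoc nat_pow_Suc2 nat_pow_closed)
  moreover have "n + of_nat (Suc q) * \<delta> = (n + of_nat q * \<delta>) + \<delta>" by (simp add: algebra_simps)
  ultimately show ?case using stable_familyD(2)[OF assms(1,2) Suc] by metis
qed

end

lemma (in noetherian_ring) ideal_chain_stabilises:
  fixes K :: "nat \<Rightarrow> 'a set"
  assumes "\<And>j. ideal (K j) R" "\<And>j. K j \<subseteq> K (Suc j)"
  shows "\<exists>N. \<forall>j\<ge>N. K j = K N"
proof -
  have mono: "K i \<subseteq> K j" if "i \<le> j" for i j using lift_Suc_mono_le[of K, OF assms(2) that] .
  have "subset.chain {I. ideal I R} (range K)"
    unfolding pred_on.chain_def
  proof (intro conjI ballI)
    fix A B assume "A \<in> range K" "B \<in> range K"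
    then obtain i j where "A = K i" "B = K j" by blast
    then show "(\<subset>)\<^sup>=\<^sup>= A B \<or> (\<subset>)\<^sup>=\<^sup>= B A" using mono[of i j] mono[of j i] linear[of i j] by auto
  qed (use assms(1) in auto)
  then have "\<Union>(range K) \<in> range K" by (rule ideal_chain_is_trivial[rotated]) simp
  then obtain N where N: "\<Union>(range K) = K N" by blast
  then have "K j = K N" if "j \<ge> N" for j using mono[OF that] by blast
  then show ?thesis by blast
qed

locale noetherian_cring = noetherian_ring + cring
begin

text \<open>Induction on the number of operators: replacing \<open>P(n)\<close> by \<open>P(n) + b F(n - \<delta>)\<close> makes the
  operator \<open>b\<close> of degree \<open>\<delta>\<close> superfluous. The family \<open>L q\<close> below collects the leading coefficients of
  the elements of \<open>K\<close> divisible by \<open>b\<^sup>q\<close> modulo \<open>P\<close>.\<close>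

theorem stable_family_chain_stabilises:
  fixes ops :: "('a \<times> 'g::comm_ring_1) list"
  assumes "finite D" "fst ` set ops \<subseteq> carrier R"
    and "stable_family ops P" "stable_family ops F"
    and "generated_outside ops D P F"
    and "\<And>b \<delta> n. (b, \<delta>) \<in> set ops \<Longrightarrow> \<exists>q::nat. F (n - of_nat q * \<delta>) \<subseteq> P (n - of_nat q * \<delta>)"
    and "\<And>j. stable_family ops (K j)" "\<And>j n. P n \<subseteq> K j n" "\<And>j n. K j n \<subseteq> F n"
    and "\<And>j n. K j n \<subseteq> K (Suc j) n"
  shows "\<exists>N. \<forall>j\<ge>N. K j = K N"
  using assms
proof (induction ops arbitrary: P K)
  case Nil
  have id: "\<And>j n. ideal (K j n) R" using Nil.prems(7) by (rule stable_familyD)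
  have "\<exists>N. \<forall>j\<ge>N. K j n = K N n" for n
    using id Nil.prems(10) by (intro ideal_chain_stabilises) auto
  then obtain M where M: "\<And>n j. j \<ge> M n \<Longrightarrow> K j n = K (M n) n" by metis
  define N where "N = Max (insert 0 (M ` D))"
  have "K j n = K N n" if "j \<ge> N" for j n
  proof (cases "n \<in> D")
    case True
    then have "M n \<le> N" using Nil.prems(1) unfolding N_def by (auto intro: Max_ge)
    then show ?thesis using M[of n j] M[of n N] that by simp
  next
    case False
    \<comment> \<open>With no operators left, the test ideal \<open>J = P n\<close> is admissible,
      so outside the finite set \<open>D\<close> the chain is squeezed between equal bounds.\<close>
    then have "F n \<subseteq> P n" using Nil.prems(5) stable_familyD(1)[OF Nil.prems(3)]
      unfolding generated_outside_def by auto
    then show ?thesis using Nil.prems(8)[of n] Nil.prems(9)[of _ n] by blast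
  qed
  then show ?case by blast
next
  case (Cons op ops)
  obtain b \<delta> where op: "op = (b, \<delta>)" by force
  have b: "b \<in> carrier R" using Cons.prems(2) op by auto
  have ops: "b' \<in> carrier R" if "(b', \<delta>') \<in> set ops" for b' \<delta>' using Cons.prems(2) that by force
  have bset: "(b, \<delta>) \<in> set (op # ops)" using op by simp
  note sP = stable_familyD[OF Cons.prems(3)] and sF = stable_familyD[OF Cons.prems(4)]
  note sK = stable_familyD[OF Cons.prems(7)]
  note PK = Cons.prems(8) and KF = Cons.prems(9) and KS = Cons.prems(10)
  have Fc: "\<And>n x. x \<in> F n \<Longrightarrow> x \<in> carrier R" using sF(1) ideal_carr by blast
  have Kc: "\<And>j n x. x \<in> K j n \<Longrightarrow> x \<in> carrier R" using sK(1) ideal_carr by blast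
  define c where "c q = b [^] q" for q :: nat
  have cS: "c (Suc q) = b \<otimes> c q" for q unfolding c_def using b by (rule nat_pow_Suc2)
  have c0: "c 0 = \<one>" by (simp add: c_def)
  have bq: "\<And>q::nat. c q \<in> carrier R" using b by (simp add: c_def)
  define P' where "P' n = P n <+>\<^bsub>R\<^esub> (\<otimes>) b ` F (n - \<delta>)" for n
  define B where "B q j n = K j (n + of_nat q * \<delta>) <+>\<^bsub>R\<^esub> (\<otimes>) (c (Suc q)) ` F (n - \<delta>)" for q j n
  \<comment> \<open>Membership of \<open>x\<close> says that some element of \<open>K j\<close> in
    degree \<open>n + of_nat q * \<delta>\<close> agrees with \<open>c q \<otimes> x\<close> up to a
    multiple of the next power of \<open>b\<close>. These families lie between \<open>P'\<close> and
    \<open>F\<close> and are stable under the remaining operators, so the induction hypothesis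
    applies to them.\<close>
  define L where "L q j n = {x \<in> F n. c q \<otimes> x \<in> B q j n}" for q j :: nat and n
  have idB: "ideal (B q j n) R" for q j n
    unfolding B_def using sK(1) sF(1) bq by (intro add_ideals ideal_image_mult)
  have idP': "ideal (P' n) R" for n
    unfolding P'_def using sP(1) sF(1) b by (intro add_ideals ideal_image_mult)
  have idL: "ideal (L q j n) R" for q j n
    unfolding L_def by (intro ideal_preimage_mult idB sF(1) bq)
  have KB: "K j (n + of_nat q * \<delta>) \<subseteq> B q j n" for q j n
    unfolding B_def by (intro ideal_sub_set_add_l ideal_image_mult sF(1) bq) (use Kc in blast)
  have bB: "b \<otimes> x \<in> B (Suc q) j n" if xB: "x \<in> B q j n" for x q j n
  proof -
    obtain u v where u: "u \<in> K j (n + of_nat q * \<delta>)" and v: "v \<in> F (n - \<delta>)"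
      and x: "x = u \<oplus> c (Suc q) \<otimes> v"
      using xB by (auto simp: B_def mem_set_add_iff)
    have "b \<otimes> u \<in> K j ((n + of_nat q * \<delta>) + \<delta>)" using sK(2)[OF bset] u by blast
    moreover have "(n + of_nat q * \<delta>) + \<delta> = n + of_nat (Suc q) * \<delta>" by (simp add: algebra_simps)
    moreover have "b \<otimes> x = b \<otimes> u \<oplus> c (Suc (Suc q)) \<otimes> v"
      unfolding x using b bq Kc[OF u] Fc[OF v] by (simp add: cS r_distr m_assoc)
    ultimately show ?thesis using v by (auto simp: B_def mem_set_add_iff)
  qed
  have stepL: "L q j n \<subseteq> L (Suc q) j n" for q j n
  proof
    fix x assume x: "x \<in> L q j n"
    have "c (Suc q) \<otimes> x = b \<otimes> (c q \<otimes> x)"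
      using b bq x Fc by (auto simp: L_def cS m_assoc)
    then show "x \<in> L (Suc q) j n" using x bB by (auto simp: L_def)
  qed
  have monoK: "j \<le> j' \<Longrightarrow> K j n \<subseteq> K j' n" for j j' n
    using lift_Suc_mono_le[of "\<lambda>j. K j n"] KS by auto
  have monoL: "L q j \<le> L q' j'" if "q \<le> q'" "j \<le> j'" for q q' j j'
  proof (rule le_funI)
    fix n
    have "L q j n \<subseteq> L q j' n" using monoK[OF that(2)] by (fastforce simp: L_def B_def mem_set_add_iff)
    also have "\<dots> \<subseteq> L q' j' n" using lift_Suc_mono_le[of "\<lambda>q. L q j' n", OF stepL that(1)] .
    finally show "L q j n \<le> L q' j' n" .
  qed
  have stL: "stable_family ops (L q j)" for q j
  proof (rule stable_familyI)
    fix b' \<delta>' n x assume op': "(b', \<delta>') \<in> set ops" and x: "x \<in> L q j n"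
    have b': "b' \<in> carrier R" and op'': "(b', \<delta>') \<in> set (op # ops)" using ops op' by auto
    obtain u v where u: "u \<in> K j (n + of_nat q * \<delta>)" and v: "v \<in> F (n - \<delta>)"
      and e: "c q \<otimes> x = u \<oplus> c (Suc q) \<otimes> v" and xF: "x \<in> F n"
      using x by (auto simp: L_def B_def mem_set_add_iff)
    have "c q \<otimes> (b' \<otimes> x) = b' \<otimes> (c q \<otimes> x)"
      using bq b' Fc[OF xF] by (simp add: m_lcomm)
    also have "\<dots> = b' \<otimes> u \<oplus> c (Suc q) \<otimes> (b' \<otimes> v)"
      unfolding e using bq[of "Suc q"] b' Kc[OF u] Fc[OF v] by (simp add: r_distr m_lcomm)
    finally have e': "c q \<otimes> (b' \<otimes> x) = b' \<otimes> u \<oplus> c (Suc q) \<otimes> (b' \<otimes> v)" .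
    have "b' \<otimes> u \<in> K j ((n + \<delta>') + of_nat q * \<delta>)"
      using sK(2)[OF op'' u] by (simp add: algebra_simps)
    moreover have "b' \<otimes> v \<in> F ((n + \<delta>') - \<delta>)" using sF(2)[OF op'' v] by (simp add: algebra_simps)
    ultimately show "b' \<otimes> x \<in> L q j (n + \<delta>')"
      using e' sF(2)[OF op'' xF] by (auto simp: L_def B_def mem_set_add_iff)
  qed (rule idL)
  have stP': "stable_family ops P'"
  proof (rule stable_familyI)
    fix b' \<delta>' n x assume op': "(b', \<delta>') \<in> set ops" and x: "x \<in> P' n"
    have b': "b' \<in> carrier R" and op'': "(b', \<delta>') \<in> set (op # ops)" using ops op' by auto
    obtain u v where u: "u \<in> P n" and v: "v \<in> F (n - \<delta>)" and e: "x = u \<oplus> b \<otimes> v"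
      using x by (auto simp: P'_def mem_set_add_iff)
    have "b' \<otimes> x = b' \<otimes> u \<oplus> b \<otimes> (b' \<otimes> v)"
      unfolding e using b b' ideal_carr[OF sP(1) u] Fc[OF v] by (simp add: r_distr m_lcomm)
    moreover have "b' \<otimes> v \<in> F ((n + \<delta>') - \<delta>)" using sF(2)[OF op'' v] by (simp add: algebra_simps)
    ultimately show "b' \<otimes> x \<in> P' (n + \<delta>')"
      using sP(2)[OF op'' u] by (auto simp: P'_def mem_set_add_iff)
  qed (rule idP')
  have stF: "stable_family ops F" using Cons.prems(4) by (auto simp: stable_family_def)
  have PP': "P n \<subseteq> P' n" for n
    unfolding P'_def using sP(1) sF(1) b ideal_carr by (intro ideal_sub_set_add_l ideal_image_mult) blast+
  have gen: "generated_outside ops D P' F"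
    unfolding generated_outside_def
  proof (intro allI impI)
    fix n J assume n: "n \<notin> D" and J: "ideal J R" and PJ: "P' n \<subseteq> J"
      and h: "\<forall>(b, \<delta>)\<in>set ops. \<forall>x\<in>F (n - \<delta>). b \<otimes> x \<in> J"
    have "(\<otimes>) b ` F (n - \<delta>) \<subseteq> P' n"
      unfolding P'_def using sP(1) Fc b by (intro ideal_sub_set_add_r) auto
    then have "\<forall>(b, \<delta>)\<in>set (op # ops). \<forall>x\<in>F (n - \<delta>). b \<otimes> x \<in> J"
      using h PJ op by auto
    then show "F n \<subseteq> J" using Cons.prems(5) n J PJ PP' unfolding generated_outside_def by blast
  qed
  have bnd: "\<exists>q::nat. F (n - of_nat q * \<delta>') \<subseteq> P' (n - of_nat q * \<delta>')" if "(b', \<delta>') \<in> set ops" for b' \<delta>' n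
    using Cons.prems(6)[of b' \<delta>' n] that PP' by (meson list.set_intros(2) subset_trans)
  have P'L: "P' n \<subseteq> L q j n" for q j n
  proof
    fix x assume x: "x \<in> P' n"
    then obtain u v where u: "u \<in> P n" and v: "v \<in> F (n - \<delta>)" and e: "x = u \<oplus> b \<otimes> v"
      by (auto simp: P'_def mem_set_add_iff)
    have uF: "u \<in> F n" using u PK KF by blast
    have "c q \<otimes> u \<in> P (n + of_nat q * \<delta>)"
      using stable_family_pow[OF Cons.prems(3) bset b u] by (simp add: c_def)
    moreover have "c q \<otimes> x = c q \<otimes> u \<oplus> c (Suc q) \<otimes> v"
      unfolding e using b bq Fc[OF uF] Fc[OF v] by (simp add: cS r_distr m_assoc m_lcomm)
    moreover have "b \<otimes> v \<in> F n" using sF(2)[OF bset v] by simp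
    ultimately show "x \<in> L q j n"
      using v PK uF ideal_add[OF sF(1)] e by (auto simp: L_def B_def mem_set_add_iff)
  qed
  have LF: "L q j n \<subseteq> F n" for q j n by (auto simp: L_def)
  \<comment> \<open>The induction hypothesis for an arbitrary ascending sequence of families
    \<open>L q k\<close>; \<open>double_chain_stabilises\<close> asks for it on the diagonal and on
    each row.\<close>
  have acc: "\<exists>N. \<forall>j\<ge>N. X j = X N"
    if "\<And>j. \<exists>q k. X j = L q k" "\<And>j n. X j n \<subseteq> X (Suc j) n" for X
  proof (rule Cons.IH[OF Cons.prems(1) _ stP' stF gen bnd])
    show "fst ` set ops \<subseteq> carrier R" using Cons.prems(2) by auto
    show "stable_family ops (X j)" for j using that(1)[of j] stL by auto
    show "P' n \<subseteq> X j n" for j n using that(1)[of j] P'L by force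
    show "X j n \<subseteq> F n" for j n using that(1)[of j] LF by force
  qed (use that(2) in auto)
  have "\<exists>N. \<forall>q. \<forall>j\<ge>N. L q j = L q N"
  proof (rule double_chain_stabilises)
    have "L k k n \<subseteq> L (Suc k) (Suc k) n" for k n
      using monoL[of k "Suc k" k "Suc k"] by (auto simp: le_fun_def)
    then show "\<exists>N. \<forall>k\<ge>N. L k k = L N N" using acc[of "\<lambda>k. L k k"] by blast
    have "L q k n \<subseteq> L q (Suc k) n" for q k n
      using monoL[of q q k "Suc k"] by (auto simp: le_fun_def)
    then show "\<exists>N. \<forall>j\<ge>N. L q j = L q N" for q using acc[of "L q"] by blast
  qed (rule monoL)
  then obtain N where N: "\<And>q j. j \<ge> N \<Longrightarrow> L q j = L q N" by blast
  have "K j n \<subseteq> K N n" if j: "j \<ge> N" for j n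
  proof
    fix y assume y: "y \<in> K j n"
    \<comment> \<open>Division with remainder: in degree \<open>n - of_nat q * \<delta>\<close> the
      leading coefficients for \<open>j\<close> and \<open>N\<close> agree, so
      \<open>c q \<otimes> x\<close> can be traded for an element of \<open>K N n\<close> and a
      remainder divisible by the next power of \<open>b\<close>. The number of rounds depends on
      \<open>n\<close>, which is why one \<open>N\<close> has to serve all \<open>q\<close>.\<close>
    have dec: "\<exists>k\<in>K N n. \<exists>x\<in>F (n - of_nat q * \<delta>). y = k \<oplus> c q \<otimes> x" for q :: nat
    proof (induction q)
      case 0
      then show ?case using y KF Kc[OF y] ideal_zero[OF sK(1)]
        by (intro bexI[of _ \<zero>] bexI[of _ y]) (auto simp: c0)
    next
      case (Suc q)
      then obtain k x where k: "k \<in> K N n" and x: "x \<in> F (n - of_nat q * \<delta>)"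
        and e: "y = k \<oplus> c q \<otimes> x" by blast
      have kj: "k \<in> K j n" using k monoK[OF j] by blast
      have bx: "c q \<otimes> x \<in> carrier R" using bq Fc[OF x] by blast
      have "c q \<otimes> x \<in> K j n"
        using ideal_diff_mem[OF sK(1) _ kj bx] y e a_comm bx Kc[OF kj] by metis
      then have "c q \<otimes> x \<in> B q j (n - of_nat q * \<delta>)" using KB[of j "n - of_nat q * \<delta>" q] by auto
      then have "x \<in> L q j (n - of_nat q * \<delta>)" using x by (simp add: L_def)
      then have "x \<in> L q N (n - of_nat q * \<delta>)" using N[OF j] by metis
      then obtain u v where u: "u \<in> K N n" and v: "v \<in> F (n - of_nat q * \<delta> - \<delta>)"
        and e': "c q \<otimes> x = u \<oplus> c (Suc q) \<otimes> v"
        by (auto simp: L_def B_def mem_set_add_iff)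
      have "y = (k \<oplus> u) \<oplus> c (Suc q) \<otimes> v"
        unfolding e e' using Kc[OF k] Kc[OF u] Fc[OF v] bq[of "Suc q"]
        by (simp add: a_assoc)
      moreover have "n - of_nat q * \<delta> - \<delta> = n - of_nat (Suc q) * \<delta>" by (simp add: algebra_simps)
      ultimately show ?case using v ideal_add[OF sK(1) k u] by metis
    qed
    obtain q where q: "F (n - of_nat q * \<delta>) \<subseteq> P (n - of_nat q * \<delta>)" 
      using Cons.prems(6)[OF bset] by blast
    obtain k x where k: "k \<in> K N n" and x: "x \<in> F (n - of_nat q * \<delta>)"
      and e: "y = k \<oplus> c q \<otimes> x" using dec by blast
    \<comment> \<open>The coefficient of the remainder has descended to a degree in which
      \<open>F\<close> is contained in \<open>P\<close>, and multiplying by the power of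
      \<open>b\<close> brings it back to degree \<open>n\<close> inside \<open>P\<close>.\<close>
    have "c q \<otimes> x \<in> P n"
      using stable_family_pow[OF Cons.prems(3) bset b, of x "n - of_nat q * \<delta>" q] q x by (auto simp: c_def)
    then show "y \<in> K N n" using e k PK ideal_add[OF sK(1)] by blast
  qed
  then have "K j = K N" if "j \<ge> N" for j using monoK that by (intro ext) blast
  then show ?case by blast
qed

end

section \<open>Vandermonde elimination\<close>

context cring
begin

primrec horner :: "'a \<Rightarrow> 'a list \<Rightarrow> 'a"
  where "horner t [] = \<zero>"
  | "horner t (y # ys) = y \<oplus> t \<otimes> horner t ys"

text \<open>Coefficients of the quotient of \<open>p(X) - p(s)\<close> by \<open>X - s\<close>,
  where \<open>p\<close> is the polynomial with the given coefficients, constant term first. They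
  are the values at \<open>s\<close> of the proper tails of the list.\<close>

primrec synthetic_div :: "'a \<Rightarrow> 'a list \<Rightarrow> 'a list"
  where "synthetic_div s [] = []"
  | "synthetic_div s (y # ys) = (if ys = [] then [] else horner s ys # synthetic_div s ys)"

lemma horner_closed [simp]:
  "t \<in> carrier R \<Longrightarrow> set ys \<subseteq> carrier R \<Longrightarrow> horner t ys \<in> carrier R"
  by (induction ys) auto

lemma horner_in_ideal: "ideal J R \<Longrightarrow> t \<in> carrier R \<Longrightarrow> set ys \<subseteq> J \<Longrightarrow> horner t ys \<in> J"
  by (induction ys) (auto intro: ideal_zero ideal_add ideal_mult_l)

lemma length_synthetic_div [simp]: "length (synthetic_div s ys) = length ys - 1"
  by (induction ys) (auto simp: Suc_le_eq)

lemma synthetic_div_closed: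
  "s \<in> carrier R \<Longrightarrow> set ys \<subseteq> carrier R \<Longrightarrow> set (synthetic_div s ys) \<subseteq> carrier R"
  by (induction ys) auto

lemma horner_minus:
  assumes "s \<in> carrier R" "t \<in> carrier R" "set ys \<subseteq> carrier R"
  shows "horner t ys \<ominus> horner s ys = (t \<ominus> s) \<otimes> horner t (synthetic_div s ys)"
  using assms(3)
proof (induction ys)
  case Nil
  then show ?case using assms by (simp add: a_minus_def)
next
  case (Cons y ys)
  have c: "y \<in> carrier R" "horner t ys \<in> carrier R" "horner s ys \<in> carrier R"
    "horner t (synthetic_div s ys) \<in> carrier R"
    using Cons.prems assms synthetic_div_closed by auto
  have IH: "horner t ys \<ominus> horner s ys = (t \<ominus> s) \<otimes> horner t (synthetic_div s ys)"
    using Cons by auto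
  show ?case
  proof (cases "ys = []")
    case True
    then show ?thesis using c assms by (simp add: a_minus_def r_neg)
  next
    case False
    have "horner t (y # ys) \<ominus> horner s (y # ys) =
      (t \<ominus> s) \<otimes> horner s ys \<oplus> t \<otimes> (horner t ys \<ominus> horner s ys)"
      using c assms unfolding horner.simps by algebra
    also have "\<dots> = (t \<ominus> s) \<otimes> (horner s ys \<oplus> t \<otimes> horner t (synthetic_div s ys))"
      unfolding IH using c assms by algebra
    finally show ?thesis using False by simp
  qed
qed

text \<open>Synthetic division is unitriangular: the value at \<open>s\<close> of every proper tail
  is an entry of the quotient, and a coefficient is the value of the list it starts minus
  \<open>s\<close> times the value of the tail after it.\<close>

lemma coeffs_in_ideal_of_synthetic_div:
  assumes "ideal J R" "s \<in> carrier R" "set ys \<subseteq> carrier R"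
    "set (synthetic_div s ys) \<subseteq> J" "horner s ys \<in> J"
  shows "set ys \<subseteq> J"
  using assms(3-5)
proof (induction ys)
  case (Cons y ys)
  show ?case
  proof (cases "ys = []")
    case True
    then show ?thesis using Cons assms by simp
  next
    case False
    then have h: "horner s ys \<in> J" and "set (synthetic_div s ys) \<subseteq> J" using Cons.prems by auto
    then have "set ys \<subseteq> J" using Cons by auto
    moreover have "y \<in> J"
      using ideal_diff_mem[OF assms(1) _ ideal_mult_l[OF assms(1) h assms(2)]] Cons.prems by auto
    ultimately show ?thesis by simp
  qed
qed simp

text \<open>Divided differences take the place of a determinant: subtracting the value at one node
  \<open>s\<close> and cancelling the unit \<open>t \<ominus> s\<close> leaves a shorter polynomial
  with values in \<open>J\<close> at the remaining nodes. A general \<open>J\<close> allows the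
  application to colon ideals and to the degree components of ideals of \<open>G(I)\<close>.\<close>

lemma vandermonde_ideal:
  assumes "ideal J R" "finite A" "card A = length ys" "A \<subseteq> carrier R" "set ys \<subseteq> carrier R"
    and "\<And>s t. s \<in> A \<Longrightarrow> t \<in> A \<Longrightarrow> s \<noteq> t \<Longrightarrow> t \<ominus> s \<in> Units R"
    and "\<And>t. t \<in> A \<Longrightarrow> horner t ys \<in> J"
  shows "set ys \<subseteq> J"
  using assms(2-)
proof (induction A arbitrary: ys rule: finite_induct)
  case empty
  then show ?case by simp
next
  case (insert s A)
  have s: "s \<in> carrier R" using insert by simp
  have "set (synthetic_div s ys) \<subseteq> J"
  proof (rule insert.IH)
    show "card A = length (synthetic_div s ys)" using insert by simp
    show "set (synthetic_div s ys) \<subseteq> carrier R" using synthetic_div_closed s insert by blast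
    show "horner t (synthetic_div s ys) \<in> J" if t: "t \<in> A" for t
    proof -
      let ?h = "horner t (synthetic_div s ys)"
      have tc: "t \<in> carrier R" and hc: "?h \<in> carrier R"
        using t insert s synthetic_div_closed[OF s insert.prems(3)] by auto
      have u: "t \<ominus> s \<in> Units R" using insert.prems(4)[of s t] t insert.hyps(2) by auto
      have "(t \<ominus> s) \<otimes> ?h \<in> J"
        using horner_minus[OF s tc insert.prems(3)] ideal_minus[OF assms(1)] insert.prems(5) t
        by (metis insertCI)
      then have "inv (t \<ominus> s) \<otimes> ((t \<ominus> s) \<otimes> ?h) \<in> J"
        using u ideal_mult_l[OF assms(1)] by blast
      then show ?thesis using u hc by (metis Units_closed Units_inv_closed Units_l_inv l_one m_assoc)
    qed
  qed (use insert.prems in auto)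
  then show ?case
    using coeffs_in_ideal_of_synthetic_div[OF assms(1) s insert.prems(3)] insert.prems(5) by blast
qed

end

section \<open>Filter-regular combinations\<close>

context noetherian_cring
begin

text \<open>The chain condition for families controlled only on an operator-stable set
  \<open>G\<close> of degrees, such as a cone or a diagonal. Extension by the zero ideal preserves
  stability, and since every operator leaves \<open>G\<close> when followed backwards, the descent
  of \<open>stable_family_chain_stabilises\<close> terminates.\<close>

lemma chain_stabilises_on:
  fixes ops :: "('a \<times> 'g::comm_ring_1) list"
  assumes "finite D" "fst ` set ops \<subseteq> carrier R"
    and idP: "\<And>n. ideal (P n) R" and idF: "\<And>n. ideal (F n) R" and idK: "\<And>j n. ideal (K j n) R"
    and G: "\<And>b \<delta> n. (b, \<delta>) \<in> set ops \<Longrightarrow> n \<in> G \<Longrightarrow> n + \<delta> \<in> G"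
    and bounded: "\<And>b \<delta> n. (b, \<delta>) \<in> set ops \<Longrightarrow> \<exists>q::nat. n - of_nat q * \<delta> \<notin> G"
    and P: "\<And>b \<delta> n x. (b, \<delta>) \<in> set ops \<Longrightarrow> n \<in> G \<Longrightarrow> x \<in> P n \<Longrightarrow> b \<otimes> x \<in> P (n + \<delta>)"
    and F: "\<And>b \<delta> n x. (b, \<delta>) \<in> set ops \<Longrightarrow> n \<in> G \<Longrightarrow> x \<in> F n \<Longrightarrow> b \<otimes> x \<in> F (n + \<delta>)"
    and K: "\<And>j b \<delta> n x. (b, \<delta>) \<in> set ops \<Longrightarrow> n \<in> G \<Longrightarrow> x \<in> K j n \<Longrightarrow> b \<otimes> x \<in> K j (n + \<delta>)"
    and gen: "\<And>n J. n \<in> G \<Longrightarrow> n \<notin> D \<Longrightarrow> ideal J R \<Longrightarrow> P n \<subseteq> J \<Longrightarrow>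
      (\<And>b \<delta> x. (b, \<delta>) \<in> set ops \<Longrightarrow> n - \<delta> \<in> G \<Longrightarrow> x \<in> F (n - \<delta>) \<Longrightarrow> b \<otimes> x \<in> J) \<Longrightarrow> F n \<subseteq> J"
    and sub: "\<And>j n. n \<in> G \<Longrightarrow> P n \<subseteq> K j n" "\<And>j n. n \<in> G \<Longrightarrow> K j n \<subseteq> F n"
    and asc: "\<And>j n. n \<in> G \<Longrightarrow> K j n \<subseteq> K (Suc j) n"
  shows "\<exists>N. \<forall>j\<ge>N. \<forall>n\<in>G. K j n = K N n"
proof -
  define tr where "tr X n = (if n \<in> G then X n else {\<zero>})" for X :: "'g \<Rightarrow> 'a set" and n
  have b: "b \<in> carrier R" if "(b, \<delta>) \<in> set ops" for b \<delta> using assms(2) that by force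
  have st: "stable_family ops (tr X)"
    if "\<And>n. ideal (X n) R" 
      "\<And>b \<delta> n x. (b, \<delta>) \<in> set ops \<Longrightarrow> n \<in> G \<Longrightarrow> x \<in> X n \<Longrightarrow> b \<otimes> x \<in> X (n + \<delta>)" for X
  proof (rule stable_familyI)
    show "ideal (tr X n) R" for n unfolding tr_def using that(1) zeroideal by simp
    then have "\<zero> \<in> tr X n" for n by (rule ideal_zero)
    then show "b \<otimes> x \<in> tr X (n + \<delta>)" if "(b, \<delta>) \<in> set ops" "x \<in> tr X n" for b \<delta> n x
      using that \<open>\<And>b \<delta> n x. _ \<Longrightarrow> _ \<Longrightarrow> _ \<Longrightarrow> b \<otimes> x \<in> X (n + \<delta>)\<close>[of b \<delta> n x] G[of b \<delta> n] b[of b \<delta>]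
      by (cases "n \<in> G") (auto simp: tr_def)
  qed
  have "\<exists>N. \<forall>j\<ge>N. tr (K j) = tr (K N)"
  proof (rule stable_family_chain_stabilises[OF assms(1,2)])
    show "stable_family ops (tr P)" using idP P by (rule st)
    show "stable_family ops (tr F)" using idF F by (rule st)
    show "stable_family ops (tr (K j))" for j using idK K by (rule st)
    show "\<exists>q::nat. tr F (n - of_nat q * \<delta>) \<subseteq> tr P (n - of_nat q * \<delta>)" if "(b, \<delta>) \<in> set ops" for b \<delta> n
      using bounded[OF that, of n] by (auto simp: tr_def)
    show "tr P n \<subseteq> tr (K j) n" for j n using sub by (simp add: tr_def)
    show "tr (K j) n \<subseteq> tr F n" for j n using sub by (simp add: tr_def)
    show "tr (K j) n \<subseteq> tr (K (Suc j)) n" for j n using asc by (simp add: tr_def)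
    show "generated_outside ops D (tr P) (tr F)"
      unfolding generated_outside_def
    proof (intro allI impI)
      fix n J assume n: "n \<notin> D" and J: "ideal J R" and "tr P n \<subseteq> J"
        and "\<forall>(b, \<delta>)\<in>set ops. \<forall>x\<in>tr F (n - \<delta>). b \<otimes> x \<in> J"
      then show "tr F n \<subseteq> J"
        using gen[OF _ n J] ideal_zero[OF J] by (cases "n \<in> G") (fastforce simp: tr_def)+
    qed
  qed
  then obtain N where N: "\<And>j. j \<ge> N \<Longrightarrow> tr (K j) = tr (K N)" by blast
  have "K j n = K N n" if "j \<ge> N" "n \<in> G" for j n
    using fun_cong[OF N[OF that(1)], of n] that(2) by (simp add: tr_def)
  then show ?thesis by blast
qed

end

text \<open>\<open>E n\<close> models the products of powers of the \<open>I i\<close>, and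
  \<open>F n\<close> modulo \<open>P n\<close> a component of a quotient of \<open>G(F)\<close>,
  generated by \<open>ops\<close> from degree \<open>m\<close> upwards. \<open>Y\<close> models the
  complete reduction, which generates along steps of \<open>1\<close>. \<open>ops_gen\<close> and
  \<open>Y_gen\<close> use test ideals so as to match \<open>generated_outside\<close>.\<close>

locale graded_ideals = noetherian_cring R for R :: "('a, 'b) ring_scheme" (structure) +
  fixes E F P :: "'s::finite mdeg \<Rightarrow> 'a set"
    and ops :: "('a \<times> 's mdeg) list" and m :: "'s mdeg" and Y :: "'a set"
  assumes idE: "\<And>n. ideal (E n) R" and idF: "\<And>n. ideal (F n) R" and idP: "\<And>n. ideal (P n) R"
    and E_zero: "E 0 = carrier R"
    and E_mult: "\<And>p q x y. x \<in> E p \<Longrightarrow> y \<in> E q \<Longrightarrow> x \<otimes> y \<in> E (p + q)"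
    and E_split: "\<And>p q. 0 \<le> p \<Longrightarrow> 0 \<le> q \<Longrightarrow> E (p + q) \<subseteq> E p \<cdot> E q"
    and EF: "\<And>p q x y. x \<in> E p \<Longrightarrow> y \<in> F q \<Longrightarrow> x \<otimes> y \<in> F (p + q)"
    and EP: "\<And>p q x y. x \<in> E p \<Longrightarrow> y \<in> P q \<Longrightarrow> x \<otimes> y \<in> P (p + q)"
    and PF: "\<And>n. P n \<subseteq> F n"
    and ops: "\<And>b \<delta>. (b, \<delta>) \<in> set ops \<Longrightarrow> b \<in> E \<delta> \<and> 0 \<le> \<delta> \<and> \<delta> \<noteq> 0"
    and ops_gen: "\<And>n J. m \<le> n \<Longrightarrow> n \<noteq> m \<Longrightarrow> ideal J R \<Longrightarrow> P n \<subseteq> J \<Longrightarrow>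
      (\<And>b \<delta> x. (b, \<delta>) \<in> set ops \<Longrightarrow> m \<le> n - \<delta> \<Longrightarrow> x \<in> F (n - \<delta>) \<Longrightarrow> b \<otimes> x \<in> J) \<Longrightarrow> F n \<subseteq> J"
    and Y: "finite Y" "Y \<subseteq> E 1"
    and Y_gen: "\<And>n J. m \<le> n \<Longrightarrow> ideal J R \<Longrightarrow> P (n + 1) \<subseteq> J \<Longrightarrow>
      (\<And>y x. y \<in> Y \<Longrightarrow> x \<in> F n \<Longrightarrow> y \<otimes> x \<in> J) \<Longrightarrow> F (n + 1) \<subseteq> J"
begin

lemma E_carr: "x \<in> E n \<Longrightarrow> x \<in> carrier R"
  using ideal_carr[OF idE] .

lemma F_carr: "x \<in> F n \<Longrightarrow> x \<in> carrier R"
  using ideal_carr[OF idF] .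

lemma chain_stabilises:
  assumes "\<And>j n. ideal (K j n) R"
    and "\<And>j p n b x. 0 \<le> p \<Longrightarrow> b \<in> E p \<Longrightarrow> m \<le> n \<Longrightarrow> x \<in> K j n \<Longrightarrow> b \<otimes> x \<in> K j (p + n)"
    and "\<And>j n. m \<le> n \<Longrightarrow> P n \<subseteq> K j n" "\<And>j n. m \<le> n \<Longrightarrow> K j n \<subseteq> F n"
    and "\<And>j n. m \<le> n \<Longrightarrow> K j n \<subseteq> K (Suc j) n"
  shows "\<exists>N. \<forall>j\<ge>N. \<forall>n\<ge>m. K j n = K N n"
proof -
  have "\<exists>N. \<forall>j\<ge>N. \<forall>n\<in>{m..}. K j n = K N n"
  proof (rule chain_stabilises_on[where D = "{m}" and ops = ops and P = P and F = F])
    show "fst ` set ops \<subseteq> carrier R" using ops E_carr by force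
    show "n + \<delta> \<in> {m..}" if "(b, \<delta>) \<in> set ops" "n \<in> {m..}" for b \<delta> n
      using that ops add_mono[of m n 0 \<delta>] by auto
    show "\<exists>q::nat. n - of_nat q * \<delta> \<notin> {m..}" if o: "(b, \<delta>) \<in> set ops" for b \<delta> n
    proof -
      obtain i where i: "\<delta> i \<ge> 1"
      proof -
        from ops[OF o] obtain i where "\<delta> i \<noteq> 0" by (auto simp: fun_eq_iff)
        moreover have "0 \<le> \<delta> i" using ops[OF o] by (auto simp: le_fun_def)
        ultimately show ?thesis using that[of i] by linarith
      qed
      \<comment> \<open>Each step back lowers the coordinate \<open>i\<close> by at least one, so
        this many steps push it below \<open>m i\<close>.\<close>
      define q where "q = nat (n i - m i + 1)"
      have "int q \<le> int q * \<delta> i" using i by (simp add: mult_le_cancel_left1)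
      then have "n i - int q * \<delta> i < m i" unfolding q_def by linarith
      then have "\<not> m \<le> n - of_nat q * \<delta>"
        by (auto simp: le_fun_def not_le of_nat_fun intro!: exI[of _ i])
      then show ?thesis by blast
    qed
    show "b \<otimes> x \<in> P (n + \<delta>)" if "(b, \<delta>) \<in> set ops" "x \<in> P n" for b \<delta> n x
      using ops[OF that(1)] EP[of b \<delta> x n] that by (simp add: add.commute)
    show "b \<otimes> x \<in> F (n + \<delta>)" if "(b, \<delta>) \<in> set ops" "x \<in> F n" for b \<delta> n x
      using ops[OF that(1)] EF[of b \<delta> x n] that by (simp add: add.commute)
    show "b \<otimes> x \<in> K j (n + \<delta>)" if "(b, \<delta>) \<in> set ops" "n \<in> {m..}" "x \<in> K j n" for j b \<delta> n x
      using ops[OF that(1)] assms(2)[of \<delta> b n x j] that by (simp add: add.commute)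
    show "F n \<subseteq> J" if "n \<in> {m..}" "n \<notin> {m}" "ideal J R" "P n \<subseteq> J"
      "\<And>b \<delta> x. (b, \<delta>) \<in> set ops \<Longrightarrow> n - \<delta> \<in> {m..} \<Longrightarrow> x \<in> F (n - \<delta>) \<Longrightarrow> b \<otimes> x \<in> J" for n J
      using ops_gen[of n J] that by auto
  qed (use assms idP idF in auto)
  then show ?thesis by auto
qed

text \<open>Along a diagonal \<open>p + k(1, \<dots>, 1)\<close> the module is finite over the polynomial ring in the
  elements of \<open>Y\<close>, and the truncations of \<open>Z\<close> form a chain because \<open>Y\<close> annihilates \<open>Z\<close> modulo \<open>P\<close>.\<close>

lemma annihilated_diagonal:
  assumes "\<And>n. ideal (Z n) R" "\<And>n. P n \<subseteq> Z n" "\<And>n. Z n \<subseteq> F n"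
    and "\<And>n y x. y \<in> Y \<Longrightarrow> x \<in> Z n \<Longrightarrow> y \<otimes> x \<in> P (n + 1)"
    and "m \<le> p"
  shows "\<exists>k. Z (p + of_nat k) \<subseteq> P (p + of_nat k)"
proof -
  obtain ys where ys: "set ys = Y" using Y(1) finite_list by blast
  define yo where "yo = map (\<lambda>y. (y, 1 :: 's mdeg)) ys"
  have so: "(b, \<delta>) \<in> set yo \<longleftrightarrow> b \<in> Y \<and> \<delta> = 1" for b \<delta> using ys unfolding yo_def by auto
  define G where "G = range (\<lambda>k. p + of_nat k)"
  define K where "K j n = (if n \<in> (\<lambda>k. p + of_nat k) ` {..j} then Z n else P n)" for j :: nat and n
  have PK: "P n \<subseteq> K j n" for j n using assms(2) by (simp add: K_def)
  have KZ: "K j n \<subseteq> Z n" for j n using assms(2) by (simp add: K_def)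
  have "\<exists>N. \<forall>j\<ge>N. \<forall>n\<in>G. K j n = K N n"
  proof (rule chain_stabilises_on[where D = "{p}" and ops = yo and P = P and F = F])
    show "fst ` set yo \<subseteq> carrier R" using so Y(2) E_carr by force
    show "n + \<delta> \<in> G" if "(b, \<delta>) \<in> set yo" "n \<in> G" for b \<delta> n
    proof -
      obtain k where "n = p + of_nat k" using \<open>n \<in> G\<close> unfolding G_def by blast
      then have "n + \<delta> = p + of_nat (Suc k)" using that(1) so by simp
      then show ?thesis unfolding G_def by blast
    qed
    show "\<exists>q::nat. n - of_nat q * \<delta> \<notin> G" if bo: "(b, \<delta>) \<in> set yo" for b \<delta> n
    proof -
      \<comment> \<open>All coordinates of \<open>\<delta>\<close> are 1, so any coordinate detects
        that the degree has fallen behind the start of the diagonal.\<close>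
      obtain i :: 's where True by blast
      define q where "q = nat (n i - p i + 1)"
      have "n i - int q < p i" unfolding q_def by linarith
      then have "n - of_nat q * \<delta> \<noteq> p + of_nat k" for k
        using bo so by (auto simp: fun_eq_iff of_nat_fun intro!: exI[of _ i])
      then show ?thesis unfolding G_def by blast
    qed
    show "b \<otimes> x \<in> P (n + \<delta>)" if "(b, \<delta>) \<in> set yo" "x \<in> P n" for b \<delta> n x
      using that so EP[of b 1 x n] Y(2) by (auto simp: add.commute)
    show "b \<otimes> x \<in> F (n + \<delta>)" if "(b, \<delta>) \<in> set yo" "x \<in> F n" for b \<delta> n x
      using that so EF[of b 1 x n] Y(2) by (auto simp: add.commute)
    \<comment> \<open>The product already lies in \<open>P\<close>, which every truncation contains,
      so it does no harm that \<open>Z\<close> may be cut off before degree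
      \<open>n + 1\<close>.\<close>
    show "b \<otimes> x \<in> K j (n + \<delta>)" if "(b, \<delta>) \<in> set yo" "x \<in> K j n" for j b \<delta> n x
      using that so KZ[of j n] PK[of "n + 1" j] assms(4)[of b x n] by auto
    show "F n \<subseteq> J" if nG: "n \<in> G" and np: "n \<notin> {p}" and J: "ideal J R" "P n \<subseteq> J"
      and h: "\<And>b \<delta> x. (b, \<delta>) \<in> set yo \<Longrightarrow> n - \<delta> \<in> G \<Longrightarrow> x \<in> F (n - \<delta>) \<Longrightarrow> b \<otimes> x \<in> J" for n J
    proof -
      obtain k where "n = p + of_nat k" using nG unfolding G_def by blast
      then obtain k where n: "n = p + of_nat k + 1" using np by (cases k) (auto simp: add_ac)
      have "m \<le> p + of_nat k" using assms(5) add_mono[of m p 0 "of_nat k"] by (simp add: le_fun_def of_nat_fun)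
      moreover have "n - 1 = p + of_nat k" using n by simp
      moreover have "p + of_nat k \<in> G" unfolding G_def by blast
      ultimately show ?thesis using Y_gen[of "p + of_nat k" J] n J h so by metis
    qed
    show "K j n \<subseteq> F n" for j n using KZ assms(3) by blast
    show "K j n \<subseteq> K (Suc j) n" for j n using assms(2) by (auto simp: K_def)
  qed (use idP idF assms PK in \<open>auto simp: K_def\<close>)
  then obtain N where N: "\<And>j n. j \<ge> N \<Longrightarrow> n \<in> G \<Longrightarrow> K j n = K N n" by blast
  \<comment> \<open>In the first degree beyond the cut at \<open>N\<close> the stationary chain
    takes the value \<open>Z\<close> through \<open>K (Suc N)\<close> and the value \<open>P\<close>
    through \<open>K N\<close>.\<close>
  have "K (Suc N) (p + of_nat (Suc N)) = Z (p + of_nat (Suc N))"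
    by (auto simp: K_def simp del: of_nat_Suc)
  moreover have "p + of_nat (Suc N) \<notin> (\<lambda>k. p + of_nat k) ` {..N}"
    by (auto simp del: of_nat_Suc)
  then have "K N (p + of_nat (Suc N)) = P (p + of_nat (Suc N))" unfolding K_def by presburger
  moreover have "p + of_nat (Suc N) \<in> G" unfolding G_def by blast
  ultimately have "Z (p + of_nat (Suc N)) = P (p + of_nat (Suc N))" using N[of "Suc N"] by (metis le_SucI order_refl)
  then show ?thesis by blast
qed

text \<open>The bound on the diagonals is made uniform by the chain of those elements of \<open>Z\<close> whose
  multiples vanish modulo \<open>P\<close> in all degrees \<open>\<ge> m + j(1, \<dots>, 1)\<close>.\<close>

lemma annihilated_eventually:
  assumes idZ: "\<And>n. ideal (Z n) R" and PZ: "\<And>n. P n \<subseteq> Z n" and ZF: "\<And>n. Z n \<subseteq> F n"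
    and EZ: "\<And>p n b x. b \<in> E p \<Longrightarrow> x \<in> Z n \<Longrightarrow> b \<otimes> x \<in> Z (p + n)"
    and YZ: "\<And>n y x. y \<in> Y \<Longrightarrow> x \<in> Z n \<Longrightarrow> y \<otimes> x \<in> P (n + 1)"
  shows "\<exists>m'. \<forall>n\<ge>m'. Z n \<subseteq> P n"
proof -
  note Zc = ideal_carr[OF idZ]
  define K where "K j n = {x \<in> Z n. \<forall>r. n \<le> r \<longrightarrow> m + of_nat j \<le> r \<longrightarrow> (\<forall>b\<in>E (r - n). b \<otimes> x \<in> P r)}"
    for j :: nat and n
  have "\<exists>N. \<forall>j\<ge>N. \<forall>n\<ge>m. K j n = K N n"
  proof (rule chain_stabilises)
    show "ideal (K j n) R" for j n
    proof (rule ideal_intro)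
      show "K j n \<subseteq> carrier R" using Zc by (auto simp: K_def)
      show "\<zero> \<in> K j n" using ideal_zero[OF idZ] ideal_zero[OF idP] E_carr by (auto simp: K_def)
      show "x \<oplus> y \<in> K j n" if "x \<in> K j n" "y \<in> K j n" for x y
        using that ideal_add[OF idZ] ideal_add[OF idP] E_carr Zc by (auto simp: K_def r_distr)
      show "r \<otimes> x \<in> K j n" if "r \<in> carrier R" "x \<in> K j n" for r x
      proof -
        have "x \<in> carrier R" using \<open>x \<in> K j n\<close> Zc by (auto simp: K_def)
        then have "b \<otimes> (r \<otimes> x) = r \<otimes> (b \<otimes> x)" if "b \<in> E q" for b q
          using E_carr[OF that] \<open>r \<in> carrier R\<close> by (simp add: m_lcomm)
        then show ?thesis using that ideal_mult_l[OF idZ] ideal_mult_l[OF idP] by (auto simp: K_def)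
      qed
    qed
    show "b \<otimes> x \<in> K j (p + n)" if p: "0 \<le> p" and b: "b \<in> E p" and x: "x \<in> K j n" for j p n b x
    proof -
      have xZ: "x \<in> Z n" using x by (simp add: K_def)
      have "b' \<otimes> (b \<otimes> x) \<in> P r" if r: "p + n \<le> r" "m + of_nat j \<le> r" and b': "b' \<in> E (r - (p + n))" for r b'
      proof -
        have "b' \<otimes> b \<in> E (r - (p + n) + p)" using E_mult[OF b' b] .
        then have "b' \<otimes> b \<in> E (r - n)" by (simp add: algebra_simps)
        moreover have "n \<le> r" using r p by (metis add_increasing order_refl order_trans)
        ultimately have "(b' \<otimes> b) \<otimes> x \<in> P r" using x r by (simp add: K_def)
        then show ?thesis using E_carr[OF b] E_carr[OF b'] Zc[OF xZ] by (simp add: m_assoc)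
      qed
      then show ?thesis using EZ[OF b xZ] by (simp add: K_def)
    qed
    show "P n \<subseteq> K j n" for j n
    proof
      fix x assume x: "x \<in> P n"
      have "b \<otimes> x \<in> P r" if "b \<in> E (r - n)" for b r using EP[OF that x] by simp
      then show "x \<in> K j n" using x PZ by (auto simp: K_def)
    qed
    show "K j n \<subseteq> F n" for j n using ZF by (auto simp: K_def)
    show "K j n \<subseteq> K (Suc j) n" for j n
    proof -
      have "m + of_nat j \<le> r" if "m + of_nat (Suc j) \<le> r" for r :: "'s mdeg"
      proof (rule le_funI)
        fix i
        show "(m + of_nat j) i \<le> r i" using le_funD[OF that, of i] by (simp add: of_nat_fun)
      qed
      then show ?thesis by (auto simp: K_def)
    qed
  qed
  then obtain N where N: "\<And>j n. j \<ge> N \<Longrightarrow> n \<ge> m \<Longrightarrow> K j n = K N n" by blast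
  have "x \<in> P n" if n: "m + of_nat N \<le> n" and x: "x \<in> Z n" for n x
  proof -
    have mn: "m \<le> n"
    proof (rule le_funI)
      fix i
      show "m i \<le> n i" using le_funD[OF n, of i] by (simp add: of_nat_fun)
    qed
    obtain k where k: "Z (n + of_nat k) \<subseteq> P (n + of_nat k)"
      using annihilated_diagonal[OF idZ PZ ZF YZ mn] by blast
    \<comment> \<open>\<open>S\<close> bounds every \<open>n i - m i\<close>, so that
      \<open>n + of_nat k\<close> lies below \<open>m + of_nat j\<close>; the summand
      \<open>N\<close> of \<open>j\<close> puts \<open>j\<close> past the stationary index.\<close>
    define S where "S = (\<Sum>i\<in>UNIV. nat (n i - m i))"
    define j where "j = S + k + N"
    have jk: "n + of_nat k \<le> m + of_nat j"
    proof (rule le_funI)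
      fix i
      have "nat (n i - m i) \<le> S" unfolding S_def by (rule member_le_sum) auto
      then have "n i \<le> m i + int S" by linarith
      then show "(n + of_nat k) i \<le> (m + of_nat j) i" unfolding j_def by (simp add: of_nat_fun)
    qed
    have "x \<in> K j n"
    proof -
      have "b \<otimes> x \<in> P r" if r: "m + of_nat j \<le> r" and b: "b \<in> E (r - n)" for r b
      proof -
        have "0 \<le> r - n - of_nat k" using jk r by (metis diff_ge_0_iff_ge diff_diff_add order_trans)
        moreover have "(0::'s mdeg) \<le> of_nat k" by (simp add: le_fun_def of_nat_fun)
        \<comment> \<open>The second factor carries \<open>x\<close> into
          \<open>Z (n + of_nat k)\<close>, hence into \<open>P\<close> by the bound for this
          diagonal, and \<open>P\<close> is stable under the first factor.\<close>
        ultimately have "b \<in> E (r - n - of_nat k) \<cdot> E (of_nat k)"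
          using E_split[of "r - n - of_nat k" "of_nat k"] b by (simp add: subset_iff)
        then show ?thesis
        proof induction
          case (prod b1 b2)
          have "b2 \<otimes> x \<in> Z (of_nat k + n)" using EZ prod x by blast
          then have "b2 \<otimes> x \<in> P (n + of_nat k)" using k by (auto simp: add.commute)
          then have "b1 \<otimes> (b2 \<otimes> x) \<in> P ((r - n - of_nat k) + (n + of_nat k))" using EP prod by blast
          then show ?case using E_carr[OF prod(1)] E_carr[OF prod(2)] Zc[OF x] by (simp add: m_assoc)
        next
          case (sum b1 b2)
          have "b1 \<in> carrier R" "b2 \<in> carrier R"
            using sum ideal_prod_in_carrier[OF idE idE] by blast+
          then show ?case using sum ideal_add[OF idP] Zc[OF x] by (simp add: l_distr)
        qed
      qed
      then show ?thesis using x by (simp add: K_def)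
    qed
    then have "x \<in> K N n" using N[of j n] mn by (simp add: j_def)
    \<comment> \<open>The condition defining \<open>K N n\<close> is read at \<open>r = n\<close>
      with multiplier 1; the degree qualifies because \<open>m + of_nat N \<le> n\<close>.\<close>
    then have "\<one> \<otimes> x \<in> P n" using n E_zero by (simp add: K_def)
    then show ?thesis using Zc[OF x] by simp
  qed
  then show ?thesis by blast
qed

section \<open>Common annihilators and irregular sets of parameters\<close>

definition annihilated :: "('t \<Rightarrow> 'a) \<Rightarrow> 't set \<Rightarrow> 's mdeg \<Rightarrow> 'a set"
  where "annihilated c A n = {x \<in> F n. \<forall>t\<in>A. c t \<otimes> x \<in> P (n + 1)}"

definition ev_regular :: "('t \<Rightarrow> 'a) \<Rightarrow> 't set \<Rightarrow> bool"
  where "ev_regular c A \<longleftrightarrow> (\<exists>m'. \<forall>n\<ge>m'. annihilated c A n \<subseteq> P n)"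

lemma ev_regular_mono: "ev_regular c A \<Longrightarrow> A \<subseteq> B \<Longrightarrow> ev_regular c B"
  unfolding ev_regular_def annihilated_def by (fast intro: order_trans)

context
  fixes c :: "'t \<Rightarrow> 'a" and T :: "'t set"
  assumes c: "\<And>t. t \<in> T \<Longrightarrow> c t \<in> E 1"
begin

lemma c_carr: "t \<in> T \<Longrightarrow> c t \<in> carrier R"
  using c E_carr by blast

lemma annihilated_ideal:
  assumes "A \<subseteq> T"
  shows "ideal (annihilated c A n) R"
proof (rule ideal_intro)
  have cc: "\<And>t. t \<in> A \<Longrightarrow> c t \<in> carrier R" using assms c_carr by blast
  show "annihilated c A n \<subseteq> carrier R" using F_carr by (auto simp: annihilated_def)
  show "\<zero> \<in> annihilated c A n"
    using ideal_zero[OF idF] ideal_zero[OF idP] cc by (auto simp: annihilated_def)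
  show "x \<oplus> y \<in> annihilated c A n" if "x \<in> annihilated c A n" "y \<in> annihilated c A n" for x y
    using that ideal_add[OF idF] ideal_add[OF idP] cc F_carr by (auto simp: annihilated_def r_distr)
  show "r \<otimes> x \<in> annihilated c A n" if "r \<in> carrier R" "x \<in> annihilated c A n" for r x
  proof -
    have "x \<in> carrier R" using \<open>x \<in> annihilated c A n\<close> F_carr by (auto simp: annihilated_def)
    then have "c t \<otimes> (r \<otimes> x) = r \<otimes> (c t \<otimes> x)" if "t \<in> A" for t
      using cc[OF that] \<open>r \<in> carrier R\<close> by (simp add: m_lcomm)
    then show ?thesis using that ideal_mult_l[OF idF] ideal_mult_l[OF idP] by (auto simp: annihilated_def)
  qed
qed

lemma annihilated_sub: "annihilated c A n \<subseteq> F n"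
  by (auto simp: annihilated_def)

lemma sub_annihilated: "A \<subseteq> T \<Longrightarrow> P n \<subseteq> annihilated c A n"
  using PF EP[OF c, of _ _ n] by (fastforce simp: annihilated_def add.commute)

lemma annihilated_mult:
  assumes "A \<subseteq> T" "b \<in> E p" "x \<in> annihilated c A n"
  shows "b \<otimes> x \<in> annihilated c A (p + n)"
proof -
  have x: "x \<in> F n" using assms(3) by (simp add: annihilated_def)
  have "c t \<otimes> (b \<otimes> x) \<in> P (p + n + 1)" if "t \<in> A" for t
  proof -
    have "c t \<otimes> x \<in> P (n + 1)" using assms(3) that by (simp add: annihilated_def)
    then have "b \<otimes> (c t \<otimes> x) \<in> P (p + (n + 1))" using EP assms(2) by blast
    moreover have "c t \<otimes> (b \<otimes> x) = b \<otimes> (c t \<otimes> x)"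
      using c_carr[of t] that assms(1) E_carr[OF assms(2)] F_carr[OF x] by (auto simp: m_lcomm)
    ultimately show ?thesis by (simp add: add.assoc)
  qed
  then show ?thesis using EF[OF assms(2) x] by (simp add: annihilated_def)
qed

text \<open>Maximality need only be tested by adding one parameter, because regularity passes to
  larger sets. From infinitely many such sets a sequence is drawn whose annihilators have partial
  sums that must become stationary.\<close>

lemma finite_maximal_irregular:
  "finite {A. finite A \<and> A \<subseteq> T \<and> \<not> ev_regular c A \<and> (\<forall>g\<in>T - A. ev_regular c (insert g A))}"
  (is "finite ?M")
proof (rule ccontr)
  assume "infinite ?M"
  then obtain A :: "nat \<Rightarrow> 't set" where inj: "inj A" and A: "range A \<subseteq> ?M"
    using infinite_countable_subset by blast
  have AT: "A j \<subseteq> T" and Abad: "\<not> ev_regular c (A j)"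
    and Amax: "\<And>g. g \<in> T - A j \<Longrightarrow> ev_regular c (insert g (A j))" for j
    using A by auto
  \<comment> \<open>No set of the sequence contains another: if \<open>A l\<close> were properly
    inside \<open>A j\<close>, adding to it one element of \<open>A j\<close> would give a regular
    set, and then \<open>A j\<close> would be regular as well.\<close>
  have sep: "\<exists>g\<in>A l. g \<in> T - A j" if "l \<noteq> j" for l j
  proof (rule ccontr)
    assume "\<not> ?thesis"
    then have "A l \<subseteq> A j" using AT by blast
    moreover have "A l \<noteq> A j" using inj that by (auto dest: injD)
    ultimately obtain h where h: "h \<in> A j" "h \<notin> A l" by blast
    then have "ev_regular c (insert h (A l))" using Amax AT by blast
    then have "ev_regular c (A j)" using ev_regular_mono \<open>A l \<subseteq> A j\<close> h by (metis insert_subset)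
    then show False using Abad by blast
  qed
  define W where "W j = annihilated c (A j)" for j
  have idW: "ideal (W j n) R" for j n unfolding W_def using annihilated_ideal AT .
  have EW: "b \<otimes> x \<in> W j (p + n)" if "b \<in> E p" "x \<in> W j n" for b x j p n
    using that annihilated_mult AT unfolding W_def by blast
  have WF: "W j n \<subseteq> F n" for j n unfolding W_def using annihilated_sub .
  \<comment> \<open>Partial sums of the annihilators, started at \<open>P\<close> so that the whole
    chain lies between \<open>P\<close> and \<open>F\<close>.\<close>
  define K where "K = rec_nat P (\<lambda>j k n. k n <+>\<^bsub>R\<^esub> W j n)"
  have K0: "K 0 = P" and KS: "K (Suc j) n = K j n <+>\<^bsub>R\<^esub> W j n" for j n unfolding K_def by auto
  have idK: "ideal (K j n) R" for j n
    by (induction j) (auto simp: K0 KS idP intro!: add_ideals idW)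
  have KF: "K j n \<subseteq> F n" for j n
    by (induction j) (simp_all add: K0 KS PF WF set_add_sub_ideal[OF idF])
  have Kasc: "K j n \<subseteq> K (Suc j) n" for j n
    unfolding KS using idW ideal_carr[OF idK] by (intro ideal_sub_set_add_l) auto
  have WK: "W j n \<subseteq> K (Suc j) n" for j n
    unfolding KS using idK ideal_carr[OF idW] by (intro ideal_sub_set_add_r) auto
  have EK: "b \<otimes> x \<in> K j (p + n)" if "b \<in> E p" "x \<in> K j n" for b x j p n
    using that(2)
  proof (induction j arbitrary: x)
    case 0
    then show ?case using EP[OF that(1)] unfolding K0 by blast
  next
    case (Suc j)
    then obtain u v where u: "u \<in> K j n" and v: "v \<in> W j n" and e: "x = u \<oplus> v"
      by (auto simp: KS mem_set_add_iff)
    have "b \<otimes> x = b \<otimes> u \<oplus> b \<otimes> v"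
      unfolding e using E_carr[OF that(1)] ideal_carr[OF idK u] ideal_carr[OF idW v] by (simp add: r_distr)
    then show ?case using Suc.IH[OF u] EW[OF that(1) v] unfolding KS mem_set_add_iff by blast
  qed
  have "\<exists>N. \<forall>j\<ge>N. \<forall>n\<ge>m. K j n = K N n"
  proof (rule chain_stabilises)
    show "P n \<subseteq> K j n" for j n using Kasc by (induction j) (auto simp: K0)
  qed (use idK EK KF Kasc in auto)
  then obtain N where N: "\<And>j n. j \<ge> N \<Longrightarrow> n \<ge> m \<Longrightarrow> K j n = K N n" by blast
  \<comment> \<open>directness in large degrees: \<open>c g\<close> with \<open>g \<in> A k - A N\<close> kills \<open>W k\<close> but is injective on \<open>W N\<close> there\<close>
  have indep: "\<exists>m'. \<forall>n\<ge>m'. W N n \<inter> K k n \<subseteq> P n" if "k \<le> N" for k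
    using that
  proof (induction k)
    case 0
    then show ?case by (auto simp: K0)
  next
    case (Suc k)
    then obtain m1 where m1: "\<And>n. n \<ge> m1 \<Longrightarrow> W N n \<inter> K k n \<subseteq> P n" by auto
    obtain g where g: "g \<in> A k" "g \<in> T - A N" using sep[of k N] Suc.prems by auto
    obtain m2 where m2: "\<And>n. n \<ge> m2 \<Longrightarrow> annihilated c (insert g (A N)) n \<subseteq> P n"
      using Amax[OF g(2)] by (auto simp: ev_regular_def)
    have gE: "c g \<in> E 1" using c g by blast
    have "x \<in> P n" if n: "n \<ge> sup m1 m2" and x: "x \<in> W N n" "x \<in> K (Suc k) n" for n x
    proof -
      obtain u v where u: "u \<in> K k n" and v: "v \<in> W k n" and e: "x = u \<oplus> v"
        using x(2) by (auto simp: KS mem_set_add_iff)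
      have "c g \<otimes> v \<in> P (n + 1)" using v g(1) by (simp add: W_def annihilated_def)
      moreover have "P (n + 1) \<subseteq> K k (n + 1)" using Kasc by (induction k) (auto simp: K0)
      ultimately have gv: "c g \<otimes> v \<in> K k (n + 1)" by blast
      have "c g \<otimes> x = c g \<otimes> u \<oplus> c g \<otimes> v"
        unfolding e using E_carr[OF gE] ideal_carr[OF idK u] ideal_carr[OF idW v] by (simp add: r_distr)
      moreover have "c g \<otimes> u \<in> K k (n + 1)" using EK[OF gE u] by (simp add: add.commute)
      ultimately have "c g \<otimes> x \<in> K k (n + 1)" using ideal_add[OF idK] gv by metis
      moreover have "c g \<otimes> x \<in> W N (n + 1)" using EW[OF gE x(1)] by (simp add: add.commute)
      moreover have "m1 \<le> n + 1" using n by (auto simp: le_fun_def intro: order_trans[of _ "n _"])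
      ultimately have "c g \<otimes> x \<in> P (n + 1)" using m1 by blast
      then have "x \<in> annihilated c (insert g (A N)) n" using x(1) by (simp add: W_def annihilated_def)
      then show ?thesis using m2 n by (auto simp: subset_iff)
    qed
    then show ?case by blast
  qed
  obtain m' where m': "\<And>n. n \<ge> m' \<Longrightarrow> W N n \<inter> K N n \<subseteq> P n" using indep by blast
  \<comment> \<open>Stationarity gives \<open>W N n \<subseteq> K (Suc N) n = K N n\<close>, so the
    intersection controlled by \<open>m'\<close> is all of \<open>W N n\<close>.\<close>
  have "annihilated c (A N) n \<subseteq> P n" if "n \<ge> sup m m'" for n
    using m'[of n] WK[of N n] N[of "Suc N" n] that unfolding W_def by auto
  then have "ev_regular c (A N)" unfolding ev_regular_def by blast
  then show False using Abad by blast
qed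

text \<open>Every irregular parameter lies in a maximal irregular set; there are finitely many of
  these, and each is finite. The assumption expresses that whatever is killed modulo an ideal by
  \<open>d\<close> of the elements \<open>c t\<close> is killed by all of \<open>Y\<close>.\<close>

lemma finite_irregular:
  assumes "\<And>A. A \<subseteq> T \<Longrightarrow> finite A \<Longrightarrow> card A = d \<Longrightarrow>
    (\<And>J x. ideal J R \<Longrightarrow> x \<in> carrier R \<Longrightarrow> (\<And>t. t \<in> A \<Longrightarrow> c t \<otimes> x \<in> J) \<Longrightarrow> (\<And>y. y \<in> Y \<Longrightarrow> y \<otimes> x \<in> J))"
  shows "finite {t \<in> T. \<not> ev_regular c {t}}"
proof -
  \<comment> \<open>The annihilator of a \<open>d\<close>-element subset is killed by
    \<open>Y\<close> modulo \<open>P\<close>, so it vanishes in large degrees by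
    \<open>annihilated_eventually\<close>; larger sets follow by monotonicity.\<close>
  have big: "ev_regular c A" if A: "A \<subseteq> T" "finite A" "d \<le> card A" for A
  proof -
    obtain B where B: "B \<subseteq> A" "card B = d" "finite B"
      using A by (meson obtain_subset_with_card_n)
    have BT: "B \<subseteq> T" using A B by blast
    have "ev_regular c B"
      unfolding ev_regular_def
    proof (rule annihilated_eventually)
      fix n y x assume y: "y \<in> Y" and x: "x \<in> annihilated c B n"
      show "y \<otimes> x \<in> P (n + 1)"
      proof (rule assms[OF BT B(3,2) idP _ _ y])
        show "x \<in> carrier R" using x F_carr by (auto simp: annihilated_def)
      qed (use x in \<open>auto simp: annihilated_def\<close>)
    qed (use BT annihilated_ideal sub_annihilated annihilated_sub annihilated_mult in auto)
    then show ?thesis using ev_regular_mono B(1) by blast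
  qed
  let ?M = "{A. finite A \<and> A \<subseteq> T \<and> \<not> ev_regular c A \<and> (\<forall>g\<in>T - A. ev_regular c (insert g A))}"
  have "{t \<in> T. \<not> ev_regular c {t}} \<subseteq> \<Union>?M"
  proof
    fix t assume t: "t \<in> {t \<in> T. \<not> ev_regular c {t}}"
    \<comment> \<open>The irregular sets containing \<open>t\<close> have fewer than
      \<open>d\<close> elements, so one of greatest cardinality exists, and such a set is
      maximal.\<close>
    define Q where "Q A \<longleftrightarrow> t \<in> A \<and> finite A \<and> A \<subseteq> T \<and> \<not> ev_regular c A" for A
    have "Q {t}" using t by (auto simp: Q_def)
    moreover have "\<forall>A. Q A \<longrightarrow> card A < d" using big unfolding Q_def by (meson not_le)
    ultimately obtain A where A: "Q A" "\<And>B. Q B \<Longrightarrow> card B \<le> card A"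
      using ex_has_greatest_nat[of Q "{t}" card d] by blast
    have "ev_regular c (insert g A)" if g: "g \<in> T - A" for g
    proof (rule ccontr)
      assume "\<not> ?thesis"
      then have "Q (insert g A)" using A(1) g by (auto simp: Q_def)
      then show False using A(2)[of "insert g A"] A(1) g by (auto simp: Q_def)
    qed
    then have "A \<in> ?M" "t \<in> A" using A(1) by (auto simp: Q_def)
    then show "t \<in> \<Union>?M" by blast
  qed
  moreover have "finite (\<Union>?M)" using finite_maximal_irregular by auto
  ultimately show ?thesis by (rule finite_subset)
qed

end

end

section \<open>Powers of ideals and admissible filtrations\<close>

definition unit_deg :: "'s \<Rightarrow> 's mdeg"
  where "unit_deg i = (\<lambda>j. if j = i then 1 else 0)"

lemma unit_deg_nonneg: "0 \<le> unit_deg i" and unit_deg_nonzero: "unit_deg i \<noteq> 0"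
  by (auto simp: unit_deg_def le_fun_def fun_eq_iff)

lemma (in cring) finsum_in_ideal:
  assumes "ideal J R" "\<And>p. p \<in> A \<Longrightarrow> h p \<in> J"
  shows "(\<Oplus>p\<in>A. h p) \<in> J"
  using assms(2)
proof (induction A rule: infinite_finite_induct)
  case (infinite A)
  then show ?case using ideal_zero[OF assms(1)] by simp
next
  case empty
  then show ?case using ideal_zero[OF assms(1)] by simp
next
  case (insert p A)
  then have "(\<Oplus>p\<in>insert p A. h p) = h p \<oplus> (\<Oplus>p\<in>A. h p)"
    using ideal_carr[OF assms(1)] by (intro finsum_insert) auto
  then show ?case using insert ideal_add[OF assms(1)] by simp
qed

lemma (in cring) genideal_mult_in_ideal:
  assumes "ideal K R" "S \<subseteq> carrier R" "r \<in> carrier R" "\<And>x. x \<in> S \<Longrightarrow> r \<otimes> x \<in> K"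
    and "x \<in> Idl S"
  shows "r \<otimes> x \<in> K"
proof -
  have "Idl S \<subseteq> {x \<in> carrier R. r \<otimes> x \<in> K}"
    using assms by (intro genideal_minimal ideal_preimage_mult oneideal) auto
  then show ?thesis using assms(5) by blast
qed

section \<open>Products of powers of the given ideals\<close>

locale ideal_family = cring R for R :: "('a, 'b) ring_scheme" (structure) +
  fixes I :: "'s::finite \<Rightarrow> 'a set"
  assumes idI: "\<And>i. ideal (I i) R"
begin

sublocale IS: comm_monoid "ideals_set R"
  by (rule ideals_set_is_comm_monoid)

lemma carrier_IS: "J \<in> carrier (ideals_set R) \<longleftrightarrow> ideal J R"
  by (simp add: ideals_set_def)

lemma mult_IS: "A \<otimes>\<^bsub>ideals_set R\<^esub> B = A \<cdot> B"
  by (simp add: ideals_set_def)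

abbreviation E :: "'s mdeg \<Rightarrow> 'a set"
  where "E \<equiv> ideal_mpow R I"

lemma pow_IS: "I i [^]\<^bsub>ideals_set R\<^esub> (k::nat) \<in> carrier (ideals_set R)"
  using idI carrier_IS by blast

lemma mpow_ideal: "ideal (E n) R"
  using IS.finprod_closed[of "\<lambda>i. I i [^]\<^bsub>ideals_set R\<^esub> nat (n i)" UNIV] pow_IS
  unfolding ideal_mpow_def carrier_IS[symmetric] by blast

lemma mpow_carr: "x \<in> E n \<Longrightarrow> x \<in> carrier R"
  using ideal_carr[OF mpow_ideal] .

lemma mpow_add:
  assumes "0 \<le> p" "0 \<le> q"
  shows "E (p + q) = E p \<cdot> E q"
proof -
  have *: "I i [^]\<^bsub>ideals_set R\<^esub> nat ((p + q) i) =
    I i [^]\<^bsub>ideals_set R\<^esub> nat (p i) \<otimes>\<^bsub>ideals_set R\<^esub> I i [^]\<^bsub>ideals_set R\<^esub> nat (q i)" for i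
  proof -
    have "0 \<le> p i" "0 \<le> q i" using assms by (auto simp: le_fun_def)
    then show ?thesis
      using idI carrier_IS by (simp add: IS.nat_pow_mult nat_add_distrib del: pow_nat)
  qed
  show ?thesis
    unfolding ideal_mpow_def * mult_IS[symmetric]
    using pow_IS by (intro IS.finprod_multf) auto
qed

lemma mpow_pos_part: "E (pos_part n) = E n"
proof -
  have "nat (max 0 k) = nat k" for k :: int by simp
  then show ?thesis by (simp add: ideal_mpow_def pos_part_def del: pow_nat)
qed

lemma mpow_zero: "E 0 = carrier R"
  unfolding ideal_mpow_def by (simp add: IS.finprod_one_eqI) (simp add: ideals_set_def)

lemma mpow_antimono:
  assumes "p \<le> q"
  shows "E q \<subseteq> E p"
proof -
  have "pos_part q = pos_part p + (pos_part q - pos_part p)" by simp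
  moreover have "0 \<le> pos_part p" by (simp add: pos_part_def le_fun_def)
  moreover have "pos_part p \<le> pos_part q"
    unfolding pos_part_def by (intro le_funI max.mono order_refl le_funD[OF assms])
  then have "0 \<le> pos_part q - pos_part p" by simp
  ultimately have "E (pos_part q) = E (pos_part p) \<cdot> E (pos_part q - pos_part p)"
    using mpow_add by metis
  then show ?thesis using ideal_prod_inter[OF mpow_ideal mpow_ideal] mpow_pos_part by auto
qed

text \<open>Negative exponents are cut off at 0, so degrees need not add up; but the sum of the
  positive parts dominates \<open>p + q\<close>, and \<open>E\<close> is decreasing.\<close>

lemma mpow_mult:
  assumes "x \<in> E p" "y \<in> E q"
  shows "x \<otimes> y \<in> E (p + q)"
proof -
  have "x \<otimes> y \<in> E (pos_part p) \<cdot> E (pos_part q)"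
    using assms mpow_pos_part by (intro ideal_prod.prod) auto
  also have "\<dots> = E (pos_part p + pos_part q)"
    by (rule mpow_add[symmetric]) (auto simp: pos_part_def le_fun_def)
  also have "\<dots> \<subseteq> E (p + q)"
    by (rule mpow_antimono) (auto simp: pos_part_def le_fun_def)
  finally show ?thesis .
qed

lemma mpow_unit_deg: "E (unit_deg i) = I i"
proof -
  have "E (unit_deg i) = (\<Otimes>\<^bsub>ideals_set R\<^esub>j\<in>UNIV. if i = j then I j else \<one>\<^bsub>ideals_set R\<^esub>)"
    unfolding ideal_mpow_def
  proof (rule IS.finprod_cong')
    fix j
    show "I j [^]\<^bsub>ideals_set R\<^esub> nat (unit_deg i j) = (if i = j then I j else \<one>\<^bsub>ideals_set R\<^esub>)"
      using idI carrier_IS IS.nat_pow_eone[of "I j"] by (auto simp: unit_deg_def simp del: pow_nat)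
  qed (use idI carrier_IS IS.one_closed in auto)
  also have "\<dots> = I i"
    using idI carrier_IS by (intro IS.finprod_singleton) auto
  finally show ?thesis .
qed

lemma finprod_in_mpow_one:
  assumes "\<And>i. a i \<in> I i"
  shows "(\<Otimes>i\<in>UNIV. a i) \<in> E 1"
proof -
  have ac: "a i \<in> carrier R" for i using assms ideal_carr[OF idI] by blast
  have "(\<Otimes>i\<in>A. a i) \<in> (\<Otimes>\<^bsub>ideals_set R\<^esub>i\<in>A. I i)" if "finite A" for A
    using that
  proof induction
    case empty
    then show ?case using IS.finprod_empty[of I] by (simp add: ideals_set_def)
  next
    case (insert i A)
    have "(\<Otimes>i\<in>insert i A. a i) = a i \<otimes> (\<Otimes>i\<in>A. a i)"
      using insert ac by (intro finprod_insert) auto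
    moreover have "(\<Otimes>\<^bsub>ideals_set R\<^esub>i\<in>insert i A. I i) = I i \<cdot> (\<Otimes>\<^bsub>ideals_set R\<^esub>i\<in>A. I i)"
      unfolding mult_IS[symmetric] using insert idI carrier_IS by (intro IS.finprod_insert) auto
    ultimately show ?case using insert assms by (simp add: ideal_prod.prod)
  qed
  moreover have "E 1 = (\<Otimes>\<^bsub>ideals_set R\<^esub>i\<in>UNIV. I i)"
    unfolding ideal_mpow_def
    using idI carrier_IS IS.nat_pow_eone by (intro IS.finprod_cong') (auto simp del: pow_nat)
  ultimately show ?thesis by simp
qed

end

section \<open>Filtrations and their generation in large degrees\<close>

locale ideal_filtered = ideal_family +
  fixes F
  assumes filtration: "ideal_filtration R I F"
begin

lemma F_ideal: "ideal (F n) R"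
  and E_sub_F: "E n \<subseteq> F n"
  and F_antimono: "n \<le> p \<Longrightarrow> F p \<subseteq> F n"
  using filtration by (auto simp: ideal_filtration_def)

lemma F_carr: "x \<in> F n \<Longrightarrow> x \<in> carrier R"
  using ideal_carr[OF F_ideal] .

lemma F_mult: "x \<in> F p \<Longrightarrow> y \<in> F q \<Longrightarrow> x \<otimes> y \<in> F (p + q)"
  using filtration unfolding ideal_filtration_def by (meson ideal_prod.prod subsetD)

lemma EF_mult: "x \<in> E p \<Longrightarrow> y \<in> F q \<Longrightarrow> x \<otimes> y \<in> F (p + q)"
  using E_sub_F F_mult by blast

lemma ext_rees_carr: "f \<in> carrier (ext_rees R F) \<Longrightarrow> f n \<in> carrier R"
  by (auto simp: ext_rees_def intro: F_carr[of _ n])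

lemma ext_rees_abelian_group: "abelian_group (ext_rees R F)"
proof (rule abelian_groupI)
  fix f g assume "f \<in> carrier (ext_rees R F)" "g \<in> carrier (ext_rees R F)"
  then show "f \<oplus>\<^bsub>ext_rees R F\<^esub> g \<in> carrier (ext_rees R F)"
    using ideal_add[OF F_ideal]
    by (auto simp: ext_rees_def intro: finite_subset[of _ "{n. f n \<noteq> \<zero>} \<union> {n. g n \<noteq> \<zero>}"])
next
  fix f assume "f \<in> carrier (ext_rees R F)"
  moreover from this have "f n \<in> carrier R" for n using F_carr by (auto simp: ext_rees_def)
  ultimately show "\<exists>g\<in>carrier (ext_rees R F). g \<oplus>\<^bsub>ext_rees R F\<^esub> f = \<zero>\<^bsub>ext_rees R F\<^esub>"
    using ideal_uminus[OF F_ideal] F_carr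
    by (intro bexI[of _ "\<lambda>n. \<ominus> f n"])
      (auto simp: ext_rees_def l_neg intro!: ext elim!: finite_subset[rotated])
next
  fix f g h assume "f \<in> carrier (ext_rees R F)" "g \<in> carrier (ext_rees R F)" "h \<in> carrier (ext_rees R F)"
  then have "f n \<in> carrier R" "g n \<in> carrier R" "h n \<in> carrier R" for n
    by (simp_all add: ext_rees_carr)
  then show "f \<oplus>\<^bsub>ext_rees R F\<^esub> g \<oplus>\<^bsub>ext_rees R F\<^esub> h = f \<oplus>\<^bsub>ext_rees R F\<^esub> (g \<oplus>\<^bsub>ext_rees R F\<^esub> h)"
    and "f \<oplus>\<^bsub>ext_rees R F\<^esub> g = g \<oplus>\<^bsub>ext_rees R F\<^esub> f"
    and "\<zero>\<^bsub>ext_rees R F\<^esub> \<oplus>\<^bsub>ext_rees R F\<^esub> f = f"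
    by (simp_all add: ext_rees_def a_ac)
qed (use ideal_zero[OF F_ideal] in \<open>auto simp: ext_rees_def\<close>)

text \<open>The nonzero coefficients of given generators, paired with their degrees, serve as
  homogeneous generators. The Laurent polynomials with coefficients in the ideals these pairs span
  form a submodule containing the given generators, hence the whole module.\<close>

lemma finite_module_homogeneous_generators:
  assumes "finite_module (ext_rees R E) (ext_rees R F)"
  obtains Gs where "finite Gs" "\<And>g p. (g, p) \<in> Gs \<Longrightarrow> g \<in> F p"
    and "\<And>n. F n \<subseteq> Idl {b \<otimes> g | b g p. (g, p) \<in> Gs \<and> b \<in> E (n - p)}"
proof -
  interpret M: abelian_group "ext_rees R F" by (rule ext_rees_abelian_group)
  obtain Y where Y: "finite Y" "Y \<subseteq> carrier (ext_rees R F)"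
    and gen: "gen_submodule (ext_rees R E) (ext_rees R F) Y = carrier (ext_rees R F)"
    using assms by (auto simp: finite_module_def)
  define Gs where "Gs = (\<Union>f\<in>Y. (\<lambda>p. (f p, p)) ` {p. f p \<noteq> \<zero>})"
  have fin: "finite Gs" using Y by (auto simp: Gs_def ext_rees_def)
  have GF: "g \<in> F p" if "(g, p) \<in> Gs" for g p using that Y by (auto simp: Gs_def ext_rees_def)
  define S where "S n = {b \<otimes> g | b g p. (g, p) \<in> Gs \<and> b \<in> E (n - p)}" for n
  have SF: "S n \<subseteq> F n" for n
  proof
    fix x assume "x \<in> S n"
    then obtain b g p where "x = b \<otimes> g" "(g, p) \<in> Gs" "b \<in> E (n - p)" by (auto simp: S_def)
    then show "x \<in> F n" using EF_mult[of b "n - p" g p] GF by simp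
  qed
  then have Sc: "S n \<subseteq> carrier R" for n using F_carr by blast
  define H where "H n = Idl (S n)" for n
  have idH: "ideal (H n) R" for n unfolding H_def using genideal_ideal Sc .
  have HF: "H n \<subseteq> F n" for n unfolding H_def using genideal_minimal F_ideal SF .
  have EH: "r \<otimes> x \<in> H (q + n)" if r: "r \<in> E q" and x: "x \<in> H n" for r x q n
  proof (rule genideal_mult_in_ideal[OF idH Sc mpow_carr[OF r] _ x[unfolded H_def]])
    fix x assume "x \<in> S n"
    then obtain b g p where x: "x = b \<otimes> g" "(g, p) \<in> Gs" "b \<in> E (n - p)" by (auto simp: S_def)
    have "r \<otimes> b \<in> E (q + n - p)" using mpow_mult[OF r x(3)] by (simp add: algebra_simps)
    moreover have "r \<otimes> x = (r \<otimes> b) \<otimes> g"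
      using x mpow_carr[OF r] mpow_carr[OF x(3)] F_carr[OF GF[OF x(2)]] by (simp add: m_assoc)
    ultimately have "r \<otimes> x \<in> S (q + n)" using x(2) by (auto simp: S_def)
    then show "r \<otimes> x \<in> H (q + n)" unfolding H_def using genideal_self[OF Sc] by blast
  qed
  let ?N = "{f \<in> carrier (ext_rees R F). \<forall>n. f n \<in> H n}"
  have add: "(f \<oplus>\<^bsub>ext_rees R F\<^esub> g) n = f n \<oplus> g n" for f g n by (simp add: ext_rees_def)
  have zero: "\<zero>\<^bsub>ext_rees R F\<^esub> n = \<zero>" for n by (simp add: ext_rees_def)
  have "submodule ?N (ext_rees R E) (ext_rees R F)"
  proof (rule submodule.intro)
    show "subgroup ?N (add_monoid (ext_rees R F))"
    proof (rule subgroup.intro)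
      fix f assume f: "f \<in> ?N"
      have "(\<lambda>n. \<ominus> f n) \<in> carrier (ext_rees R F)"
        using f ideal_uminus[OF F_ideal] F_carr
        by (auto simp: ext_rees_def elim!: finite_subset[rotated])
      moreover have "(\<lambda>n. \<ominus> f n) \<oplus>\<^bsub>ext_rees R F\<^esub> f = \<zero>\<^bsub>ext_rees R F\<^esub>"
      proof
        fix n
        have "f n \<in> carrier R" using f F_carr by (auto simp: ext_rees_def)
        then show "((\<lambda>n. \<ominus> f n) \<oplus>\<^bsub>ext_rees R F\<^esub> f) n = \<zero>\<^bsub>ext_rees R F\<^esub> n"
          by (simp add: add zero l_neg)
      qed
      ultimately have "\<ominus>\<^bsub>ext_rees R F\<^esub> f = (\<lambda>n. \<ominus> f n)" using f M.minus_equality by blast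
      moreover have "(\<lambda>n. \<ominus> f n) \<in> ?N"
        using f \<open>(\<lambda>n. \<ominus> f n) \<in> _\<close> ideal_uminus[OF idH] by blast
      ultimately show "inv\<^bsub>add_monoid (ext_rees R F)\<^esub> f \<in> ?N" by (simp add: a_inv_def)
    next
      fix f g assume fg: "f \<in> ?N" "g \<in> ?N"
      then have "f \<oplus>\<^bsub>ext_rees R F\<^esub> g \<in> carrier (ext_rees R F)" by blast
      then show "f \<otimes>\<^bsub>add_monoid (ext_rees R F)\<^esub> g \<in> ?N" using fg ideal_add[OF idH] by (simp add: add)
    next
      have "\<zero>\<^bsub>ext_rees R F\<^esub> \<in> ?N" using zero ideal_zero[OF idH] by simp
      then show "\<one>\<^bsub>add_monoid (ext_rees R F)\<^esub> \<in> ?N" by simp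
    qed auto
    show "submodule_axioms ?N (ext_rees R E) (ext_rees R F)"
    proof
      fix r f assume r: "r \<in> carrier (ext_rees R E)" and f: "f \<in> ?N"
      have rE: "r p \<in> E p" and finr: "finite {p. r p \<noteq> \<zero>}" for p using r by (auto simp: ext_rees_def)
      have finf: "finite {p. f p \<noteq> \<zero>}" using f by (auto simp: ext_rees_def)
      have H: "rees_mult R r f n \<in> H n" for n
        unfolding rees_mult_def
      proof (rule finsum_in_ideal[OF idH])
        fix p show "r p \<otimes> f (n - p) \<in> H n" using EH[OF rE, of "f (n - p)" "n - p" p] f by simp
      qed
      \<comment> \<open>The support of a product is contained in the finite set of sums of two
        supporting degrees.\<close>
      have "rees_mult R r f n = \<zero>" if n: "n \<notin> (\<lambda>(p, q). p + q) ` ({p. r p \<noteq> \<zero>} \<times> {p. f p \<noteq> \<zero>})" for n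
        unfolding rees_mult_def
      proof (rule add.finprod_one_eqI)
        fix p assume p: "p \<in> {p. r p \<noteq> \<zero>}"
        have "f (n - p) = \<zero>"
        proof (rule ccontr)
          assume "f (n - p) \<noteq> \<zero>"
          then have "n \<in> (\<lambda>(p, q). p + q) ` ({p. r p \<noteq> \<zero>} \<times> {p. f p \<noteq> \<zero>})"
            using p by (intro image_eqI[of _ _ "(p, n - p)"]) auto
          then show False using n by blast
        qed
        then show "r p \<otimes> f (n - p) = \<zero>" using mpow_carr[OF rE] by simp
      qed
      then have "{n. rees_mult R r f n \<noteq> \<zero>} \<subseteq>
          (\<lambda>(p, q). p + q) ` ({p. r p \<noteq> \<zero>} \<times> {p. f p \<noteq> \<zero>})"
        by blast
      then have "finite {n. rees_mult R r f n \<noteq> \<zero>}"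
        by (rule finite_subset) (intro finite_imageI finite_cartesian_product finr finf)
      moreover have "rees_mult R r f n \<in> F n" for n using H HF by blast
      ultimately have "rees_mult R r f \<in> carrier (ext_rees R F)" by (simp add: ext_rees_def)
      then show "r \<odot>\<^bsub>ext_rees R F\<^esub> f \<in> ?N" using H by (simp add: ext_rees_def)
    qed
  qed
  moreover have "Y \<subseteq> ?N"
  proof
    fix f assume f: "f \<in> Y"
    have "f n \<in> H n" for n
    proof (cases "f n = \<zero>")
      case True
      then show ?thesis using ideal_zero[OF idH] by simp
    next
      case False
      then have g: "(f n, n) \<in> Gs" using f by (auto simp: Gs_def)
      moreover have "\<one> \<in> E (n - n)" using mpow_zero by simp
      ultimately have "\<one> \<otimes> f n \<in> S n" unfolding S_def by blast
      then show ?thesis using F_carr[OF GF[OF g]] genideal_self[OF Sc] unfolding H_def by auto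
    qed
    then show "f \<in> ?N" using f Y by blast
  qed
  ultimately have "gen_submodule (ext_rees R E) (ext_rees R F) Y \<subseteq> ?N"
    unfolding gen_submodule_def by (intro Inter_lower) simp
  then have N: "f n \<in> H n" if "f \<in> carrier (ext_rees R F)" for f n using gen that by blast
  have "F n \<subseteq> H n" for n
  proof
    fix x assume x: "x \<in> F n"
    \<comment> \<open>The monomial with coefficient \<open>x\<close> in degree \<open>n\<close>
      transfers the result from the Rees module to \<open>F n\<close>.\<close>
    have "(\<lambda>k. if k = n then x else \<zero>) \<in> carrier (ext_rees R F)"
      using x ideal_zero[OF F_ideal] by (auto simp: ext_rees_def intro: finite_subset[of _ "{n}"])
    from N[OF this, of n] show "x \<in> H n" by simp
  qed
  then show ?thesis using that[of Gs] fin GF unfolding H_def S_def by blast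
qed

text \<open>Once \<open>n\<close> dominates the degree \<open>p\<close> of every generator,
  \<open>n - p\<close> is nonnegative and \<open>E (n + unit_deg i - p)\<close> splits as
  \<open>I i \<cdot> E (n - p)\<close>; one factor \<open>I i\<close> can then be peeled off
  everything in \<open>F (n + unit_deg i)\<close>. The test ideal \<open>J\<close> has the form
  required by \<open>ops_gen\<close>.\<close>

lemma admissible_eventually_generated:
  assumes "finite_module (ext_rees R E) (ext_rees R F)"
  shows "\<exists>M. \<forall>n\<ge>M. \<forall>i J. ideal J R \<longrightarrow> (\<forall>b\<in>I i. \<forall>x\<in>F n. b \<otimes> x \<in> J) \<longrightarrow>
    F (n + unit_deg i) \<subseteq> J"
proof -
  obtain Gs where fin: "finite Gs" and GF: "\<And>g p. (g, p) \<in> Gs \<Longrightarrow> g \<in> F p"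
    and gen: "\<And>n. F n \<subseteq> Idl {b \<otimes> g | b g p. (g, p) \<in> Gs \<and> b \<in> E (n - p)}"
    using finite_module_homogeneous_generators[OF assms] by blast
  \<comment> \<open>The coordinatewise maximum of 0 and the degrees of the generators.\<close>
  define M where "M i = Max (insert 0 ((\<lambda>(g, p). p i) ` Gs))" for i
  have Mp: "p \<le> M" if "(g, p) \<in> Gs" for g p
    unfolding le_fun_def M_def using fin that by (force intro!: Max_ge)
  show ?thesis
  proof (intro exI[of _ M] allI impI)
    fix n i J assume n: "M \<le> n" and J: "ideal J R"
      and h: "\<forall>b\<in>I i. \<forall>x\<in>F n. b \<otimes> x \<in> J"
    have "b \<otimes> g \<in> J" if g: "(g, p) \<in> Gs" and b: "b \<in> E (n + unit_deg i - p)" for b g p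
    proof -
      have gc: "g \<in> carrier R" using F_carr GF[OF g] by blast
      have "0 \<le> n - p" using n Mp[OF g] by (simp add: order_trans)
      then have "E (unit_deg i + (n - p)) = I i \<cdot> E (n - p)"
        using mpow_add[OF unit_deg_nonneg] mpow_unit_deg by metis
      moreover have "unit_deg i + (n - p) = n + unit_deg i - p" by (simp add: algebra_simps)
      ultimately have "b \<in> I i \<cdot> E (n - p)" using b by simp
      then show ?thesis
      proof induction
        case (prod b1 b2)
        have "b2 \<otimes> g \<in> F n" using EF_mult[OF prod(2) GF[OF g]] by simp
        then have "b1 \<otimes> (b2 \<otimes> g) \<in> J" using h prod(1) by blast
        then show ?case using ideal_carr[OF idI prod(1)] mpow_carr[OF prod(2)] gc by (simp add: m_assoc)
      next
        case (sum b1 b2)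
        have "b1 \<in> carrier R" "b2 \<in> carrier R"
          using sum ideal_prod_in_carrier[OF idI mpow_ideal] by blast+
        then show ?case using sum ideal_add[OF J] gc by (simp add: l_distr)
      qed
    qed
    then have "{b \<otimes> g | b g p. (g, p) \<in> Gs \<and> b \<in> E (n + unit_deg i - p)} \<subseteq> J" by blast
    then show "F (n + unit_deg i) \<subseteq> J" using gen genideal_minimal[OF J] by (meson subset_trans)
  qed
qed

end

section \<open>The associated graded ring and module\<close>

lemma finite_atLeastAtMost_fun: "finite {p..q :: 's::finite \<Rightarrow> int}"
proof (rule finite_subset)
  show "{p..q} \<subseteq> (\<Pi>\<^sub>E i\<in>UNIV. {p i..q i})" by (auto simp: le_fun_def)
qed (simp add: finite_PiE)

section \<open>Cosets and convolution of families of representatives\<close>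

context ring
begin

lemma coset_mem: "ideal J R \<Longrightarrow> x \<in> carrier R \<Longrightarrow> x \<in> J +> x"
  using ideal_zero by (force simp: a_r_coset_def')

lemma coset_zero: "ideal J R \<Longrightarrow> J +> \<zero> = J"
  using ideal_carr by (auto simp: a_r_coset_def')

lemma coset_eqI:
  assumes "ideal J R" "x \<in> carrier R" "y \<in> carrier R" "x \<ominus> y \<in> J"
  shows "J +> x = J +> y"
proof -
  interpret ideal J R by fact
  show ?thesis using quotient_eq_iff_same_a_r_cos[OF assms(1-3)] assms(4) by simp
qed

lemma coset_subset_iff:
  assumes "ideal J R" "ideal K R" "J \<subseteq> K" "x \<in> carrier R"
  shows "J +> x \<subseteq> K \<longleftrightarrow> x \<in> K"
  using coset_mem[OF assms(1,4)] ideal_add[OF assms(2)] assms(3) by (auto simp: a_r_coset_def')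

lemma coset_add:
  assumes "ideal J R" "x \<in> carrier R" "y \<in> carrier R"
  shows "(J +> x) <+>\<^bsub>R\<^esub> (J +> y) = J +> (x \<oplus> y)"
  using abelian_subgroup.a_rcos_sum[OF abelian_subgroupI3[OF ideal.axioms(1)[OF assms(1)] is_abelian_group] assms(2,3)] .

lemma finsum_swap:
  assumes "finite A" "finite B" "\<And>i j. i \<in> A \<Longrightarrow> j \<in> B \<Longrightarrow> h i j \<in> carrier R"
  shows "(\<Oplus>i\<in>A. \<Oplus>j\<in>B. h i j) = (\<Oplus>j\<in>B. \<Oplus>i\<in>A. h i j)"
  using assms(1,3)
proof (induction A)
  case empty
  then show ?case by simp
next
  case (insert i A)
  have "(\<Oplus>i\<in>insert i A. \<Oplus>j\<in>B. h i j) = (\<Oplus>j\<in>B. h i j) \<oplus> (\<Oplus>i\<in>A. \<Oplus>j\<in>B. h i j)"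
    using insert by (intro finsum_insert) (auto intro!: finsum_closed)
  also have "\<dots> = (\<Oplus>j\<in>B. h i j \<oplus> (\<Oplus>i\<in>A. h i j))"
    using insert by (subst finsum_addf) (auto intro!: finsum_closed)
  also have "\<dots> = (\<Oplus>j\<in>B. \<Oplus>i\<in>insert i A. h i j)"
    using insert by (intro finsum_cong' refl) (auto intro!: finsum_closed)
  finally show ?case .
qed

text \<open>\<open>gr_mult\<close> lifted to representatives in \<open>R\<close>, where the ring
  laws become identities between finite sums of ring elements.\<close>

definition conv :: "('s mdeg \<Rightarrow> 'a) \<Rightarrow> ('s mdeg \<Rightarrow> 'a) \<Rightarrow> 's mdeg \<Rightarrow> 'a"
  where "conv x z n = (\<Oplus>p\<in>{0..n}. x p \<otimes> z (n - p))"

lemma conv_closed: "(\<And>p. x p \<in> carrier R) \<Longrightarrow> (\<And>p. z p \<in> carrier R) \<Longrightarrow> conv x z n \<in> carrier R"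
  unfolding conv_def by (intro finsum_closed) auto

lemma conv_assoc:
  fixes x y z :: "'s::finite mdeg \<Rightarrow> 'a"
  assumes x: "\<And>p. x p \<in> carrier R" and y: "\<And>p. y p \<in> carrier R" and z: "\<And>p. z p \<in> carrier R"
  shows "conv (conv x y) z n = conv x (conv y z) n"
proof -
  \<comment> \<open>Both sides are sums over the pairs \<open>q \<le> p\<close> in
    \<open>{0..n}\<close>. Extension by zero to the whole square lets the summations be exchanged;
    afterwards \<open>p - q\<close> becomes the inner variable.\<close>
  define G where "G p q = (if q \<le> p then x q \<otimes> y (p - q) \<otimes> z (n - p) else \<zero>)" for p q
  have Gc: "G p q \<in> carrier R" for p q using x y z by (simp add: G_def)
  have "conv (conv x y) z n = (\<Oplus>p\<in>{0..n}. \<Oplus>q\<in>{0..n}. G p q)"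
    unfolding conv_def[of "conv x y"]
  proof (intro finsum_cong' refl)
    fix p assume p: "p \<in> {0..n}"
    have "conv x y p \<otimes> z (n - p) = (\<Oplus>q\<in>{0..p}. x q \<otimes> y (p - q) \<otimes> z (n - p))"
      unfolding conv_def using x y z by (intro finsum_ldistr finite_atLeastAtMost_fun) auto
    also have "\<dots> = (\<Oplus>q\<in>{0..n}. G p q)"
    proof (rule add.finprod_mono_neutral_cong_left)
      show "{0..p} \<subseteq> {0..n}" using p by auto
      show "G p q = \<zero>" if "q \<in> {0..n} - {0..p}" for q using that by (auto simp: G_def)
      show "x q \<otimes> y (p - q) \<otimes> z (n - p) = G p q" if "q \<in> {0..p}" for q using that by (simp add: G_def)
    qed (use Gc finite_atLeastAtMost_fun in auto)
    finally show "conv x y p \<otimes> z (n - p) = (\<Oplus>q\<in>{0..n}. G p q)" .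
  qed (use Gc in \<open>auto intro!: finsum_closed\<close>)
  also have "\<dots> = (\<Oplus>q\<in>{0..n}. \<Oplus>p\<in>{0..n}. G p q)"
    using Gc by (intro finsum_swap finite_atLeastAtMost_fun)
  also have "\<dots> = conv x (conv y z) n"
    unfolding conv_def[of x]
  proof (intro finsum_cong' refl)
    fix q assume q: "q \<in> {0..n}"
    have "(\<Oplus>p\<in>{0..n}. G p q) = (\<Oplus>p\<in>{q..n}. x q \<otimes> y (p - q) \<otimes> z (n - p))"
    proof (rule add.finprod_mono_neutral_cong_right)
      show "{q..n} \<subseteq> {0..n}" using q by auto
      show "G p q = \<zero>" if "p \<in> {0..n} - {q..n}" for p using that by (auto simp: G_def)
      show "G p q = x q \<otimes> y (p - q) \<otimes> z (n - p)" if "p \<in> {q..n}" for p using that by (simp add: G_def)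
    qed (use Gc finite_atLeastAtMost_fun in auto)
    also have "{q..n} = (\<lambda>r. r + q) ` {0..n - q}"
    proof (intro equalityI subsetI)
      fix p assume "p \<in> {q..n}"
      then show "p \<in> (\<lambda>r. r + q) ` {0..n - q}"
        by (intro image_eqI[of _ _ "p - q"]) (auto intro: diff_right_mono)
    qed (auto simp: le_diff_eq)
    also have "(\<Oplus>p\<in>(\<lambda>r. r + q) ` {0..n - q}. x q \<otimes> y (p - q) \<otimes> z (n - p))
        = (\<Oplus>r\<in>{0..n - q}. x q \<otimes> y (r + q - q) \<otimes> z (n - (r + q)))"
      using x y z by (intro finsum_reindex) (auto simp: inj_on_def)
    also have "\<dots> = (\<Oplus>r\<in>{0..n - q}. x q \<otimes> (y r \<otimes> z (n - q - r)))"
      using x y z by (intro finsum_cong' refl) (auto simp: m_assoc algebra_simps)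
    also have "\<dots> = x q \<otimes> conv y z (n - q)"
      unfolding conv_def using x y z by (intro finsum_rdistr[symmetric] finite_atLeastAtMost_fun) auto
    finally show "(\<Oplus>p\<in>{0..n}. G p q) = x q \<otimes> conv y z (n - q)" .
  qed (use x y z conv_closed[of y z] in auto)
  finally show ?thesis .
qed

end

lemma (in cring) conv_comm:
  assumes x: "\<And>p. x p \<in> carrier R" and y: "\<And>p. y p \<in> carrier R"
  shows "conv x y n = conv y x n"
proof -
  have im: "{0..n} = (\<lambda>p. n - p) ` {0..n}"
  proof (intro equalityI subsetI)
    fix p assume "p \<in> {0..n}"
    then show "p \<in> (\<lambda>p. n - p) ` {0..n}" by (intro image_eqI[of _ _ "n - p"]) auto
  qed auto
  have "conv x y n = (\<Oplus>p\<in>(\<lambda>p. n - p) ` {0..n}. x p \<otimes> y (n - p))"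
    unfolding conv_def using im by simp
  also have "\<dots> = (\<Oplus>p\<in>{0..n}. x (n - p) \<otimes> y (n - (n - p)))"
    using x y by (intro finsum_reindex) (auto simp: inj_on_def)
  also have "\<dots> = conv y x n"
    unfolding conv_def using x y by (intro finsum_cong' refl) (auto simp: m_comm)
  finally show ?thesis .
qed

section \<open>Additive structure of the associated graded ring, for \<open>E\<close> and
  \<open>F\<close> alike\<close>

locale decreasing_ideals = cring R for R :: "('a, 'b) ring_scheme" (structure) +
  fixes X :: "'s::finite mdeg \<Rightarrow> 'a set"
  assumes X_ideal: "\<And>n. ideal (X n) R" and X_antimono: "\<And>n p. n \<le> p \<Longrightarrow> X p \<subseteq> X n"
begin

abbreviation G :: "('s mdeg \<Rightarrow> 'a set, 's mdeg \<Rightarrow> 'a set) module"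
  where "G \<equiv> assoc_gr R X"

definition reps :: "('s mdeg \<Rightarrow> 'a) set"
  where "reps = {x. (\<forall>n. x n \<in> X n) \<and> (\<forall>n. \<not> 0 \<le> n \<longrightarrow> x n = \<zero>) \<and> finite {n. x n \<noteq> \<zero>}}"

definition cls :: "('s mdeg \<Rightarrow> 'a) \<Rightarrow> 's mdeg \<Rightarrow> 'a set"
  where "cls x n = X (n + 1) +> x n"

lemma X_carr: "x \<in> X n \<Longrightarrow> x \<in> carrier R"
  using ideal_carr[OF X_ideal] .

lemma X_Suc: "X (n + 1) \<subseteq> X n"
  by (rule X_antimono) (simp add: le_fun_def)

lemma reps_mem: "x \<in> reps \<Longrightarrow> x n \<in> X n"
  and reps_carr: "x \<in> reps \<Longrightarrow> x n \<in> carrier R"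
  using X_carr by (auto simp: reps_def)

lemma G_carrier: "carrier G = cls ` reps"
proof (intro equalityI subsetI)
  fix f assume "f \<in> carrier G"
  then have f: "\<And>n. 0 \<le> n \<Longrightarrow> f n \<in> (\<lambda>x. X (n + 1) +> x) ` X n"
    "\<And>n. \<not> 0 \<le> n \<Longrightarrow> f n = X (n + 1)" "finite {n. f n \<noteq> X (n + 1)}"
    by (auto simp: assoc_gr_def)
  \<comment> \<open>Representing zero cosets by \<open>\<zero>\<close> makes the chosen family of
    representatives finitely supported.\<close>
  have "\<exists>x. x \<in> X n \<and> f n = X (n + 1) +> x \<and> (f n = X (n + 1) \<longrightarrow> x = \<zero>)" for n
  proof (cases "f n = X (n + 1)")
    case True
    then show ?thesis using coset_zero[OF X_ideal] ideal_zero[OF X_ideal] by blast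
  next
    case False
    then show ?thesis using f(1,2) by blast
  qed
  then obtain x where x: "\<And>n. x n \<in> X n" "\<And>n. f n = X (n + 1) +> x n"
    "\<And>n. f n = X (n + 1) \<Longrightarrow> x n = \<zero>" by metis
  have "finite {n. x n \<noteq> \<zero>}" using x(3) by (intro finite_subset[OF _ f(3)]) auto
  then have "x \<in> reps" using x f(2) by (auto simp: reps_def)
  moreover have "f = cls x" using x(2) by (auto simp: cls_def)
  ultimately show "f \<in> cls ` reps" by blast
next
  fix f assume "f \<in> cls ` reps"
  then obtain x where x: "x \<in> reps" and f: "f = cls x" by blast
  have "finite {n. x n \<noteq> \<zero>}" using x by (simp add: reps_def)
  moreover have "{n. f n \<noteq> X (n + 1)} \<subseteq> {n. x n \<noteq> \<zero>}"
    using coset_zero[OF X_ideal] by (auto simp: f cls_def)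
  ultimately have "finite {n. f n \<noteq> X (n + 1)}" using finite_subset by blast
  then show "f \<in> carrier G"
    using x coset_zero[OF X_ideal] by (auto simp: f assoc_gr_def cls_def reps_def)
qed

lemma cls_in_G: "x \<in> reps \<Longrightarrow> cls x \<in> carrier G"
  using G_carrier by blast

lemma G_zero: "\<zero>\<^bsub>G\<^esub> = cls (\<lambda>n. \<zero>)"
  using coset_zero[OF X_ideal] by (auto simp: assoc_gr_def cls_def)

lemma G_add: "x \<in> reps \<Longrightarrow> y \<in> reps \<Longrightarrow> cls x \<oplus>\<^bsub>G\<^esub> cls y = cls (\<lambda>n. x n \<oplus> y n)"
  using coset_add[OF X_ideal] reps_carr by (auto simp: assoc_gr_def cls_def)

lemma reps_zero: "(\<lambda>n. \<zero>) \<in> reps"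
  using ideal_zero[OF X_ideal] by (simp add: reps_def)

lemma reps_add:
  assumes "x \<in> reps" "y \<in> reps"
  shows "(\<lambda>n. x n \<oplus> y n) \<in> reps"
proof -
  have "finite ({n. x n \<noteq> \<zero>} \<union> {n. y n \<noteq> \<zero>})" using assms by (simp add: reps_def)
  moreover have "{n. x n \<oplus> y n \<noteq> \<zero>} \<subseteq> {n. x n \<noteq> \<zero>} \<union> {n. y n \<noteq> \<zero>}" by auto
  ultimately have "finite {n. x n \<oplus> y n \<noteq> \<zero>}" by (rule finite_subset[rotated])
  then show ?thesis using assms ideal_add[OF X_ideal] by (simp add: reps_def)
qed

lemma reps_uminus:
  assumes "x \<in> reps"
  shows "(\<lambda>n. \<ominus> x n) \<in> reps"
proof -
  have "{n. \<ominus> x n \<noteq> \<zero>} \<subseteq> {n. x n \<noteq> \<zero>}" by auto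
  then have "finite {n. \<ominus> x n \<noteq> \<zero>}" using assms by (auto simp: reps_def intro: finite_subset)
  then show ?thesis using assms ideal_uminus[OF X_ideal] by (auto simp: reps_def)
qed

lemma G_uminus_add: "x \<in> reps \<Longrightarrow> cls (\<lambda>n. \<ominus> x n) \<oplus>\<^bsub>G\<^esub> cls x = \<zero>\<^bsub>G\<^esub>"
  using reps_carr by (simp add: G_add reps_uminus G_zero l_neg)

lemma G_abelian_group: "abelian_group G"
proof (rule abelian_groupI)
  fix f g h assume "f \<in> carrier G" "g \<in> carrier G" "h \<in> carrier G"
  then obtain x y z where "x \<in> reps" "y \<in> reps" "z \<in> reps" "f = cls x" "g = cls y" "h = cls z"
    using G_carrier by auto
  then show "f \<oplus>\<^bsub>G\<^esub> g \<oplus>\<^bsub>G\<^esub> h = f \<oplus>\<^bsub>G\<^esub> (g \<oplus>\<^bsub>G\<^esub> h)"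
    using reps_carr by (simp add: G_add reps_add a_assoc)
next
  fix f g assume "f \<in> carrier G" "g \<in> carrier G"
  then obtain x y where *: "x \<in> reps" "y \<in> reps" "f = cls x" "g = cls y"
    using G_carrier by auto
  then show "f \<oplus>\<^bsub>G\<^esub> g = g \<oplus>\<^bsub>G\<^esub> f" using reps_carr by (simp add: G_add a_comm)
  show "f \<oplus>\<^bsub>G\<^esub> g \<in> carrier G" using * by (simp add: G_add reps_add cls_in_G)
next
  fix f assume "f \<in> carrier G"
  then obtain x where *: "x \<in> reps" "f = cls x" using G_carrier by auto
  then show "\<zero>\<^bsub>G\<^esub> \<oplus>\<^bsub>G\<^esub> f = f" using reps_carr by (simp add: G_add G_zero reps_zero)
  show "\<exists>g\<in>carrier G. g \<oplus>\<^bsub>G\<^esub> f = \<zero>\<^bsub>G\<^esub>"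
    using * G_uminus_add reps_uminus cls_in_G by blast
qed (simp add: G_zero reps_zero cls_in_G)

sublocale G: abelian_group G
  by (rule G_abelian_group)

lemma G_uminus: "x \<in> reps \<Longrightarrow> \<ominus>\<^bsub>G\<^esub> cls x = cls (\<lambda>n. \<ominus> x n)"
  using G.minus_equality[OF G_uminus_add] cls_in_G reps_uminus by blast

definition homog :: "'s mdeg \<Rightarrow> 'a \<Rightarrow> 's mdeg \<Rightarrow> 'a"
  where "homog n x = (\<lambda>p. if p = n then x else \<zero>)"

lemma gr_elem_eq_cls: "gr_elem R X n x = cls (homog n x)"
proof
  fix p
  show "gr_elem R X n x p = cls (homog n x) p"
    using coset_zero[OF X_ideal] by (simp add: gr_elem_def cls_def homog_def)
qed

lemma homog_reps: "0 \<le> n \<Longrightarrow> x \<in> X n \<Longrightarrow> homog n x \<in> reps"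
  using ideal_zero[OF X_ideal] by (auto simp: reps_def homog_def intro: finite_subset[of _ "{n}"])

lemma gr_elem_in_G: "0 \<le> n \<Longrightarrow> x \<in> X n \<Longrightarrow> gr_elem R X n x \<in> carrier G"
  by (simp add: gr_elem_eq_cls homog_reps cls_in_G)

lemma gr_elem_add:
  assumes "0 \<le> n" "x \<in> X n" "y \<in> X n"
  shows "gr_elem R X n x \<oplus>\<^bsub>G\<^esub> gr_elem R X n y = gr_elem R X n (x \<oplus> y)"
proof -
  have "(\<lambda>p. homog n x p \<oplus> homog n y p) = homog n (x \<oplus> y)" by (auto simp: homog_def)
  then show ?thesis using assms by (simp add: gr_elem_eq_cls G_add homog_reps)
qed

lemma gr_elem_zero:
  assumes "x \<in> X (n + 1)"
  shows "gr_elem R X n x = \<zero>\<^bsub>G\<^esub>"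
proof
  fix p
  have "X (n + 1) +> x = X (n + 1) +> \<zero>"
    using assms X_carr by (intro coset_eqI X_ideal) (auto simp: a_minus_def)
  then show "gr_elem R X n x p = \<zero>\<^bsub>G\<^esub> p"
    using coset_zero[OF X_ideal] by (simp add: gr_elem_def assoc_gr_def)
qed

lemma G_comp:
  assumes "0 \<le> n"
  shows "assoc_gr_comp R X n = gr_elem R X n ` X n"
proof (intro equalityI subsetI)
  fix f assume f: "f \<in> assoc_gr_comp R X n"
  then have n: "f n \<in> (\<lambda>x. X (n + 1) +> x) ` X n" and p: "\<forall>p. p \<noteq> n \<longrightarrow> f p = X (p + 1)"
    using assms unfolding assoc_gr_comp_def assoc_gr_def by simp_all
  from n obtain x where x: "x \<in> X n" "f n = X (n + 1) +> x" by blast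
  have "f = gr_elem R X n x"
  proof
    fix q show "f q = gr_elem R X n x q" using p x(2) by (simp add: gr_elem_def)
  qed
  then show "f \<in> gr_elem R X n ` X n" using x(1) by blast
next
  fix f assume "f \<in> gr_elem R X n ` X n"
  then obtain x where x: "x \<in> X n" "f = gr_elem R X n x" by blast
  then show "f \<in> assoc_gr_comp R X n"
    using gr_elem_in_G[OF assms] unfolding assoc_gr_comp_def by (auto simp: gr_elem_def)
qed

text \<open>Meant for \<open>X (n + 1) \<subseteq> Q n\<close>: a coset is then contained in
  \<open>Q n\<close> as soon as one of its representatives is, so that families of ideals of
  \<open>R\<close> describe graded submodules.\<close>

definition sub_gr :: "('s mdeg \<Rightarrow> 'a set) \<Rightarrow> ('s mdeg \<Rightarrow> 'a set) set"
  where "sub_gr Q = {f \<in> carrier G. \<forall>n. f n \<subseteq> Q n}"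

lemma cls_in_sub_gr:
  assumes "\<And>n. ideal (Q n) R" "\<And>n. X (n + 1) \<subseteq> Q n" "x \<in> reps"
  shows "cls x \<in> sub_gr Q \<longleftrightarrow> (\<forall>n. x n \<in> Q n)"
  using coset_subset_iff[OF X_ideal assms(1,2) reps_carr[OF assms(3)]] cls_in_G[OF assms(3)]
  by (simp add: sub_gr_def cls_def)

lemma sub_gr_subgroup:
  assumes "\<And>n. ideal (Q n) R" "\<And>n. X (n + 1) \<subseteq> Q n"
  shows "subgroup (sub_gr Q) (add_monoid G)"
proof (rule subgroup.intro)
  note iff = cls_in_sub_gr[OF assms]
  have ex: "\<exists>x\<in>reps. f = cls x \<and> (\<forall>n. x n \<in> Q n)" if f: "f \<in> sub_gr Q" for f
  proof -
    have "f \<in> carrier G" using f by (simp add: sub_gr_def)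
    then obtain x where "x \<in> reps" "f = cls x" using G_carrier by blast
    then show ?thesis using f iff by blast
  qed
  show "sub_gr Q \<subseteq> carrier (add_monoid G)" by (auto simp: sub_gr_def)
  show "f \<otimes>\<^bsub>add_monoid G\<^esub> g \<in> sub_gr Q" if fg: "f \<in> sub_gr Q" "g \<in> sub_gr Q" for f g
  proof -
    obtain x y where x: "x \<in> reps" "f = cls x" "\<And>n. x n \<in> Q n"
      and y: "y \<in> reps" "g = cls y" "\<And>n. y n \<in> Q n" using ex[OF fg(1)] ex[OF fg(2)] by blast
    show ?thesis using x y ideal_add[OF assms(1)] iff[OF reps_add[OF x(1) y(1)]] by (simp add: G_add)
  qed
  show "\<one>\<^bsub>add_monoid G\<^esub> \<in> sub_gr Q"
    using iff[OF reps_zero] ideal_zero[OF assms(1)] by (simp add: G_zero)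
  show "inv\<^bsub>add_monoid G\<^esub> f \<in> sub_gr Q" if f: "f \<in> sub_gr Q" for f
  proof -
    obtain x where x: "x \<in> reps" "f = cls x" "\<And>n. x n \<in> Q n" using ex[OF f] by blast
    show ?thesis
      using x ideal_uminus[OF assms(1)] iff[OF reps_uminus[OF x(1)]] G_uminus[OF x(1)] by (simp add: a_inv_def)
  qed
qed

end

section \<open>The ring \<open>G(I)\<close> and its action on \<open>G(F)\<close>, computed on
  representatives\<close>

context ideal_filtered
begin

text \<open>Taking \<open>F\<close> to be \<open>E\<close> turns every statement on the action of
  \<open>G(I)\<close> on \<open>G(F)\<close> into one on the multiplication of \<open>G(I)\<close>,
  so each is proved once.\<close>

lemma mpow_filtered: "ideal_filtered R I E"
proof
  show "ideal_filtration R I E"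
    unfolding ideal_filtration_def
  proof (intro conjI allI impI)
    fix p q
    show "E p \<cdot> E q \<subseteq> E (p + q)"
    proof
      fix x assume "x \<in> E p \<cdot> E q"
      then show "x \<in> E (p + q)"
        by induction (rule mpow_mult ideal_add[OF mpow_ideal]; assumption)+
    qed
  qed (use mpow_ideal mpow_antimono in auto)
qed

sublocale DE: decreasing_ideals R E
  by (intro decreasing_ideals.intro cring_axioms decreasing_ideals_axioms.intro mpow_ideal mpow_antimono)

sublocale DF: decreasing_ideals R F
  by (intro decreasing_ideals.intro cring_axioms decreasing_ideals_axioms.intro F_ideal F_antimono)

text \<open>For \<open>a = e \<oplus> x\<close> and \<open>b = f \<oplus> z\<close> the difference
  of \<open>a \<otimes> b\<close> and \<open>x \<otimes> z\<close> is
  \<open>e \<otimes> (f \<oplus> z) \<oplus> x \<otimes> f\<close>, and each summand gains a step of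
  degree from \<open>E (p + 1)\<close> or \<open>F (q + 1)\<close>. Hence cosets with different
  moduli have a well-defined product.\<close>

lemma rcoset_mult_eq:
  assumes "x \<in> E p" "z \<in> F q"
  shows "[mod F (p + q + 1):] (E (p + 1) +> x) \<Otimes> (F (q + 1) +> z) = F (p + q + 1) +> (x \<otimes> z)"
proof -
  have xc: "x \<in> carrier R" and zc: "z \<in> carrier R" using assms mpow_carr F_carr by auto
  have "F (p + q + 1) +> (a \<otimes> b) = F (p + q + 1) +> (x \<otimes> z)"
    if ab: "a \<in> E (p + 1) +> x" "b \<in> F (q + 1) +> z" for a b
  proof -
    obtain e f where e: "e \<in> E (p + 1)" "a = e \<oplus> x" and f: "f \<in> F (q + 1)" "b = f \<oplus> z"
      using ab by (auto simp: a_r_coset_def')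
    have ec: "e \<in> carrier R" and fc: "f \<in> carrier R" using e f mpow_carr F_carr by auto
    have "f \<oplus> z \<in> F q" using f DF.X_Suc assms ideal_add[OF F_ideal] by blast
    then have "e \<otimes> (f \<oplus> z) \<in> F ((p + 1) + q)" using EF_mult[OF e(1)] by blast
    then have "e \<otimes> (f \<oplus> z) \<in> F (p + q + 1)" by (simp add: ac_simps)
    moreover have "x \<otimes> f \<in> F (p + q + 1)"
      using EF_mult[OF assms(1) f(1)] by (simp add: ac_simps)
    moreover have "a \<otimes> b \<ominus> x \<otimes> z = e \<otimes> (f \<oplus> z) \<oplus> x \<otimes> f"
      unfolding e f using xc zc ec fc by algebra
    ultimately have "a \<otimes> b \<ominus> x \<otimes> z \<in> F (p + q + 1)" using ideal_add[OF F_ideal] by simp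
    then show ?thesis using e f xc zc ec fc by (intro coset_eqI F_ideal) auto
  qed
  moreover have "x \<in> E (p + 1) +> x" "z \<in> F (q + 1) +> z"
    using coset_mem mpow_ideal F_ideal xc zc by auto
  ultimately show ?thesis unfolding rcoset_mult_def by blast
qed

lemma conv_mem:
  assumes "\<And>n. ideal (Q n) R" "\<And>p q. x p \<otimes> z q \<in> Q (p + q)"
  shows "conv x z n \<in> Q n"
  unfolding conv_def
proof (rule finsum_in_ideal[OF assms(1)])
  fix p show "x p \<otimes> z (n - p) \<in> Q n" using assms(2)[of p "n - p"] by simp
qed

lemma conv_reps:
  assumes x: "x \<in> DE.reps" and z: "z \<in> DF.reps"
  shows "conv x z \<in> DF.reps"
proof -
  note xc = DE.reps_carr[OF x] and zc = DF.reps_carr[OF z]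
  have "conv x z n \<in> F n" for n
  proof (rule conv_mem)
    show "ideal (F n) R" for n by (rule F_ideal)
    show "x p \<otimes> z q \<in> F (p + q)" for p q
      by (rule EF_mult[OF DE.reps_mem[OF x] DF.reps_mem[OF z]])
  qed
  moreover have "conv x z n = \<zero>" if "\<not> 0 \<le> n" for n
  proof -
    have "{0..n} = {}" using that by auto
    then show ?thesis by (simp add: conv_def)
  qed
  moreover have "conv x z n = \<zero>" if n: "n \<notin> (\<lambda>(p, q). p + q) ` ({p. x p \<noteq> \<zero>} \<times> {p. z p \<noteq> \<zero>})" for n
    unfolding conv_def
  proof (rule add.finprod_one_eqI)
    fix p
    have "x p = \<zero> \<or> z (n - p) = \<zero>"
    proof (rule ccontr)
      assume "\<not> ?thesis"
      then have "n \<in> (\<lambda>(p, q). p + q) ` ({p. x p \<noteq> \<zero>} \<times> {p. z p \<noteq> \<zero>})"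
        by (intro image_eqI[of _ _ "(p, n - p)"]) auto
      then show False using n by blast
    qed
    then show "x p \<otimes> z (n - p) = \<zero>" using xc zc by auto
  qed
  then have "{n. conv x z n \<noteq> \<zero>} \<subseteq> (\<lambda>(p, q). p + q) ` ({p. x p \<noteq> \<zero>} \<times> {p. z p \<noteq> \<zero>})" by blast
  then have "finite {n. conv x z n \<noteq> \<zero>}"
    by (rule finite_subset) (use x z in \<open>simp add: DE.reps_def DF.reps_def\<close>)
  ultimately show ?thesis by (simp add: DF.reps_def)
qed

text \<open>The canonical map onto the quotient by \<open>F (n + 1)\<close> is a ring homomorphism,
  so it commutes with the finite sum over \<open>{0..n}\<close>.\<close>

lemma gr_mult_cls:
  assumes x: "x \<in> DE.reps" and z: "z \<in> DF.reps"
  shows "gr_mult R F (DE.cls x) (DF.cls z) = DF.cls (conv x z)"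
proof
  fix n
  note xc = DE.reps_carr[OF x] and zc = DF.reps_carr[OF z]
  interpret h: ring_hom_cring R "R Quot F (n + 1)" "(+>) (F (n + 1))"
    by (rule ideal.rcos_ring_hom_cring[OF F_ideal is_cring])
  have "gr_mult R F (DE.cls x) (DF.cls z) n =
      (\<Oplus>\<^bsub>R Quot F (n + 1)\<^esub>p\<in>{0..n}. F (n + 1) +> (x p \<otimes> z (n - p)))"
    unfolding gr_mult_def
  proof (intro h.S.finsum_cong' refl)
    fix p
    show "[mod F (n + 1):] DE.cls x p \<Otimes> DF.cls z (n - p) = F (n + 1) +> (x p \<otimes> z (n - p))"
      using rcoset_mult_eq[OF DE.reps_mem[OF x] DF.reps_mem[OF z], of p "n - p"]
      by (simp add: DE.cls_def DF.cls_def)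
  qed (use xc zc in auto)
  also have "\<dots> = F (n + 1) +> (\<Oplus>p\<in>{0..n}. x p \<otimes> z (n - p))"
    using xc zc by (subst h.hom_finsum) (auto simp: comp_def)
  finally show "gr_mult R F (DE.cls x) (DF.cls z) n = DF.cls (conv x z) n"
    by (simp add: DF.cls_def conv_def)
qed

lemma smult_cls:
  "x \<in> DE.reps \<Longrightarrow> z \<in> DF.reps \<Longrightarrow> DE.cls x \<odot>\<^bsub>DF.G\<^esub> DF.cls z = DF.cls (conv x z)"
  using gr_mult_cls by (simp add: assoc_gr_def)

lemma mult_cls:
  "x \<in> DE.reps \<Longrightarrow> z \<in> DE.reps \<Longrightarrow> DE.cls x \<otimes>\<^bsub>DE.G\<^esub> DE.cls z = DE.cls (conv x z)"
  using ideal_filtered.gr_mult_cls[OF mpow_filtered] by (simp add: assoc_gr_def)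

lemma conv_reps_E: "x \<in> DE.reps \<Longrightarrow> z \<in> DE.reps \<Longrightarrow> conv x z \<in> DE.reps"
  using ideal_filtered.conv_reps[OF mpow_filtered] .

lemma one_cls: "\<one>\<^bsub>DE.G\<^esub> = DE.cls (DE.homog 0 \<one>)"
  using DE.gr_elem_eq_cls by (simp add: assoc_gr_def)

lemma conv_homog:
  assumes "0 \<le> p" "0 \<le> q" "x \<in> carrier R" "z \<in> carrier R"
  shows "conv (DE.homog p x) (DF.homog q z) = DF.homog (p + q) (x \<otimes> z)"
proof
  fix n
  show "conv (DE.homog p x) (DF.homog q z) n = DF.homog (p + q) (x \<otimes> z) n"
  proof (cases "n = p + q")
    case True
    have "conv (DE.homog p x) (DF.homog q z) n = (\<Oplus>k\<in>{0..n}. if p = k then x \<otimes> z else \<zero>)"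
      unfolding conv_def using assms True by (intro finsum_cong' refl) (auto simp: DE.homog_def DF.homog_def)
    also have "\<dots> = x \<otimes> z"
      using True assms finite_atLeastAtMost_fun by (intro add.finprod_singleton) auto
    finally show ?thesis using True by (simp add: DF.homog_def)
  next
    case False
    have "conv (DE.homog p x) (DF.homog q z) n = (\<Oplus>k\<in>{0..n}. \<zero>)"
      unfolding conv_def using assms False by (intro finsum_cong' refl) (auto simp: DE.homog_def DF.homog_def)
    then show ?thesis using False by (simp add: DF.homog_def)
  qed
qed

lemma conv_one: "x \<in> DF.reps \<Longrightarrow> conv (DE.homog 0 \<one>) x = x"
proof
  fix n assume x: "x \<in> DF.reps"
  note xc = DF.reps_carr[OF x]
  have "conv (DE.homog 0 \<one>) x n = (\<Oplus>k\<in>{0..n}. if 0 = k then x n else \<zero>)"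
    unfolding conv_def using xc by (intro finsum_cong' refl) (auto simp: DE.homog_def)
  also have "\<dots> = x n"
  proof (cases "0 \<le> n")
    case True
    then show ?thesis using xc finite_atLeastAtMost_fun by (intro add.finprod_singleton) auto
  next
    case False
    then have "{0..n} = {}" by auto
    then show ?thesis using x False by (simp add: DF.reps_def)
  qed
  finally show "conv (DE.homog 0 \<one>) x n = x n" .
qed

lemma one_reps: "DE.homog 0 \<one> \<in> DE.reps"
  by (rule DE.homog_reps) (simp_all add: mpow_zero)

lemma GE_cring: "cring DE.G"
proof (rule cringI)
  show "abelian_group DE.G" by (rule DE.G_abelian_group)
  show "comm_monoid DE.G"
  proof (rule comm_monoidI)
    fix f g h assume "f \<in> carrier DE.G" "g \<in> carrier DE.G" "h \<in> carrier DE.G"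
    then obtain x y z where xyz: "x \<in> DE.reps" "y \<in> DE.reps" "z \<in> DE.reps"
      and e: "f = DE.cls x" "g = DE.cls y" "h = DE.cls z" using DE.G_carrier by auto
    have "conv (conv x y) z = conv x (conv y z)"
      using conv_assoc[of x y z] xyz DE.reps_carr by blast
    then show "f \<otimes>\<^bsub>DE.G\<^esub> g \<otimes>\<^bsub>DE.G\<^esub> h = f \<otimes>\<^bsub>DE.G\<^esub> (g \<otimes>\<^bsub>DE.G\<^esub> h)"
      using xyz e by (simp add: mult_cls conv_reps_E)
  next
    fix f g assume "f \<in> carrier DE.G" "g \<in> carrier DE.G"
    then obtain x y where xy: "x \<in> DE.reps" "y \<in> DE.reps" and e: "f = DE.cls x" "g = DE.cls y"
      using DE.G_carrier by auto
    have "conv x y = conv y x" using conv_comm[of x y] xy DE.reps_carr by blast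
    then show "f \<otimes>\<^bsub>DE.G\<^esub> g = g \<otimes>\<^bsub>DE.G\<^esub> f" using xy e by (simp add: mult_cls)
    show "f \<otimes>\<^bsub>DE.G\<^esub> g \<in> carrier DE.G" using xy e by (simp add: mult_cls conv_reps_E DE.cls_in_G)
  next
    fix f assume "f \<in> carrier DE.G"
    then obtain x where x: "x \<in> DE.reps" and e: "f = DE.cls x" using DE.G_carrier by auto
    show "\<one>\<^bsub>DE.G\<^esub> \<otimes>\<^bsub>DE.G\<^esub> f = f"
      using x e ideal_filtered.conv_one[OF mpow_filtered x] by (simp add: one_cls mult_cls one_reps)
  qed (simp add: one_cls one_reps DE.cls_in_G)
  fix f g h assume "f \<in> carrier DE.G" "g \<in> carrier DE.G" "h \<in> carrier DE.G"
  then obtain x y z where xyz: "x \<in> DE.reps" "y \<in> DE.reps" "z \<in> DE.reps"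
    and e: "f = DE.cls x" "g = DE.cls y" "h = DE.cls z" using DE.G_carrier by auto
  have "conv (\<lambda>n. x n \<oplus> y n) z = (\<lambda>n. conv x z n \<oplus> conv y z n)"
  proof
    fix n
    have c: "x p \<in> carrier R" "y p \<in> carrier R" "z p \<in> carrier R" for p using xyz DE.reps_carr by auto
    have "conv (\<lambda>n. x n \<oplus> y n) z n = (\<Oplus>p\<in>{0..n}. x p \<otimes> z (n - p) \<oplus> y p \<otimes> z (n - p))"
      unfolding conv_def using c by (intro finsum_cong' refl) (auto simp: l_distr)
    also have "\<dots> = conv x z n \<oplus> conv y z n"
      unfolding conv_def using c by (intro finsum_addf) auto
    finally show "conv (\<lambda>n. x n \<oplus> y n) z n = conv x z n \<oplus> conv y z n" .
  qed
  then show "(f \<oplus>\<^bsub>DE.G\<^esub> g) \<otimes>\<^bsub>DE.G\<^esub> h = f \<otimes>\<^bsub>DE.G\<^esub> h \<oplus>\<^bsub>DE.G\<^esub> g \<otimes>\<^bsub>DE.G\<^esub> h"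
    using xyz e by (simp add: mult_cls DE.G_add DE.reps_add conv_reps_E)
qed

lemma smult_in_sub_gr:
  assumes Q: "\<And>n. ideal (Q n) R" "\<And>n. F (n + 1) \<subseteq> Q n"
    and x: "x \<in> DE.reps" and z: "z \<in> DF.reps" and "\<And>p q. x p \<otimes> z q \<in> Q (p + q)"
  shows "DE.cls x \<odot>\<^bsub>DF.G\<^esub> DF.cls z \<in> DF.sub_gr Q"
  using DF.cls_in_sub_gr[OF Q conv_reps[OF x z]] conv_mem[of Q, OF Q(1) assms(5)] smult_cls[OF x z] by simp

lemma sub_gr_submodule:
  assumes Q: "\<And>n. ideal (Q n) R" "\<And>n. F (n + 1) \<subseteq> Q n"
    and EQ: "\<And>p q x y. x \<in> E p \<Longrightarrow> y \<in> Q q \<Longrightarrow> x \<otimes> y \<in> Q (p + q)"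
  shows "submodule (DF.sub_gr Q) DE.G DF.G"
proof (rule submodule.intro)
  show "subgroup (DF.sub_gr Q) (add_monoid DF.G)" using DF.sub_gr_subgroup[OF Q] .
  show "submodule_axioms (DF.sub_gr Q) DE.G DF.G"
  proof
    fix b h assume b: "b \<in> carrier DE.G" and h: "h \<in> DF.sub_gr Q"
    obtain x where x: "x \<in> DE.reps" "b = DE.cls x" using b DE.G_carrier by blast
    have "h \<in> carrier DF.G" using h by (simp add: DF.sub_gr_def)
    then obtain z where z: "z \<in> DF.reps" "h = DF.cls z" using DF.G_carrier by blast
    then have "z n \<in> Q n" for n using DF.cls_in_sub_gr[OF Q] h by blast
    then show "b \<odot>\<^bsub>DF.G\<^esub> h \<in> DF.sub_gr Q"
      unfolding x(2) z(2) using EQ DE.reps_mem[OF x(1)] by (intro smult_in_sub_gr Q x(1) z(1)) blast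
  qed
qed

lemma sub_gr_ideal:
  assumes Q: "\<And>n. ideal (Q n) R" "\<And>n. E (n + 1) \<subseteq> Q n"
    and EQ: "\<And>p q x y. x \<in> E p \<Longrightarrow> y \<in> Q q \<Longrightarrow> x \<otimes> y \<in> Q (p + q)"
  shows "ideal (DE.sub_gr Q) DE.G"
proof -
  interpret GE: cring DE.G by (rule GE_cring)
  have sub: "submodule (DE.sub_gr Q) DE.G DE.G"
    by (rule ideal_filtered.sub_gr_submodule[OF mpow_filtered Q EQ])
  show ?thesis
  proof (rule idealI)
    show "ring DE.G" by (rule GE.ring_axioms)
    show "subgroup (DE.sub_gr Q) (add_monoid DE.G)" using DE.sub_gr_subgroup[OF Q] .
    fix f g assume f: "f \<in> DE.sub_gr Q" and g: "g \<in> carrier DE.G"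
    have "g \<odot>\<^bsub>DE.G\<^esub> f \<in> DE.sub_gr Q" using submodule.smult_closed[OF sub g f] .
    then show gf: "g \<otimes>\<^bsub>DE.G\<^esub> f \<in> DE.sub_gr Q" by (simp add: assoc_gr_def)
    show "f \<otimes>\<^bsub>DE.G\<^esub> g \<in> DE.sub_gr Q"
      using gf f g GE.m_comm by (simp add: DE.sub_gr_def)
  qed
qed

lemma gr_elem_smult:
  assumes "0 \<le> p" "0 \<le> q" "x \<in> E p" "z \<in> F q"
  shows "gr_elem R E p x \<odot>\<^bsub>DF.G\<^esub> gr_elem R F q z = gr_elem R F (p + q) (x \<otimes> z)"
  using assms conv_homog[OF assms(1,2)] mpow_carr F_carr
  by (simp add: DE.gr_elem_eq_cls DF.gr_elem_eq_cls smult_cls DE.homog_reps DF.homog_reps)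

text \<open>The way back from submodules of \<open>G(F)\<close> to ideals of \<open>R\<close>: ring
  elements act through degree 0, since \<open>E 0\<close> is the whole ring.\<close>

lemma homogeneous_part_ideal:
  assumes "submodule N DE.G DF.G" "0 \<le> n"
  shows "ideal {x \<in> F n. gr_elem R F n x \<in> N} R"
proof (rule ideal_intro)
  interpret N: submodule N DE.G DF.G by fact
  show "{x \<in> F n. gr_elem R F n x \<in> N} \<subseteq> carrier R" using F_carr by blast
  have "\<zero>\<^bsub>DF.G\<^esub> \<in> N" using N.one_closed by simp
  then show "\<zero> \<in> {x \<in> F n. gr_elem R F n x \<in> N}"
    using DF.gr_elem_zero ideal_zero[OF F_ideal] by simp
  show "x \<oplus> y \<in> {x \<in> F n. gr_elem R F n x \<in> N}"
    if "x \<in> {x \<in> F n. gr_elem R F n x \<in> N}" "y \<in> {x \<in> F n. gr_elem R F n x \<in> N}" for x y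
    using that N.m_closed[of "gr_elem R F n x" "gr_elem R F n y"] ideal_add[OF F_ideal]
    by (simp add: DF.gr_elem_add[OF assms(2)])
  show "r \<otimes> x \<in> {x \<in> F n. gr_elem R F n x \<in> N}"
    if r: "r \<in> carrier R" and x: "x \<in> {x \<in> F n. gr_elem R F n x \<in> N}" for r x
  proof -
    have rE: "r \<in> E 0" using r mpow_zero by simp
    have "gr_elem R E 0 r \<odot>\<^bsub>DF.G\<^esub> gr_elem R F n x \<in> N"
      using N.smult_closed DE.gr_elem_in_G[OF order_refl rE] x by blast
    then have "gr_elem R F n (r \<otimes> x) \<in> N"
      using gr_elem_smult[OF order_refl assms(2) rE, of x] x by simp
    then show ?thesis using x ideal_mult_l[OF F_ideal _ r] by simp
  qed
qed

end

section \<open>Filter-regular sequences\<close>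

lemma zero_le_one_mdeg: "(0 :: 's mdeg) \<le> 1"
  by (simp add: le_fun_def)

lemma gen_submodule_minimal: "submodule N S M \<Longrightarrow> Y \<subseteq> N \<Longrightarrow> gen_submodule S M Y \<subseteq> N"
  by (auto simp: gen_submodule_def)

lemma gen_submodule_superset: "Y \<subseteq> gen_submodule S M Y"
  by (auto simp: gen_submodule_def)

lemma gen_submodule_submodule:
  assumes "submodule N S M" "Y \<subseteq> N"
  shows "submodule (gen_submodule S M Y) S M"
proof (rule submodule.intro)
  have sg: "subgroup L (add_monoid M)" if "submodule L S M" for L using that by (rule submodule.axioms)
  show "subgroup (gen_submodule S M Y) (add_monoid M)"
  proof (rule subgroup.intro)
    show "gen_submodule S M Y \<subseteq> carrier (add_monoid M)"
      using gen_submodule_minimal[OF assms] subgroup.subset[OF sg[OF assms(1)]] by blast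
    show "x \<otimes>\<^bsub>add_monoid M\<^esub> y \<in> gen_submodule S M Y"
      if "x \<in> gen_submodule S M Y" "y \<in> gen_submodule S M Y" for x y
      using that subgroup.m_closed[OF sg] unfolding gen_submodule_def by blast
    show "\<one>\<^bsub>add_monoid M\<^esub> \<in> gen_submodule S M Y"
      using subgroup.one_closed[OF sg] unfolding gen_submodule_def by blast
    show "inv\<^bsub>add_monoid M\<^esub> x \<in> gen_submodule S M Y" if "x \<in> gen_submodule S M Y" for x
      using that subgroup.m_inv_closed[OF sg] unfolding gen_submodule_def by blast
  qed
  show "submodule_axioms (gen_submodule S M Y) S M"
  proof
    fix r x assume r: "r \<in> carrier S" and x: "x \<in> gen_submodule S M Y"
    have "r \<odot>\<^bsub>M\<^esub> x \<in> L" if L: "submodule L S M" "Y \<subseteq> L" for L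
      using submodule.smult_closed[OF L(1) r] subsetD[OF gen_submodule_minimal[OF L] x] .
    then show "r \<odot>\<^bsub>M\<^esub> x \<in> gen_submodule S M Y" by (simp add: gen_submodule_def)
  qed
qed

text \<open>If \<open>b\<close> kills the coset of \<open>x\<close>, then \<open>b \<odot> x\<close>
  lies in \<open>N\<close>, so filter-regularity can be tested on representatives. Scalar
  multiplication in \<open>quot_module\<close> is a union of cosets; \<open>smult\<close> guarantees
  that \<open>b \<odot> x\<close> belongs to its own coset and hence to this union.\<close>

lemma filter_regular_quot_moduleI:
  assumes M: "abelian_group M" and N: "submodule N S M"
    and b: "b \<in> carrier S" "b \<in> Sgr k" "0 \<le> k"
    and gr: "\<And>n. m \<le> n \<Longrightarrow> Mgr n \<subseteq> carrier M \<and> \<zero>\<^bsub>M\<^esub> \<in> Mgr n" and m: "0 \<le> m"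
    and reg: "\<And>n x. m \<le> n \<Longrightarrow> x \<in> Mgr n \<Longrightarrow> b \<odot>\<^bsub>M\<^esub> x \<in> N \<Longrightarrow> x \<in> N"
    and smult: "\<And>n x. m \<le> n \<Longrightarrow> x \<in> Mgr n \<Longrightarrow> b \<odot>\<^bsub>M\<^esub> x \<in> carrier M"
  shows "filter_regular Sgr (quot_module M N) (\<lambda>n. (\<lambda>x. N +>\<^bsub>M\<^esub> x) ` Mgr n) b"
proof -
  interpret M: abelian_group M by fact
  interpret N: submodule N S M by fact
  have "additive_subgroup N M" using N.subgroup_axioms by (rule additive_subgroupI)
  then interpret abelian_subgroup N M by (rule abelian_subgroupI3[OF _ M])
  have zN: "\<zero>\<^bsub>M\<^esub> \<in> N" by simp
  have const: "N +>\<^bsub>M\<^esub> x = N" if "x \<in> N" for x using a_rcos_const[OF that] .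
  have q: "b \<odot>\<^bsub>quot_module M N\<^esub> Y = (\<Union>x\<in>Y. N +>\<^bsub>M\<^esub> (b \<odot>\<^bsub>M\<^esub> x))" "\<zero>\<^bsub>quot_module M N\<^esub> = N" for Y
    by (simp_all add: quot_module_def)
  have "{Y \<in> (\<lambda>x. N +>\<^bsub>M\<^esub> x) ` Mgr n. b \<odot>\<^bsub>quot_module M N\<^esub> Y = \<zero>\<^bsub>quot_module M N\<^esub>} = {\<zero>\<^bsub>quot_module M N\<^esub>}"
    if n: "m \<le> n" for n
  proof (intro equalityI subsetI)
    fix Y assume "Y \<in> {Y \<in> (\<lambda>x. N +>\<^bsub>M\<^esub> x) ` Mgr n. b \<odot>\<^bsub>quot_module M N\<^esub> Y = \<zero>\<^bsub>quot_module M N\<^esub>}"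
    then obtain x where x: "x \<in> Mgr n" "Y = N +>\<^bsub>M\<^esub> x"
      and eq: "(\<Union>z\<in>Y. N +>\<^bsub>M\<^esub> (b \<odot>\<^bsub>M\<^esub> z)) = N" using q by auto
    have "x \<in> Y" using x gr[OF n] a_rcos_self by blast
    moreover have "b \<odot>\<^bsub>M\<^esub> x \<in> N +>\<^bsub>M\<^esub> (b \<odot>\<^bsub>M\<^esub> x)" using smult[OF n x(1)] a_rcos_self by blast
    ultimately have "b \<odot>\<^bsub>M\<^esub> x \<in> N" using eq by blast
    then have "x \<in> N" using reg n x by blast
    then show "Y \<in> {\<zero>\<^bsub>quot_module M N\<^esub>}" using const x q by simp
  next
    fix Y assume "Y \<in> {\<zero>\<^bsub>quot_module M N\<^esub>}"
    then have Y: "Y = N" using q by simp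
    have "N = N +>\<^bsub>M\<^esub> \<zero>\<^bsub>M\<^esub>" using const[OF zN] by simp
    then have "Y \<in> (\<lambda>x. N +>\<^bsub>M\<^esub> x) ` Mgr n" using gr[OF n] Y by blast
    moreover have "(\<Union>z\<in>N. N +>\<^bsub>M\<^esub> (b \<odot>\<^bsub>M\<^esub> z)) = N"
      using const N.smult_closed[OF b(1)] zN by auto
    ultimately show "Y \<in> {Y \<in> (\<lambda>x. N +>\<^bsub>M\<^esub> x) ` Mgr n. b \<odot>\<^bsub>quot_module M N\<^esub> Y = \<zero>\<^bsub>quot_module M N\<^esub>}"
      using Y q by simp
  qed
  then show ?thesis unfolding filter_regular_def using b m by blast
qed

text \<open>With \<open>X = F\<close>, the quotient of \<open>G(F)\<close> by the elements \<open>x\<^sup>*\<close>, \<open>x \<in> C \<subseteq> I\<^sub>1 \<cdots> I\<^sub>s\<close>, has the component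
  \<open>F(n) / quot_fam F C n\<close> in every degree \<open>n \<ge> 1\<close>.\<close>

definition (in ring) quot_fam :: "('s mdeg \<Rightarrow> 'a set) \<Rightarrow> 'a set \<Rightarrow> 's mdeg \<Rightarrow> 'a set"
  where "quot_fam X C n = X (n + 1) <+>\<^bsub>R\<^esub> (C \<cdot> X (n - 1))"

lemma (in cring) ideal_prod_mult_mem:
  assumes "ideal A R" "ideal B R" "r \<in> carrier R" "\<And>b. b \<in> B \<Longrightarrow> r \<otimes> b \<in> B'" "v \<in> A \<cdot> B"
  shows "r \<otimes> v \<in> A \<cdot> B'"
  using assms(5)
proof induction
  case (prod a b)
  have "r \<otimes> (a \<otimes> b) = a \<otimes> (r \<otimes> b)"
    using assms(3) ideal_carr[OF assms(1) prod(1)] ideal_carr[OF assms(2) prod(2)] by (simp add: m_lcomm)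
  then show ?case using ideal_prod.prod[OF prod(1) assms(4)[OF prod(2)]] by simp
next
  case (sum s1 s2)
  then have "s1 \<in> carrier R" "s2 \<in> carrier R" using ideal_prod_in_carrier[OF assms(1,2)] by auto
  then show ?case using assms(3) ideal_prod.sum[OF sum(3,4)] by (simp add: r_distr)
qed

section \<open>Quotients of \<open>G(F)\<close> by elements of degree
  \<open>(1,\<dots>,1)\<close>\<close>

context ideal_filtered
begin

context
  fixes C assumes C: "ideal C R" "C \<subseteq> E 1"
begin

lemma quot_fam_ideal: "ideal (quot_fam F C n) R"
  unfolding quot_fam_def using F_ideal C(1) by (intro add_ideals ideal_prod_is_ideal)

lemma F_Suc_sub_quot_fam: "F (n + 1) \<subseteq> quot_fam F C n"
  unfolding quot_fam_def using F_ideal F_carr C(1) by (intro ideal_sub_set_add_l ideal_prod_is_ideal) auto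

lemma prod_sub_quot_fam: "C \<cdot> F (n - 1) \<subseteq> quot_fam F C n"
  unfolding quot_fam_def using F_ideal ideal_prod_in_carrier[OF C(1) F_ideal] by (intro ideal_sub_set_add_r)

lemma prod_sub_F: "C \<cdot> F (n - 1) \<subseteq> F n"
proof
  fix x assume "x \<in> C \<cdot> F (n - 1)"
  then show "x \<in> F n"
  proof induction
    case (prod i j)
    then have "i \<otimes> j \<in> F (1 + (n - 1))" using EF_mult C(2) by blast
    then show ?case by simp
  qed (rule ideal_add[OF F_ideal])
qed

lemma quot_fam_sub: "quot_fam F C n \<subseteq> F n"
  unfolding quot_fam_def using prod_sub_F DF.X_Suc by (intro set_add_sub_ideal F_ideal) auto

lemma quot_fam_mult:
  assumes x: "x \<in> E p" and y: "y \<in> quot_fam F C q"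
  shows "x \<otimes> y \<in> quot_fam F C (p + q)"
proof -
  obtain u v where u: "u \<in> F (q + 1)" and v: "v \<in> C \<cdot> F (q - 1)" and e: "y = u \<oplus> v"
    using y by (auto simp: quot_fam_def mem_set_add_iff)
  have "x \<otimes> u \<in> F (p + (q + 1))" using EF_mult[OF x u] .
  then have "x \<otimes> u \<in> F (p + q + 1)" by (simp add: ac_simps)
  moreover have "x \<otimes> v \<in> C \<cdot> F (p + (q - 1))"
    using ideal_prod_mult_mem[OF C(1) F_ideal mpow_carr[OF x] EF_mult[OF x] v] .
  then have "x \<otimes> v \<in> C \<cdot> F (p + q - 1)" by (simp add: add_diff_eq)
  moreover have "x \<otimes> y = x \<otimes> u \<oplus> x \<otimes> v"
    unfolding e using mpow_carr[OF x] F_carr[OF u] v ideal_prod_in_carrier[OF C(1) F_ideal]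
    by (intro r_distr) auto
  ultimately show ?thesis unfolding quot_fam_def mem_set_add_iff by blast
qed

text \<open>\<open>quot_fam E C\<close> bounds the components of the ideal generated in
  \<open>G(I)\<close> by the classes of \<open>C\<close>; the product of that ideal with
  \<open>G(F)\<close> is thereby bounded by \<open>quot_fam F C\<close>.\<close>

lemma quot_fam_mult_F:
  assumes x: "x \<in> quot_fam E C p" and y: "y \<in> F q"
  shows "x \<otimes> y \<in> quot_fam F C (p + q)"
proof -
  obtain u v where u: "u \<in> E (p + 1)" and v: "v \<in> C \<cdot> E (p - 1)" and e: "x = u \<oplus> v"
    using x by (auto simp: quot_fam_def mem_set_add_iff)
  have vc: "v \<in> carrier R" using v ideal_prod_in_carrier[OF C(1) mpow_ideal] by blast
  have "u \<otimes> y \<in> F ((p + 1) + q)" using EF_mult[OF u y] .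
  then have "u \<otimes> y \<in> F (p + q + 1)" by (simp add: ac_simps)
  moreover have "y \<otimes> b \<in> F ((p - 1) + q)" if b: "b \<in> E (p - 1)" for b
    using EF_mult[OF b y] m_comm mpow_carr[OF b] F_carr[OF y] by metis
  then have "y \<otimes> v \<in> C \<cdot> F ((p - 1) + q)"
    using ideal_prod_mult_mem[OF C(1) mpow_ideal F_carr[OF y] _ v] by blast
  then have "v \<otimes> y \<in> C \<cdot> F (p + q - 1)"
    using m_comm[OF vc F_carr[OF y]] by (simp add: algebra_simps)
  moreover have "x \<otimes> y = u \<otimes> y \<oplus> v \<otimes> y"
    unfolding e using mpow_carr[OF u] F_carr[OF y] vc by (intro l_distr)
  ultimately show ?thesis unfolding quot_fam_def mem_set_add_iff by blast
qed

end

text \<open>The submodule \<open>N\<close> is caught from both sides: \<open>NQ\<close> places it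
  inside the submodule given by \<open>quot_fam\<close>, and \<open>QN\<close> returns every
  homogeneous element of that submodule in degrees at least \<open>1\<close>. There membership in
  \<open>N\<close> is a condition on ring elements, which is how \<open>reg\<close> is
  stated.\<close>

lemma quotient_filter_regular:
  assumes S: "S \<subseteq> E 1" and c: "c \<in> E 1"
    and reg: "\<exists>m. \<forall>n\<ge>m. \<forall>x\<in>F n. c \<otimes> x \<in> quot_fam F (Idl S) (n + 1) \<longrightarrow> x \<in> quot_fam F (Idl S) n"
  shows "let N = ideal_smult DE.G (Idl\<^bsub>DE.G\<^esub> (gr_elem R E 1 ` S)) DF.G in
    filter_regular (assoc_gr_comp R E) (quot_module DF.G N)
      (\<lambda>n. (\<lambda>x. N +>\<^bsub>DF.G\<^esub> x) ` assoc_gr_comp R F n) (gr_elem R E 1 c)"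
proof -
  interpret GE: cring DE.G by (rule GE_cring)
  note one0 = zero_le_one_mdeg
  have Sc: "S \<subseteq> carrier R" using S mpow_carr by blast
  define C where "C = Idl S"
  have C: "ideal C R" "C \<subseteq> E 1" and SC: "S \<subseteq> C"
    unfolding C_def using genideal_ideal[OF Sc] genideal_minimal[OF mpow_ideal S] genideal_self[OF Sc] by auto
  define K where "K = Idl\<^bsub>DE.G\<^esub> (gr_elem R E 1 ` S)"
  define B where "B = {b \<odot>\<^bsub>DF.G\<^esub> x | b x. b \<in> K \<and> x \<in> carrier DF.G}"
  define N where "N = ideal_smult DE.G K DF.G"
  have Neq: "N = gen_submodule DE.G DF.G B" by (simp add: N_def B_def ideal_smult_def)
  note Q = quot_fam_ideal[OF C] F_Suc_sub_quot_fam[OF C]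
  note QE = ideal_filtered.quot_fam_ideal[OF mpow_filtered C]
    ideal_filtered.F_Suc_sub_quot_fam[OF mpow_filtered C]
  have SG: "gr_elem R E 1 ` S \<subseteq> carrier DE.G" using S DE.gr_elem_in_G[OF one0] by blast
  have "gr_elem R E 1 ` S \<subseteq> DE.sub_gr (quot_fam E C)"
  proof
    fix f assume "f \<in> gr_elem R E 1 ` S"
    then obtain x where x: "x \<in> S" "f = gr_elem R E 1 x" by blast
    \<comment> \<open>In degree \<open>1\<close> the second factor is \<open>E 0\<close>, the whole
      ring, so the generators themselves belong to the family.\<close>
    have "x \<otimes> \<one> \<in> C \<cdot> E (1 - 1)" using x SC mpow_zero by (intro ideal_prod.prod) auto
    then have "x \<otimes> \<one> \<in> quot_fam E C 1"
      by (rule subsetD[OF ideal_filtered.prod_sub_quot_fam[OF mpow_filtered C]])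
    then have "x \<in> quot_fam E C 1" using x Sc by auto
    then have "DE.homog 1 x n \<in> quot_fam E C n" for n
      using ideal_zero[OF QE(1)] by (simp add: DE.homog_def)
    then show "f \<in> DE.sub_gr (quot_fam E C)"
      unfolding x(2) DE.gr_elem_eq_cls
      using DE.cls_in_sub_gr[OF QE DE.homog_reps[OF one0]] x S by blast
  qed
  moreover have KI: "ideal (DE.sub_gr (quot_fam E C)) DE.G"
  proof (rule sub_gr_ideal)
    show "x \<otimes> y \<in> quot_fam E C (p + q)" if "x \<in> E p" "y \<in> quot_fam E C q" for p q x y
      using ideal_filtered.quot_fam_mult[OF mpow_filtered C that] .
  qed (rule QE)+
  ultimately have KE: "K \<subseteq> DE.sub_gr (quot_fam E C)"
    unfolding K_def using GE.genideal_minimal KI by blast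
  have sub: "submodule (DF.sub_gr (quot_fam F C)) DE.G DF.G"
    by (rule sub_gr_submodule[OF Q quot_fam_mult[OF C]])
  have Bsub: "B \<subseteq> DF.sub_gr (quot_fam F C)"
  proof
    fix h assume "h \<in> B"
    then obtain b z where b: "b \<in> K" and z: "z \<in> carrier DF.G" and h: "h = b \<odot>\<^bsub>DF.G\<^esub> z"
      by (auto simp: B_def)
    have bs: "b \<in> DE.sub_gr (quot_fam E C)" using b KE by blast
    then have "b \<in> carrier DE.G" by (simp add: DE.sub_gr_def)
    then obtain x where x: "x \<in> DE.reps" "b = DE.cls x" using DE.G_carrier by blast
    obtain w where w: "w \<in> DF.reps" "z = DF.cls w" using z DF.G_carrier by blast
    have "x p \<in> quot_fam E C p" for p using DE.cls_in_sub_gr[OF QE x(1)] bs x(2) by blast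
    then show "h \<in> DF.sub_gr (quot_fam F C)"
      unfolding h x(2) w(2)
      using quot_fam_mult_F[OF C] DF.reps_mem[OF w(1)] by (intro smult_in_sub_gr Q x(1) w(1)) blast
  qed
  have subN: "submodule N DE.G DF.G" unfolding Neq by (rule gen_submodule_submodule[OF sub Bsub])
  have NQ: "N \<subseteq> DF.sub_gr (quot_fam F C)" unfolding Neq by (rule gen_submodule_minimal[OF sub Bsub])
  have BN: "B \<subseteq> N" unfolding Neq by (rule gen_submodule_superset)
  interpret N: submodule N DE.G DF.G by (rule subN)
  have QN: "gr_elem R F n x \<in> N" if n: "1 \<le> n" and x: "x \<in> quot_fam F C n" for n x
  proof -
    have n0: "0 \<le> n" "0 \<le> n - 1" using n order_trans[OF one0 n] by simp_all
    let ?W = "{x \<in> F n. gr_elem R F n x \<in> N}"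
    have W: "ideal ?W R" by (rule homogeneous_part_ideal[OF subN n0(1)])
    have CW: "v \<otimes> b \<in> ?W" if v: "v \<in> F (n - 1)" and b: "b \<in> C" for v b
    proof (rule genideal_mult_in_ideal[OF W Sc F_carr[OF v] _ b[unfolded C_def]])
      fix s assume s: "s \<in> S"
      have sE: "s \<in> E 1" and sc: "s \<in> carrier R" using s S Sc by auto
      have "gr_elem R E 1 s \<in> K" unfolding K_def using s GE.genideal_self[OF SG] by blast
      then have "gr_elem R E 1 s \<odot>\<^bsub>DF.G\<^esub> gr_elem R F (n - 1) v \<in> N"
        using BN DF.gr_elem_in_G[OF n0(2) v] unfolding B_def by blast
      then have "gr_elem R F n (s \<otimes> v) \<in> N"
        using gr_elem_smult[OF one0 n0(2) sE v] by simp
      moreover have "s \<otimes> v \<in> F n" using EF_mult[OF sE v] by simp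
      ultimately show "v \<otimes> s \<in> ?W" using m_comm[OF F_carr[OF v] sc] by simp
    qed
    have prodW: "y \<in> ?W" if "y \<in> C \<cdot> F (n - 1)" for y
      using that
    proof induction
      case (prod b v)
      then show ?case using CW[OF prod(2,1)] m_comm[OF ideal_carr[OF C(1) prod(1)] F_carr[OF prod(2)]] by simp
    qed (rule ideal_add[OF W])
    have sucW: "y \<in> ?W" if "y \<in> F (n + 1)" for y
      using that DF.gr_elem_zero DF.X_Suc N.one_closed by auto
    obtain u v where u: "u \<in> F (n + 1)" and v: "v \<in> C \<cdot> F (n - 1)" and e: "x = u \<oplus> v"
      using x by (auto simp: quot_fam_def mem_set_add_iff)
    have "x \<in> ?W" unfolding e by (rule ideal_add[OF W sucW[OF u] prodW[OF v]])
    then show ?thesis by simp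
  qed
  obtain m where m: "\<And>n x. m \<le> n \<Longrightarrow> x \<in> F n \<Longrightarrow> c \<otimes> x \<in> quot_fam F C (n + 1) \<Longrightarrow> x \<in> quot_fam F C n"
    using reg unfolding C_def by blast
  have cG: "gr_elem R E 1 c \<in> carrier DE.G" using DE.gr_elem_in_G[OF one0 c] .
  have "filter_regular (assoc_gr_comp R E) (quot_module DF.G N)
      (\<lambda>n. (\<lambda>x. N +>\<^bsub>DF.G\<^esub> x) ` assoc_gr_comp R F n) (gr_elem R E 1 c)"
  \<comment> \<open>The bound is raised to at least \<open>1\<close> so that \<open>n - 1\<close> is
    nonnegative and \<open>F (n - 1)\<close> is represented in \<open>G(F)\<close>, as
    \<open>QN\<close> demands.\<close>
  proof (rule filter_regular_quot_moduleI[OF DF.G_abelian_group subN cG _ one0, where m = "sup m 1"])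
    show "gr_elem R E 1 c \<in> assoc_gr_comp R E 1" using DE.G_comp[OF one0] c by blast
    show "0 \<le> sup m 1" by (rule le_supI2[OF one0])
    fix n assume "sup m 1 \<le> n"
    then have mn: "m \<le> n" and n1: "1 \<le> n" by auto
    have n0: "0 \<le> n" using order_trans[OF one0 n1] .
    have n10: "0 \<le> n + 1" using add_nonneg_nonneg[OF n0 one0] .
    have "\<zero>\<^bsub>DF.G\<^esub> = gr_elem R F n \<zero>" using DF.gr_elem_zero[of \<zero> n] ideal_zero[OF F_ideal] by simp
    then show "assoc_gr_comp R F n \<subseteq> carrier DF.G \<and> \<zero>\<^bsub>DF.G\<^esub> \<in> assoc_gr_comp R F n"
      unfolding DF.G_comp[OF n0] using DF.gr_elem_in_G[OF n0] ideal_zero[OF F_ideal] by auto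
    fix f assume "f \<in> assoc_gr_comp R F n"
    then obtain x where x: "x \<in> F n" "f = gr_elem R F n x" unfolding DF.G_comp[OF n0] by blast
    have cf: "gr_elem R E 1 c \<odot>\<^bsub>DF.G\<^esub> f = gr_elem R F (n + 1) (c \<otimes> x)"
      using gr_elem_smult[OF one0 n0 c x(1)] x(2) by (simp add: add.commute)
    have cx: "c \<otimes> x \<in> F (n + 1)" using EF_mult[OF c x(1)] by (simp add: add.commute)
    show "gr_elem R E 1 c \<odot>\<^bsub>DF.G\<^esub> f \<in> carrier DF.G"
      unfolding cf using DF.gr_elem_in_G[OF n10 cx] .
    assume "gr_elem R E 1 c \<odot>\<^bsub>DF.G\<^esub> f \<in> N"
    then have "DF.cls (DF.homog (n + 1) (c \<otimes> x)) \<in> DF.sub_gr (quot_fam F C)"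
      using NQ cf DF.gr_elem_eq_cls by auto
    then have "DF.homog (n + 1) (c \<otimes> x) (n + 1) \<in> quot_fam F C (n + 1)"
      using DF.cls_in_sub_gr[OF Q DF.homog_reps[OF n10 cx]] by blast
    then have "x \<in> quot_fam F C n" using m[OF mn x(1)] by (simp add: DF.homog_def)
    then show "f \<in> N" using QN[OF n1] x(2) by blast
  qed
  then show ?thesis unfolding N_def K_def Let_def .
qed

text \<open>Allows the Vandermonde argument, which takes place in \<open>R\<close>, to be applied to
  ideals of \<open>G(I)\<close>.\<close>

lemma gr_ideal_degree_one:
  assumes "ideal J DE.G"
  shows "ideal {x \<in> E 1. gr_elem R E 1 x \<in> J} R"
proof -
  have "submodule J DE.G DE.G"
  proof (rule submodule.intro)
    show "subgroup J (add_monoid DE.G)"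
      using assms by (simp add: additive_subgroup.a_subgroup ideal.axioms(1))
    show "submodule_axioms J DE.G DE.G"
      using ideal.I_l_closed[OF assms] by unfold_locales (simp add: assoc_gr_def)
  qed
  then show ?thesis
    by (rule ideal_filtered.homogeneous_part_ideal[OF mpow_filtered]) (simp add: le_fun_def)
qed

end

section \<open>Successive choice of the parameters\<close>

locale eventually_reduced = noetherian_cring R + ideal_filtered R I F
  for R :: "('a, 'b) ring_scheme" (structure) and I :: "'s::finite \<Rightarrow> 'a set" and F +
  fixes ys :: "'a list" and T :: "'a set"
  assumes fin: "finite_module (ext_rees R E) (ext_rees R F)"
    and ys: "set ys \<subseteq> E 1"
    and reduced: "\<exists>m. \<forall>n\<ge>m. (Idl (set ys)) \<cdot> F n = F (n + 1)"
    and T: "T \<subseteq> carrier R" "infinite T" "\<And>s t. s \<in> T \<Longrightarrow> t \<in> T \<Longrightarrow> s \<noteq> t \<Longrightarrow> t \<ominus> s \<in> Units R"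
begin

abbreviation c :: "'a \<Rightarrow> 'a"
  where "c t \<equiv> horner t ys"

lemma ys_carr: "set ys \<subseteq> carrier R"
  using ys mpow_carr by blast

lemma c_E: "t \<in> T \<Longrightarrow> c t \<in> E 1"
  using horner_in_ideal[OF mpow_ideal _ ys] T(1) by blast

text \<open>Filter-regularity of the element of \<open>G(I)\<close> given by \<open>c t\<close> on the quotient of \<open>G(F)\<close> by the
  elements given by \<open>c s\<close>, \<open>s \<in> S\<close>.\<close>

definition regular_over :: "'a set \<Rightarrow> 'a \<Rightarrow> bool"
  where "regular_over S t \<longleftrightarrow> (\<exists>m. \<forall>n\<ge>m. \<forall>x\<in>F n.
    c t \<otimes> x \<in> quot_fam F (Idl (c ` S)) (n + 1) \<longrightarrow> x \<in> quot_fam F (Idl (c ` S)) n)"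

text \<open>An instance of \<open>finite_irregular\<close> with \<open>quot_fam\<close> in the place
  of \<open>P\<close>. The operators are finite generating sets of the \<open>I i\<close>, placed in
  degree \<open>unit_deg i\<close>; from degree \<open>sup M m0\<close> on, both admissibility and
  the complete reduction supply the required generation.\<close>

lemma finite_not_regular_over:
  assumes S: "S \<subseteq> T"
  shows "finite {t \<in> T. \<not> regular_over S t}"
proof -
  have cS: "c ` S \<subseteq> E 1" using S c_E by blast
  then have cSc: "c ` S \<subseteq> carrier R" using mpow_carr by blast
  have C: "ideal (Idl (c ` S)) R" "Idl (c ` S) \<subseteq> E 1"
    using genideal_ideal[OF cSc] genideal_minimal[OF mpow_ideal cS] by auto
  obtain M where M: "\<And>n i J. M \<le> n \<Longrightarrow> ideal J R \<Longrightarrow>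
      (\<And>b x. b \<in> I i \<Longrightarrow> x \<in> F n \<Longrightarrow> b \<otimes> x \<in> J) \<Longrightarrow> F (n + unit_deg i) \<subseteq> J"
    using admissible_eventually_generated[OF fin] by metis
  obtain m0 where m0: "\<And>n. m0 \<le> n \<Longrightarrow> (Idl (set ys)) \<cdot> F n = F (n + 1)" using reduced by blast
  have "\<forall>i. \<exists>A. A \<subseteq> carrier R \<and> finite A \<and> I i = Idl A" using finetely_gen[OF idI] by blast
  then obtain A where A: "\<And>i. A i \<subseteq> carrier R" "\<And>i. finite (A i)" "\<And>i. I i = Idl (A i)" by metis
  have AI: "A i \<subseteq> I i" for i using genideal_self[OF A(1)] A(3) by metis
  have "finite (\<Union>i. (\<lambda>b. (b, unit_deg i)) ` A i)" using A(2) by auto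
  then obtain ops where ops: "set ops = (\<Union>i. (\<lambda>b. (b, unit_deg i)) ` A i)" using finite_list by metis
  interpret graded_ideals R E F "quot_fam F (Idl (c ` S))" ops "sup M m0" "set ys"
  proof (intro graded_ideals.intro noetherian_cring_axioms graded_ideals_axioms.intro)
    show "ideal (E n) R" "ideal (F n) R" "ideal (quot_fam F (Idl (c ` S)) n) R" for n
      using mpow_ideal F_ideal quot_fam_ideal[OF C] by auto
    show "E 0 = carrier R" by (rule mpow_zero)
    show "x \<otimes> y \<in> E (p + q)" if "x \<in> E p" "y \<in> E q" for p q x y using mpow_mult[OF that] .
    show "E (p + q) \<subseteq> E p \<cdot> E q" if "0 \<le> p" "0 \<le> q" for p q using mpow_add[OF that] by simp
    show "x \<otimes> y \<in> F (p + q)" if "x \<in> E p" "y \<in> F q" for p q x y using EF_mult[OF that] .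
    show "x \<otimes> y \<in> quot_fam F (Idl (c ` S)) (p + q)"
      if "x \<in> E p" "y \<in> quot_fam F (Idl (c ` S)) q" for p q x y using quot_fam_mult[OF C that] .
    show "quot_fam F (Idl (c ` S)) n \<subseteq> F n" for n using quot_fam_sub[OF C] .
    show "b \<in> E \<delta> \<and> 0 \<le> \<delta> \<and> \<delta> \<noteq> 0" if "(b, \<delta>) \<in> set ops" for b \<delta>
    proof -
      obtain i where "b \<in> A i" "\<delta> = unit_deg i" using \<open>(b, \<delta>) \<in> set ops\<close> ops by blast
      then show ?thesis
        using subsetD[OF AI] mpow_unit_deg[of i] unit_deg_nonneg unit_deg_nonzero by metis
    qed
    show "F n \<subseteq> J" if n: "sup M m0 \<le> n" "n \<noteq> sup M m0" and J: "ideal J R" "quot_fam F (Idl (c ` S)) n \<subseteq> J"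
      and h: "\<And>b \<delta> x. (b, \<delta>) \<in> set ops \<Longrightarrow> sup M m0 \<le> n - \<delta> \<Longrightarrow> x \<in> F (n - \<delta>) \<Longrightarrow> b \<otimes> x \<in> J" for n J
    proof -
      define m where "m = sup M m0"
      \<comment> \<open>In this coordinate \<open>n\<close> exceeds \<open>m\<close>, so stepping
        back by \<open>unit_deg i\<close> stays above \<open>m\<close>; this is why the single
        degree \<open>m\<close> suffices as a starting point.\<close>
      obtain i where i: "m i \<noteq> n i" using n(2) unfolding m_def by (metis ext)
      have mi: "m \<le> n - unit_deg i"
      proof (rule le_funI)
        fix j show "m j \<le> (n - unit_deg i) j"
          using i le_funD[OF n(1)[folded m_def], of j] by (auto simp: unit_deg_def)
      qed
      have "F ((n - unit_deg i) + unit_deg i) \<subseteq> J"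
      proof (rule M[OF _ J(1)])
        show "M \<le> n - unit_deg i" using mi unfolding m_def by (simp add: le_sup_iff)
        fix b x assume b: "b \<in> I i" and x: "x \<in> F (n - unit_deg i)"
        have "x \<otimes> b \<in> J"
        proof (rule genideal_mult_in_ideal[OF J(1) A(1) F_carr[OF x]])
          show "b \<in> Idl (A i)" using b A(3) by metis
          fix a assume a: "a \<in> A i"
          then have "(a, unit_deg i) \<in> set ops" using ops by blast
          then have "a \<otimes> x \<in> J" using h mi x unfolding m_def by blast
          then show "x \<otimes> a \<in> J" using m_comm F_carr[OF x] a A(1) by (metis subsetD)
        qed
        then show "b \<otimes> x \<in> J" using m_comm F_carr[OF x] ideal_carr[OF idI b] by metis
      qed
      then show ?thesis by simp
    qed
    show "finite (set ys)" by simp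
    show "set ys \<subseteq> E 1" by (rule ys)
    show "F (n + 1) \<subseteq> J" if n: "sup M m0 \<le> n" and J: "ideal J R"
      and h: "\<And>y x. y \<in> set ys \<Longrightarrow> x \<in> F n \<Longrightarrow> y \<otimes> x \<in> J" for n J
    proof
      fix z assume z: "z \<in> F (n + 1)"
      have "m0 \<le> n" using n by simp
      then have "z \<in> (Idl (set ys)) \<cdot> F n" using m0 z by blast
      then show "z \<in> J"
      proof induction
        case (prod b x)
        have bc: "b \<in> carrier R" using prod(1) genideal_ideal[OF ys_carr] ideal_carr by blast
        have "x \<otimes> b \<in> J"
        proof (rule genideal_mult_in_ideal[OF J ys_carr F_carr[OF prod(2)] _ prod(1)])
          fix y assume y: "y \<in> set ys"
          then show "x \<otimes> y \<in> J" using h[OF y prod(2)] m_comm F_carr[OF prod(2)] ys_carr by (metis subsetD)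
        qed
        then show ?case using m_comm[OF bc F_carr[OF prod(2)]] by simp
      qed (rule ideal_add[OF J])
    qed
  qed
  have "finite {t \<in> T. \<not> ev_regular c {t}}"
  proof (rule finite_irregular[where d = "length ys"])
    show "c t \<in> E 1" if "t \<in> T" for t using c_E that .
    fix B J x y assume B: "B \<subseteq> T" "finite B" "card B = length ys" and J: "ideal J R" and x: "x \<in> carrier R"
      and h: "\<And>t. t \<in> B \<Longrightarrow> c t \<otimes> x \<in> J" and y: "y \<in> set ys"
    \<comment> \<open>Vandermonde is applied to the colon ideal of \<open>J\<close> by
      \<open>x\<close>: it contains the values \<open>c t\<close> for \<open>t \<in> B\<close>,
      hence all coefficients \<open>ys\<close>.\<close>
    have id: "ideal {r \<in> carrier R. x \<otimes> r \<in> J} R" by (intro ideal_preimage_mult oneideal J x)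
    have "set ys \<subseteq> {r \<in> carrier R. x \<otimes> r \<in> J}"
    proof (rule vandermonde_ideal[OF id B(2,3) _ ys_carr])
      fix t assume t: "t \<in> B"
      then have tc: "c t \<in> carrier R" using B(1) T(1) ys_carr by auto
      then show "c t \<in> {r \<in> carrier R. x \<otimes> r \<in> J}" using h[OF t] m_comm[OF x tc] by simp
    next
      show "t \<ominus> s \<in> Units R" if "s \<in> B" "t \<in> B" "s \<noteq> t" for s t
        using T(3) that B(1) by blast
    qed (use B(1) T(1) in blast)
    then have "x \<otimes> y \<in> J" using y by blast
    then show "y \<otimes> x \<in> J" using m_comm x y ys_carr by (metis subsetD)
  qed
  moreover have "{t \<in> T. \<not> regular_over S t} \<subseteq> {t \<in> T. \<not> ev_regular c {t}}"
    unfolding regular_over_def ev_regular_def annihilated_def by blast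
  ultimately show ?thesis by (rule finite_subset[rotated])
qed

text \<open>Each new parameter has to avoid only the earlier ones and a finite exceptional set
  inside the infinite set \<open>T\<close>. Avoiding the earlier ones gives the injectivity that
  Vandermonde needs.\<close>

lemma regular_parameters:
  "\<exists>t. \<forall>i\<in>{1..k::nat}. t i \<in> T \<and> t i \<notin> t ` {1..<i} \<and> regular_over (t ` {1..<i}) (t i)"
proof (induction k)
  case 0
  then show ?case by simp
next
  case (Suc k)
  then obtain t where t: "\<And>i. i \<in> {1..k} \<Longrightarrow>
    t i \<in> T \<and> t i \<notin> t ` {1..<i} \<and> regular_over (t ` {1..<i}) (t i)" by blast
  let ?S = "t ` {1..<Suc k}"
  have S: "?S \<subseteq> T" using t by auto
  have "finite (?S \<union> {t \<in> T. \<not> regular_over ?S t})" using finite_not_regular_over[OF S] by simp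
  then have "T - (?S \<union> {t \<in> T. \<not> regular_over ?S t}) \<noteq> {}"
    using Diff_infinite_finite[OF _ T(2)] infinite_imp_nonempty by blast
  then obtain u where u: "u \<in> T" "u \<notin> ?S" "regular_over ?S u" by blast
  define t' where "t' = t(Suc k := u)"
  have im: "t' ` {1..<i} = t ` {1..<i}" if "i \<le> Suc k" for i
    using that unfolding t'_def by (intro image_cong) auto
  have "t' i \<in> T \<and> t' i \<notin> t' ` {1..<i} \<and> regular_over (t' ` {1..<i}) (t' i)" if i: "i \<in> {1..Suc k}" for i
  proof (cases "i = Suc k")
    case True
    then show ?thesis using im[of "Suc k"] u by (simp add: t'_def)
  next
    case False
    then have "i \<in> {1..k}" using i by auto
    then show ?thesis using t[of i] im[of i] by (simp add: t'_def)
  qed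
  then show ?case by blast
qed

text \<open>Both sides are intersections over the same ideals \<open>J\<close>. The degree-one part
  of such a \<open>J\<close> contains the values \<open>c (t j)\<close> if it contains the
  coefficients \<open>ys\<close>, and conversely by Vandermonde.\<close>

lemma Idl_gr_elem_eq:
  assumes "inj_on t {1..d}" "t ` {1..d} \<subseteq> T" "length ys = d"
  shows "Idl\<^bsub>DE.G\<^esub> (gr_elem R E 1 ` set ys) = Idl\<^bsub>DE.G\<^esub> ((\<lambda>j. gr_elem R E 1 (c (t j))) ` {1..d})"
proof -
  have "gr_elem R E 1 ` set ys \<subseteq> J \<longleftrightarrow> (\<lambda>j. gr_elem R E 1 (c (t j))) ` {1..d} \<subseteq> J"
    if J: "ideal J DE.G" for J
  proof
    let ?J = "{x \<in> E 1. gr_elem R E 1 x \<in> J}"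
    note id = gr_ideal_degree_one[OF J]
    {
      assume "gr_elem R E 1 ` set ys \<subseteq> J"
      then have "set ys \<subseteq> ?J" using ys by blast
      then show "(\<lambda>j. gr_elem R E 1 (c (t j))) ` {1..d} \<subseteq> J"
        using horner_in_ideal[OF id] assms(2) T(1) by blast
    }
    assume a: "(\<lambda>j. gr_elem R E 1 (c (t j))) ` {1..d} \<subseteq> J"
    have "set ys \<subseteq> ?J"
    proof (rule vandermonde_ideal[OF id, where A = "t ` {1..d}"])
      show "card (t ` {1..d}) = length ys" using assms by (simp add: card_image)
      show "t ` {1..d} \<subseteq> carrier R" using assms(2) T(1) by blast
      show "v \<ominus> u \<in> Units R" if "u \<in> t ` {1..d}" "v \<in> t ` {1..d}" "u \<noteq> v" for u v
        using that assms(2) T(3) by blast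
      show "c v \<in> ?J" if "v \<in> t ` {1..d}" for v using that a assms(2) c_E by blast
    qed (use ys_carr in auto)
    then show "gr_elem R E 1 ` set ys \<subseteq> J" by blast
  qed
  then show ?thesis unfolding genideal_def by (intro arg_cong[of _ _ Inter]) blast
qed

theorem filter_regular_generators:
  assumes "length ys = d"
  shows "\<exists>f. (\<forall>j\<in>{1..d}. f j \<in> Idl\<^bsub>DE.G\<^esub> (gr_elem R E 1 ` set ys) \<inter> assoc_gr_comp R E 1) \<and>
    filter_regular_seq DE.G (assoc_gr_comp R E) DF.G (assoc_gr_comp R F) d f \<and>
    Idl\<^bsub>DE.G\<^esub> (gr_elem R E 1 ` set ys) = Idl\<^bsub>DE.G\<^esub> (f ` {1..d})"
proof -
  obtain t where t: "\<And>i. i \<in> {1..d} \<Longrightarrow>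
    t i \<in> T \<and> t i \<notin> t ` {1..<i} \<and> regular_over (t ` {1..<i}) (t i)"
    using regular_parameters[of d] by blast
  have inj: "inj_on t {1..d}"
  proof (rule linorder_inj_onI)
    fix i j assume ij: "i < j" "i \<in> {1..d}" "j \<in> {1..d}"
    then have "t i \<in> t ` {1..<j}" by (intro imageI) auto
    then show "t i \<noteq> t j" using t[OF ij(3)] by metis
  qed auto
  have tT: "t ` {1..d} \<subseteq> T" using t by blast
  define f where "f j = gr_elem R E 1 (c (t j))" for j
  have eq: "Idl\<^bsub>DE.G\<^esub> (gr_elem R E 1 ` set ys) = Idl\<^bsub>DE.G\<^esub> (f ` {1..d})"
    unfolding f_def using Idl_gr_elem_eq[OF inj tT assms] .
  have cE: "c (t j) \<in> E 1" if "j \<in> {1..d}" for j using c_E t[OF that] by blast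
  note one0 = zero_le_one_mdeg
  have "filter_regular_seq DE.G (assoc_gr_comp R E) DF.G (assoc_gr_comp R F) d f"
    unfolding filter_regular_seq_def
  proof
    fix i assume i: "i \<in> {1..d}"
    let ?S = "c ` t ` {1..<i}"
    have fS: "f ` {1..<i} = gr_elem R E 1 ` ?S" unfolding f_def by (simp add: image_image)
    have "?S \<subseteq> E 1" using cE i by auto
    from quotient_filter_regular[OF this cE[OF i]] t[OF i]
    show "let N = ideal_smult DE.G (Idl\<^bsub>DE.G\<^esub> (f ` {1..<i})) DF.G in
       filter_regular (assoc_gr_comp R E) (quot_module DF.G N)
         (\<lambda>n. (\<lambda>x. N +>\<^bsub>DF.G\<^esub> x) ` assoc_gr_comp R F n) (f i)"
      unfolding fS unfolding f_def regular_over_def by blast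
  qed
  moreover have "f j \<in> Idl\<^bsub>DE.G\<^esub> (gr_elem R E 1 ` set ys) \<inter> assoc_gr_comp R E 1" if j: "j \<in> {1..d}" for j
  proof
    have "f j \<in> Idl\<^bsub>DE.G\<^esub> (f ` {1..d})" unfolding genideal_def using j by auto
    then show "f j \<in> Idl\<^bsub>DE.G\<^esub> (gr_elem R E 1 ` set ys)" unfolding eq .
    show "f j \<in> assoc_gr_comp R E 1" unfolding f_def DE.G_comp[OF one0] using cE[OF j] by blast
  qed
  ultimately show ?thesis using eq by blast
qed

end

section \<open>Local rings with infinite residue field\<close>

text \<open>In a Noetherian ring the union of a nonempty chain of ideals is one of its members, so
  Zorn's lemma applies to the proper ideals containing \<open>x\<close>.\<close>

lemma (in noetherian_cring) exists_maximalideal: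
  assumes x: "x \<in> carrier R" "x \<notin> Units R"
  shows "\<exists>M. maximalideal M R \<and> x \<in> M"
proof -
  let ?A = "{J. ideal J R \<and> x \<in> J \<and> J \<noteq> carrier R}"
  have "PIdl x \<in> ?A"
  proof -
    have "\<one> \<notin> PIdl x"
    proof
      assume "\<one> \<in> PIdl x"
      then obtain r where "r \<in> carrier R" "\<one> = r \<otimes> x" by (auto simp: cgenideal_def)
      then show False using x m_comm unfolding Units_def by force
    qed
    then have "PIdl x \<noteq> carrier R" by auto
    then show ?thesis using cgenideal_ideal[OF x(1)] cgenideal_self[OF x(1)] by simp
  qed
  then have ne: "?A \<noteq> {}" by blast
  have "\<Union>C \<in> ?A" if C: "C \<noteq> {}" "subset.chain ?A C" for C
  proof -
    have "subset.chain {J. ideal J R} C" using C(2) by (auto simp: pred_on.chain_def)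
    then have "\<Union>C \<in> C" using ideal_chain_is_trivial C(1) by blast
    then show ?thesis using C(2) unfolding pred_on.chain_def by blast
  qed
  from subset_Zorn_nonempty[OF ne this]
  obtain M where M: "M \<in> ?A" "\<forall>J\<in>?A. M \<subseteq> J \<longrightarrow> J = M" by blast
  have "maximalideal M R"
  proof (rule maximalidealI)
    show "ideal M R" "carrier R \<noteq> M" using M by auto
    show "J = M \<or> J = carrier R" if "ideal J R" "M \<subseteq> J" "J \<subseteq> carrier R" for J
      using that M by auto
  qed
  then show ?thesis using M by blast
qed

lemma (in noetherian_cring) local_ring_infinite_units:
  assumes "local_ring R \<mm>" "infinite (carrier (R Quot \<mm>))"
  shows "\<exists>T\<subseteq>carrier R. infinite T \<and> (\<forall>s\<in>T. \<forall>t\<in>T. s \<noteq> t \<longrightarrow> t \<ominus> s \<in> Units R)"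
proof -
  have unit: "x \<in> Units R" if "x \<in> carrier R" "x \<notin> \<mm>" for x
    using exists_maximalideal[of x] that assms(1) by (auto simp: local_ring_def)
  have m: "ideal \<mm> R" using assms(1) by (simp add: local_ring_def maximalideal.axioms)
  have car: "carrier (R Quot \<mm>) = (\<lambda>x. \<mm> +> x) ` carrier R" by (auto simp: FactRing_def A_RCOSETS_def')
  \<comment> \<open>One representative for each residue class: two distinct ones differ by an
    element outside the unique maximal ideal, hence by a unit.\<close>
  define T where "T = inv_into (carrier R) (\<lambda>x. \<mm> +> x) ` carrier (R Quot \<mm>)"
  have Tc: "T \<subseteq> carrier R" unfolding T_def car by (auto intro: inv_into_into)
  have "infinite T"
    unfolding T_def using assms(2) finite_imageD[OF _ inj_on_inv_into] car by (metis order_refl)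
  moreover have "t \<ominus> s \<in> Units R" if st: "s \<in> T" "t \<in> T" "s \<noteq> t" for s t
  proof (rule unit)
    show "t \<ominus> s \<in> carrier R" using st Tc by auto
    show "t \<ominus> s \<notin> \<mm>"
    proof
      assume "t \<ominus> s \<in> \<mm>"
      then have eq: "\<mm> +> t = \<mm> +> s" using st Tc by (intro coset_eqI m) auto
      have repr: "inv_into (carrier R) (\<lambda>x. \<mm> +> x) (\<mm> +> u) = u" if "u \<in> T" for u
        using that unfolding T_def car by (auto simp: f_inv_into_f[of _ "\<lambda>x. \<mm> +> x" "carrier R"])
      show False using repr[OF st(1)] repr[OF st(2)] eq st(3) by simp
    qed
  qed
  ultimately show ?thesis using Tc by blast
qed

theorem theorem3p5:
  fixes R :: "('a, 'b) ring_scheme" (structure)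
    and \<mm> :: "'a set"
    and d :: nat
    and I :: "'s::finite \<Rightarrow> 'a set"
    and F :: "'s mdeg \<Rightarrow> 'a set"
    and a :: "'s \<Rightarrow> nat \<Rightarrow> 'a"
  assumes "noetherian_ring R"
    and "local_ring R \<mm>"
    and "krull_dim R = enat d"
    and "d \<ge> 1"
    and "infinite (carrier (R Quot \<mm>))"
    and "\<And>i. primary_to R \<mm> (I i)"
    and "ideal_grade R (\<Otimes>\<^bsub>ideals_set R\<^esub>i\<in>UNIV. I i) \<ge> 1"
    and "admissible_filtration R I F"
    and "complete_reduction R I F d a"
  shows "let GI = assoc_gr R (ideal_mpow R I);
             GI_comp = assoc_gr_comp R (ideal_mpow R I);
             GF = assoc_gr R F;
             GF_comp = assoc_gr_comp R F;
             ystar = (\<lambda>j. gr_elem R (ideal_mpow R I) 1 (column_prod R a j));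
             \<aa> = Idl\<^bsub>GI\<^esub> (ystar ` {1..d})
         in \<exists>f. (\<forall>j\<in>{1..d}. f j \<in> \<aa> \<inter> GI_comp 1) \<and>
                filter_regular_seq GI GI_comp GF GF_comp d f \<and>
                \<aa> = Idl\<^bsub>GI\<^esub> (f ` {1..d})"
proof -
  have "cring R" using assms(2) unfolding local_ring_def by blast
  then interpret noetherian_cring R by (rule noetherian_cring.intro[OF assms(1)])
  have "ideal (I i) R" for i using assms(6)[of i] unfolding primary_to_def primary_ideal_def by blast
  then interpret ideal_family R I
    by (intro ideal_family.intro ideal_family_axioms.intro cring_axioms)
  have "ideal_filtration R I F" using assms(8) unfolding admissible_filtration_def by blast
  then interpret ideal_filtered R I F
    by (intro ideal_filtered.intro ideal_filtered_axioms.intro ideal_family_axioms)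
  obtain T where T: "T \<subseteq> carrier R" "infinite T" "\<And>s t. s \<in> T \<Longrightarrow> t \<in> T \<Longrightarrow> s \<noteq> t \<Longrightarrow> t \<ominus> s \<in> Units R"
    using local_ring_infinite_units[OF assms(2,5)] by metis
  \<comment> \<open>Listed in increasing order, so that \<open>horner t ys\<close> is the sum of the
    \<open>y\<^sub>j\<close> weighted by the powers of \<open>t\<close> with exponent
    \<open>j - 1\<close>.\<close>
  define ys where "ys = map (column_prod R a) [1..<Suc d]"
  have set_ys: "set ys = column_prod R a ` {1..d}" 
    unfolding ys_def by (simp add: atLeastLessThanSuc_atLeastAtMost del: upt_Suc)
  interpret eventually_reduced R I F ys T
  proof (intro eventually_reduced.intro eventually_reduced_axioms.intro
      noetherian_cring_axioms ideal_filtered_axioms T)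
    show "finite_module (ext_rees R (ideal_mpow R I)) (ext_rees R F)"
      using assms(8) by (simp add: admissible_filtration_def)
    show "set ys \<subseteq> ideal_mpow R I 1"
      unfolding set_ys column_prod_def using assms(9)
      by (auto simp: complete_reduction_def intro!: finprod_in_mpow_one)
    show "\<exists>m. \<forall>n\<ge>m. (Idl (set ys)) \<cdot> F n = F (n + 1)"
      using assms(9) unfolding set_ys complete_reduction_def by blast
  qed
  have "length ys = d" by (simp add: ys_def)
  from filter_regular_generators[OF this] show ?thesis
    unfolding Let_def set_ys image_image .
qed

end
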